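(* Let $M$ be a smooth manifold, $A\subset TM\setminus\mathbf 0$ an open conic subset with $\pi(A)=M$, and $L:A\to\mathbb R$ a pseudo-Finsler metric with fundamental tensor $g$. Then the Levi-Civita–Chern $A$-anisotropic connection of $(M,L)$ is the only torsion-free $A$-anisotropic connection whose parallel transport preserves the fundamental tensor $g$ of $L$; that is, it is the unique torsion-free $A$-anisotropic connection such that, for every smooth curve $\gamma:[a,b]\to M$ and every $v\in A\cap T_{\gamma(a)}M$ whose parallel transport is well defined along the whole of $\gamma$, $$g_{P_{a,b}(v)}\big(P^v_{a,b}(u),P^v_{a,b}(w)\big)=g_v(u,w)\qquad\text{for all }u,w\in T_{\gamma(a)}M.$$
   Context: All objects are smooth; repeated indices are summed. $\pi:TM\to M$ is the projection, $\pi_A=\pi|_A$; conic means invariant under $v\mapsto\lambda v$, $\lambda>0$. $(x,y)$ are the natural coordinates on $TU$ induced by a chart $(U,x)$. **Pseudo-Finsler metric.** A smooth function $L:A\to\mathbb R$ with $L(\lambda v)=\lambda^2L(v)$ for $\lambda>0$ and such that for every $v\in A$ the fundamental tensor $g_v(u,w)=\frac12\frac{\partial^2}{\partial t\partial s}L(v+tu+sw)|_{t=s=0}$, $u,w\in T_{\pi(v)}M$, is nondegenerate. In coordinates $g_{ij}(x,y)=\frac12\partial_{y^i}\partial_{y^j}L(x,y)$. **Anisotropic connection.** $\mathcal T^r_s(M_A)$ is the space of sections over $A$ of $\pi_A^*(\bigotimes^rTM\otimes\bigotimes^sT^*M)$; e.g. $g\in\mathcal T^0_2(M_A)$. An $A$-anisotropic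 connection is a map $\nabla:\mathfrak X(M)\times\mathfrak X(M)\to\mathcal T^1_0(M_A)$ that is additive in both entries, with $\nabla_X(fY)=(X(f)Y)\circ\pi_A+(f\circ\pi_A)\nabla_XY$ and $\nabla_{fX+hY}Z=(f\circ\pi_A)\nabla_XZ+(h\circ\pi_A)\nabla_YZ$ for $f,h\in\mathcal F(M)$. Its Christoffel symbols are the functions on $A\cap TU$ with $(\nabla_{\partial_i}\partial_j)_v=\Gamma^a_{ij}(v)\,\partial_a|_{\pi(v)}$. It is torsion-free if $\Gamma^k_{ij}=\Gamma^k_{ji}$ in every chart. The covariant derivative of $g$ is given by $$(\nabla_{\partial_k}g)_{ij}=\partial_{x^k}g_{ij}-\Gamma^l_{km}y^m\,\partial_{y^l}g_{ij}-\Gamma_{ki}^lg_{lj}-\Gamma_{kj}^lg_{il},$$ all evaluated at $(x,y)$. **Levi-Civita–Chern connection.** For a pseudo-Finsler metric $L$ there is exactly one $A$-anisotropic connection which is torsion-free and satisfies $\nabla g=0$; it is called the Levi-Civita–Chern anisotropic connection of $(M,L)$. **Parallel transport.** For a vector field $W$ along a curve $\gamma:[a,b]\to M$ with values in $A$ and a vector field $X$ along $\gamma$, $D^W_\gamma X=(\dot X^i+\Gamma^i_{jk}(W)\dot\gamma^jX^k)\partial_i$. The parallel transport of $v\in A\cap T_{\gamma(a)}M$ is well defined along $\gamma$ if there is an $A$-valued vector field $V$ along $\gamma$ (on all of $[a,b]$; it is then unique) with $V(a)=v$, $D_\gamma^VV=0$; then $P_{a,b}(v)=V(b)$, and $P^v_{a,b}:T_{\gamma(a)}M\to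 T_{\gamma(b)}M$ is given by $P^v_{a,b}(w)=W(b)$, where $W$ is the vector field along $\gamma$ with $D^V_\gamma W=0$, $W(a)=w$. *)

theory Defs
  imports "HOL-Analysis.Analysis"
begin

section \<open>Smooth maps between normed spaces\<close>

text \<open>
  \<open>Ck_on k S f\<close> is used for finite-dimensional domains and for sets \<open>S\<close> in which the
  derivative within \<open>S\<close> is unique: open sets, and relatively open subsets of an interval
  \<open>{a..b}\<close> with \<open>a < b\<close> (where it means one-sided derivatives at the end points).
\<close>

primrec Ck_on ::
  "nat \<Rightarrow> 'b::real_normed_vector set \<Rightarrow> ('b \<Rightarrow> 'c::real_normed_vector) \<Rightarrow> bool" where
  "Ck_on 0 S f \<longleftrightarrow> continuous_on S f"
| "Ck_on (Suc k) S f \<longleftrightarrow>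
     f differentiable_on S \<and>
     (\<forall>h. Ck_on k S (\<lambda>x. frechet_derivative f (at x within S) h))"

definition smooth_on ::
  "'b::real_normed_vector set \<Rightarrow> ('b \<Rightarrow> 'c::real_normed_vector) \<Rightarrow> bool" where
  "smooth_on S f \<longleftrightarrow> (\<forall>k. Ck_on k S f)"

definition partial_deriv :: "'n::finite \<Rightarrow> (real^'n \<Rightarrow> real) \<Rightarrow> real^'n \<Rightarrow> real" where
  "partial_deriv i f x = deriv (\<lambda>t. f (x + t *\<^sub>R axis i 1)) 0"


section \<open>Smooth manifolds\<close>

text \<open>
  The points of the manifold are the elements of a type \<open>'a\<close>. A chart is a pair
  of its domain \<open>U\<close> and a map whose values outside \<open>U\<close> are irrelevant. The smooth structure
  is a maximal smooth atlas; it is the argument called \<open>M\<close> below.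
\<close>

type_synonym ('a, 'n) chart = "'a set \<times> ('a \<Rightarrow> (real, 'n) vec)"

definition is_chart :: "('a::topological_space, 'n::finite) chart \<Rightarrow> bool" where
  "is_chart c \<longleftrightarrow> open (fst c) \<and> open (snd c ` fst c) \<and>
     homeomorphism (fst c) (snd c ` fst c) (snd c) (inv_into (fst c) (snd c))"

definition chart_inv :: "('a, 'n::finite) chart \<Rightarrow> real^'n \<Rightarrow> 'a" where
  "chart_inv c = inv_into (fst c) (snd c)"

definition transition :: "('a, 'n::finite) chart \<Rightarrow> ('a, 'n) chart \<Rightarrow> real^'n \<Rightarrow> real^'n" where
  "transition c c' = snd c' \<circ> chart_inv c"

definition compatible :: "('a, 'n::finite) chart \<Rightarrow> ('a, 'n) chart \<Rightarrow> bool" where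
  "compatible c c' \<longleftrightarrow>
     smooth_on (snd c ` (fst c \<inter> fst c')) (transition c c') \<and>
     smooth_on (snd c' ` (fst c \<inter> fst c')) (transition c' c)"

definition smooth_manifold ::
  "('a::{t2_space, second_countable_topology}, 'n::finite) chart set \<Rightarrow> bool" where
  "smooth_manifold M \<longleftrightarrow>
     (\<forall>c\<in>M. is_chart c) \<and>
     (\<Union>c\<in>M. fst c) = UNIV \<and>
     (\<forall>c\<in>M. \<forall>c'\<in>M. compatible c c') \<and>
     (\<forall>c. is_chart c \<and> (\<forall>c'\<in>M. compatible c c') \<longrightarrow> c \<in> M)"

definition smooth_function ::
  "('a, 'n::finite) chart set \<Rightarrow> ('a \<Rightarrow> real) \<Rightarrow> bool" where
  "smooth_function M f \<longleftrightarrow> (\<forall>c\<in>M. smooth_on (snd c ` fst c) (f \<circ> chart_inv c))"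


section \<open>The tangent bundle\<close>

text \<open>
  A tangent vector at \<open>p\<close> is the family of its component vectors with respect to all charts
  around \<open>p\<close>, related to each other by the derivatives of the transition maps. Components with
  respect to anything that is not a chart around \<open>p\<close> are set to \<open>0\<close>, so that equality of
  tangent vectors is equality of families and the linear structure is the pointwise one.
  An element of the tangent bundle is a pair of a base point and a tangent vector there.
\<close>

type_synonym ('a, 'n) tvec = "('a, 'n) chart \<Rightarrow> (real, 'n) vec"
type_synonym ('a, 'n) tbundle = "'a \<times> ('a, 'n) tvec"

definition tangent_space ::
  "('a, 'n::finite) chart set \<Rightarrow> 'a \<Rightarrow> ('a, 'n) tvec set" where
  "tangent_space M p = {\<xi>.
     (\<forall>c\<in>M. \<forall>c'\<in>M. p \<in> fst c \<and> p \<in> fst c' \<longrightarrow>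
        \<xi> c' = frechet_derivative (transition c c') (at (snd c p)) (\<xi> c)) \<and>
     (\<forall>c. \<not> (c \<in> M \<and> p \<in> fst c) \<longrightarrow> \<xi> c = 0)}"

definition tangent_bundle :: "('a, 'n::finite) chart set \<Rightarrow> ('a, 'n) tbundle set" where
  "tangent_bundle M = (SIGMA p:UNIV. tangent_space M p)"

definition tadd :: "('a, 'n::finite) tvec \<Rightarrow> ('a, 'n) tvec \<Rightarrow> ('a, 'n) tvec" where
  "tadd \<xi> \<eta> = (\<lambda>c. \<xi> c + \<eta> c)"

definition tscale :: "real \<Rightarrow> ('a, 'n::finite) tvec \<Rightarrow> ('a, 'n) tvec" where
  "tscale r \<xi> = (\<lambda>c. r *\<^sub>R \<xi> c)"

definition tzero :: "('a, 'n::finite) tvec" where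
  "tzero = (\<lambda>c. 0)"

text \<open>The tangent vector at \<open>p\<close> whose component vector in the chart \<open>c\<close> is \<open>y\<close>.\<close>

definition coord_vec ::
  "('a, 'n::finite) chart set \<Rightarrow> ('a, 'n) chart \<Rightarrow> 'a \<Rightarrow> real^'n \<Rightarrow> ('a, 'n) tvec" where
  "coord_vec M c p y = (\<lambda>c'. if c' \<in> M \<and> p \<in> fst c'
     then frechet_derivative (transition c c') (at (snd c p)) y else 0)"

definition coord_frame ::
  "('a, 'n::finite) chart set \<Rightarrow> ('a, 'n) chart \<Rightarrow> 'n \<Rightarrow> 'a \<Rightarrow> ('a, 'n) tvec" where
  "coord_frame M c i p = coord_vec M c p (axis i 1)"

text \<open>The natural coordinates \<open>(x, y)\<close> on the tangent bundle, and their inverse.\<close>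

definition to_coords ::
  "('a, 'n::finite) chart \<Rightarrow> ('a, 'n) tbundle \<Rightarrow> (real^'n) \<times> (real^'n)" where
  "to_coords c v = (snd c (fst v), snd v c)"

definition from_coords ::
  "('a, 'n::finite) chart set \<Rightarrow> ('a, 'n) chart \<Rightarrow> (real^'n) \<times> (real^'n) \<Rightarrow> ('a, 'n) tbundle" where
  "from_coords M c z = (chart_inv c (fst z), coord_vec M c (chart_inv c (fst z)) (snd z))"

definition coord_dom ::
  "('a, 'n::finite) chart \<Rightarrow> ('a, 'n) tbundle set \<Rightarrow> ((real^'n) \<times> (real^'n)) set" where
  "coord_dom c A = to_coords c ` {v \<in> A. fst v \<in> fst c}"

definition open_in_bundle ::
  "('a, 'n::finite) chart set \<Rightarrow> ('a, 'n) tbundle set \<Rightarrow> bool" where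
  "open_in_bundle M A \<longleftrightarrow> A \<subseteq> tangent_bundle M \<and> (\<forall>c\<in>M. open (coord_dom c A))"

definition fibrewise_conic :: "('a, 'n::finite) tbundle set \<Rightarrow> bool" where
  "fibrewise_conic A \<longleftrightarrow> (\<forall>p \<xi> r. (p, \<xi>) \<in> A \<and> r > 0 \<longrightarrow> (p, tscale r \<xi>) \<in> A)"

definition vector_fields ::
  "('a, 'n::finite) chart set \<Rightarrow> ('a \<Rightarrow> ('a, 'n) tvec) set" where
  "vector_fields M = {X. (\<forall>p. X p \<in> tangent_space M p) \<and>
     (\<forall>c\<in>M. smooth_on (snd c ` fst c) (\<lambda>x. X (chart_inv c x) c))}"

text \<open>The derivative \<open>\<xi>(f)\<close> at \<open>p\<close>; it does not depend on the chart that is chosen.\<close>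

definition tvec_apply ::
  "('a, 'n::finite) chart set \<Rightarrow> 'a \<Rightarrow> ('a, 'n) tvec \<Rightarrow> ('a \<Rightarrow> real) \<Rightarrow> real" where
  "tvec_apply M p \<xi> f = (let c = (SOME c. c \<in> M \<and> p \<in> fst c) in
     frechet_derivative (f \<circ> chart_inv c) (at (snd c p)) (\<xi> c))"


section \<open>Pseudo-Finsler metrics\<close>

definition fundamental_tensor ::
  "(('a, 'n::finite) tbundle \<Rightarrow> real) \<Rightarrow> ('a, 'n) tbundle \<Rightarrow> ('a, 'n) tvec \<Rightarrow> ('a, 'n) tvec \<Rightarrow> real"
where
  "fundamental_tensor L v u w = 1/2 *
     deriv (\<lambda>t. deriv (\<lambda>s. L (fst v, tadd (tadd (snd v) (tscale t u)) (tscale s w))) 0) 0"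

definition pseudo_finsler ::
  "('a, 'n::finite) chart set \<Rightarrow> ('a, 'n) tbundle set \<Rightarrow> (('a, 'n) tbundle \<Rightarrow> real) \<Rightarrow> bool" where
  "pseudo_finsler M A L \<longleftrightarrow>
     (\<forall>c\<in>M. smooth_on (coord_dom c A) (L \<circ> from_coords M c)) \<and>
     (\<forall>p \<xi> r. (p, \<xi>) \<in> A \<and> r > 0 \<longrightarrow> L (p, tscale r \<xi>) = r\<^sup>2 * L (p, \<xi>)) \<and>
     (\<forall>v\<in>A. \<forall>u\<in>tangent_space M (fst v).
        (\<forall>w\<in>tangent_space M (fst v). fundamental_tensor L v u w = 0) \<longrightarrow> u = tzero)"

definition metric_coeff ::
  "('a, 'n::finite) chart set \<Rightarrow> (('a, 'n) tbundle \<Rightarrow> real) \<Rightarrow> ('a, 'n) chart \<Rightarrow> 'n \<Rightarrow> 'n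
     \<Rightarrow> real^'n \<Rightarrow> real^'n \<Rightarrow> real" where
  "metric_coeff M L c i j x y = (let v = from_coords M c (x, y) in
     fundamental_tensor L v (coord_frame M c i (fst v)) (coord_frame M c j (fst v)))"


section \<open>Anisotropic connections\<close>

definition anisotropic_vector_fields ::
  "('a, 'n::finite) chart set \<Rightarrow> ('a, 'n) tbundle set \<Rightarrow> (('a, 'n) tbundle \<Rightarrow> ('a, 'n) tvec) set"
where
  "anisotropic_vector_fields M A = {Z. (\<forall>v\<in>A. Z v \<in> tangent_space M (fst v)) \<and>
     (\<forall>c\<in>M. smooth_on (coord_dom c A) (\<lambda>z. Z (from_coords M c z) c))}"

text \<open>
  In \<open>D X Y v\<close>, the arguments \<open>X\<close>, \<open>Y\<close> outside \<open>vector_fields M\<close> and \<open>v\<close> outside \<open>A\<close> are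
  irrelevant; equality of connections is equality on the remaining arguments.
\<close>

type_synonym ('a, 'n) operator =
  "('a \<Rightarrow> ('a, 'n) tvec) \<Rightarrow> ('a \<Rightarrow> ('a, 'n) tvec) \<Rightarrow> ('a, 'n) tbundle \<Rightarrow> ('a, 'n) tvec"

definition anisotropic_connection ::
  "('a, 'n::finite) chart set \<Rightarrow> ('a, 'n) tbundle set \<Rightarrow> ('a, 'n) operator \<Rightarrow> bool" where
  "anisotropic_connection M A D \<longleftrightarrow>
     (\<forall>X\<in>vector_fields M. \<forall>Y\<in>vector_fields M. D X Y \<in> anisotropic_vector_fields M A) \<and>
     (\<forall>X\<in>vector_fields M. \<forall>Y\<in>vector_fields M. \<forall>Z\<in>vector_fields M. \<forall>v\<in>A.
        D X (\<lambda>p. tadd (Y p) (Z p)) v = tadd (D X Y v) (D X Z v)) \<and>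
     (\<forall>X\<in>vector_fields M. \<forall>Y\<in>vector_fields M. \<forall>Z\<in>vector_fields M. \<forall>v\<in>A.
        D (\<lambda>p. tadd (X p) (Y p)) Z v = tadd (D X Z v) (D Y Z v)) \<and>
     (\<forall>X\<in>vector_fields M. \<forall>Y\<in>vector_fields M. \<forall>f. smooth_function M f \<longrightarrow> (\<forall>v\<in>A.
        D X (\<lambda>p. tscale (f p) (Y p)) v =
          tadd (tscale (tvec_apply M (fst v) (X (fst v)) f) (Y (fst v)))
               (tscale (f (fst v)) (D X Y v)))) \<and>
     (\<forall>X\<in>vector_fields M. \<forall>Y\<in>vector_fields M. \<forall>Z\<in>vector_fields M.
      \<forall>f h. smooth_function M f \<and> smooth_function M h \<longrightarrow> (\<forall>v\<in>A.
        D (\<lambda>p. tadd (tscale (f p) (X p)) (tscale (h p) (Y p))) Z v =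
          tadd (tscale (f (fst v)) (D X Z v)) (tscale (h (fst v)) (D Y Z v))))"

definition connection_eq ::
  "('a, 'n::finite) chart set \<Rightarrow> ('a, 'n) tbundle set \<Rightarrow> ('a, 'n) operator \<Rightarrow> ('a, 'n) operator
     \<Rightarrow> bool" where
  "connection_eq M A D D' \<longleftrightarrow>
     (\<forall>X\<in>vector_fields M. \<forall>Y\<in>vector_fields M. \<forall>v\<in>A. D X Y v = D' X Y v)"

text \<open>
  A connection acts on globally defined vector fields and is local in both arguments. Its value
  at \<open>v\<close> on the coordinate fields of \<open>c\<close>, which are only defined on \<open>fst c\<close>, is therefore its
  value on any global fields that agree with them near the base point of \<open>v\<close>.
  \<open>christoffel M D c v k i j\<close> is the symbol with upper index \<open>k\<close> and lower indices \<open>i j\<close>.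
\<close>

definition is_extension ::
  "('a::topological_space, 'n::finite) chart set \<Rightarrow> ('a, 'n) chart \<Rightarrow> 'n \<Rightarrow> 'a
     \<Rightarrow> ('a \<Rightarrow> ('a, 'n) tvec) \<Rightarrow> bool" where
  "is_extension M c i p X \<longleftrightarrow>
     X \<in> vector_fields M \<and> (\<forall>\<^sub>F q in nhds p. X q = coord_frame M c i q)"

definition christoffel ::
  "('a::topological_space, 'n::finite) chart set \<Rightarrow> ('a, 'n) operator \<Rightarrow> ('a, 'n) chart
     \<Rightarrow> ('a, 'n) tbundle \<Rightarrow> 'n \<Rightarrow> 'n \<Rightarrow> 'n \<Rightarrow> real" where
  "christoffel M D c v k i j =
     D (SOME X. is_extension M c i (fst v) X) (SOME Y. is_extension M c j (fst v) Y) v c $ k"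

definition torsion_free ::
  "('a::topological_space, 'n::finite) chart set \<Rightarrow> ('a, 'n) tbundle set \<Rightarrow> ('a, 'n) operator
     \<Rightarrow> bool" where
  "torsion_free M A D \<longleftrightarrow>
     (\<forall>c\<in>M. \<forall>v\<in>A. fst v \<in> fst c \<longrightarrow>
        (\<forall>i j k. christoffel M D c v k i j = christoffel M D c v k j i))"

definition cov_deriv_metric ::
  "('a::topological_space, 'n::finite) chart set \<Rightarrow> (('a, 'n) tbundle \<Rightarrow> real) \<Rightarrow> ('a, 'n) operator
     \<Rightarrow> ('a, 'n) chart \<Rightarrow> ('a, 'n) tbundle \<Rightarrow> 'n \<Rightarrow> 'n \<Rightarrow> 'n \<Rightarrow> real" where
  "cov_deriv_metric M L D c v k i j =
     (let x = fst (to_coords c v); y = snd (to_coords c v);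
          g = metric_coeff M L c; \<Gamma> = christoffel M D c v
      in partial_deriv k (\<lambda>x'. g i j x' y) x
         - (\<Sum>l\<in>UNIV. \<Sum>m\<in>UNIV. \<Gamma> l k m * y $ m * partial_deriv l (\<lambda>y'. g i j x y') y)
         - (\<Sum>l\<in>UNIV. \<Gamma> l k i * g l j x y)
         - (\<Sum>l\<in>UNIV. \<Gamma> l k j * g i l x y))"

definition metric_parallel ::
  "('a::topological_space, 'n::finite) chart set \<Rightarrow> ('a, 'n) tbundle set
     \<Rightarrow> (('a, 'n) tbundle \<Rightarrow> real) \<Rightarrow> ('a, 'n) operator \<Rightarrow> bool" where
  "metric_parallel M A L D \<longleftrightarrow>
     (\<forall>c\<in>M. \<forall>v\<in>A. fst v \<in> fst c \<longrightarrow> (\<forall>k i j. cov_deriv_metric M L D c v k i j = 0))"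

definition levi_civita_chern ::
  "('a::topological_space, 'n::finite) chart set \<Rightarrow> ('a, 'n) tbundle set
     \<Rightarrow> (('a, 'n) tbundle \<Rightarrow> real) \<Rightarrow> ('a, 'n) operator \<Rightarrow> bool" where
  "levi_civita_chern M A L D \<longleftrightarrow>
     anisotropic_connection M A D \<and> torsion_free M A D \<and> metric_parallel M A L D"


section \<open>Parallel transport\<close>

definition smooth_curve ::
  "('a::topological_space, 'n::finite) chart set \<Rightarrow> real \<Rightarrow> real \<Rightarrow> (real \<Rightarrow> 'a) \<Rightarrow> bool" where
  "smooth_curve M a b \<gamma> \<longleftrightarrow> continuous_on {a..b} \<gamma> \<and>
     (\<forall>c\<in>M. smooth_on {t \<in> {a..b}. \<gamma> t \<in> fst c} (snd c \<circ> \<gamma>))"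

definition fields_along ::
  "('a, 'n::finite) chart set \<Rightarrow> real \<Rightarrow> real \<Rightarrow> (real \<Rightarrow> 'a) \<Rightarrow> (real \<Rightarrow> ('a, 'n) tvec) set" where
  "fields_along M a b \<gamma> = {X. (\<forall>t\<in>{a..b}. X t \<in> tangent_space M (\<gamma> t)) \<and>
     (\<forall>c\<in>M. smooth_on {t \<in> {a..b}. \<gamma> t \<in> fst c} (\<lambda>t. X t c))}"

text \<open>The covariant derivative of \<open>X\<close> along \<open>\<gamma>\<close> with reference field \<open>W\<close>.\<close>

definition cov_deriv_along ::
  "('a::topological_space, 'n::finite) chart set \<Rightarrow> ('a, 'n) operator \<Rightarrow> real \<Rightarrow> real
     \<Rightarrow> (real \<Rightarrow> 'a) \<Rightarrow> (real \<Rightarrow> ('a, 'n) tvec) \<Rightarrow> (real \<Rightarrow> ('a, 'n) tvec) \<Rightarrow> real \<Rightarrow> ('a, 'n) tvec"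
where
  "cov_deriv_along M D a b \<gamma> W X t = (\<lambda>c. if c \<in> M \<and> \<gamma> t \<in> fst c then
     (\<chi> i. vector_derivative (\<lambda>s. X s c) (at t within {a..b}) $ i +
        (\<Sum>j\<in>UNIV. \<Sum>k\<in>UNIV. christoffel M D c (\<gamma> t, W t) i j k *
           vector_derivative (snd c \<circ> \<gamma>) (at t within {a..b}) $ j * X t c $ k))
     else 0)"

text \<open>\<open>V\<close> is a transport of \<open>\<xi>\<close> along \<open>\<gamma>\<close>: an \<open>A\<close>-valued field, parallel with respect to itself.\<close>

definition is_transport ::
  "('a::topological_space, 'n::finite) chart set \<Rightarrow> ('a, 'n) tbundle set \<Rightarrow> ('a, 'n) operator
     \<Rightarrow> real \<Rightarrow> real \<Rightarrow> (real \<Rightarrow> 'a) \<Rightarrow> ('a, 'n) tvec \<Rightarrow> (real \<Rightarrow> ('a, 'n) tvec) \<Rightarrow> bool" where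
  "is_transport M A D a b \<gamma> \<xi> V \<longleftrightarrow>
     V \<in> fields_along M a b \<gamma> \<and> (\<forall>t\<in>{a..b}. (\<gamma> t, V t) \<in> A) \<and> V a = \<xi> \<and>
     (\<forall>t\<in>{a..b}. cov_deriv_along M D a b \<gamma> V V t = tzero)"

definition transport_defined ::
  "('a::topological_space, 'n::finite) chart set \<Rightarrow> ('a, 'n) tbundle set \<Rightarrow> ('a, 'n) operator
     \<Rightarrow> real \<Rightarrow> real \<Rightarrow> (real \<Rightarrow> 'a) \<Rightarrow> ('a, 'n) tvec \<Rightarrow> bool" where
  "transport_defined M A D a b \<gamma> \<xi> \<longleftrightarrow> (\<exists>V. is_transport M A D a b \<gamma> \<xi> V)"

text \<open>
  The end values \<open>V b\<close> and \<open>W b\<close> are described, rather than the fields \<open>V\<close> and \<open>W\<close>, because a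
  field along \<open>\<gamma>\<close> is determined only on \<open>{a..b}\<close>.
\<close>

definition transport ::
  "('a::topological_space, 'n::finite) chart set \<Rightarrow> ('a, 'n) tbundle set \<Rightarrow> ('a, 'n) operator
     \<Rightarrow> real \<Rightarrow> real \<Rightarrow> (real \<Rightarrow> 'a) \<Rightarrow> ('a, 'n) tvec \<Rightarrow> ('a, 'n) tvec" where
  "transport M A D a b \<gamma> \<xi> = (THE \<eta>. \<exists>V. is_transport M A D a b \<gamma> \<xi> V \<and> V b = \<eta>)"

definition transport_along ::
  "('a::topological_space, 'n::finite) chart set \<Rightarrow> ('a, 'n) tbundle set \<Rightarrow> ('a, 'n) operator
     \<Rightarrow> real \<Rightarrow> real \<Rightarrow> (real \<Rightarrow> 'a) \<Rightarrow> ('a, 'n) tvec \<Rightarrow> ('a, 'n) tvec \<Rightarrow> ('a, 'n) tvec" where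
  "transport_along M A D a b \<gamma> \<xi> w = (THE \<eta>. \<exists>V W. is_transport M A D a b \<gamma> \<xi> V \<and>
     W \<in> fields_along M a b \<gamma> \<and> W a = w \<and>
     (\<forall>t\<in>{a..b}. cov_deriv_along M D a b \<gamma> V W t = tzero) \<and> W b = \<eta>)"

definition transport_preserves_metric ::
  "('a::topological_space, 'n::finite) chart set \<Rightarrow> ('a, 'n) tbundle set
     \<Rightarrow> (('a, 'n) tbundle \<Rightarrow> real) \<Rightarrow> ('a, 'n) operator \<Rightarrow> bool" where
  "transport_preserves_metric M A L D \<longleftrightarrow>
     (\<forall>a b \<gamma> \<xi>. a < b \<and> smooth_curve M a b \<gamma> \<and> (\<gamma> a, \<xi>) \<in> A \<and> transport_defined M A D a b \<gamma> \<xi> \<longrightarrow>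
        (\<forall>u\<in>tangent_space M (\<gamma> a). \<forall>w\<in>tangent_space M (\<gamma> a).
           fundamental_tensor L (\<gamma> b, transport M A D a b \<gamma> \<xi>)
             (transport_along M A D a b \<gamma> \<xi> u) (transport_along M A D a b \<gamma> \<xi> w)
           = fundamental_tensor L (\<gamma> a, \<xi>) u w))"

end

theory Submission
  imports Defs
begin

text \<open>
  In a chart, an anisotropic connection is \<open>D X Y = dY(X) + \<Gamma>\<^sub>v(X, Y)\<close> with a bilinear form
  \<open>\<Gamma>\<^sub>v\<close>; locality and the Leibniz rule, applied with bump functions, give this formula, and with it the
  transformation law of \<open>\<Gamma>\<close> between charts. If \<open>V\<close> is parallel with respect to itself along \<open>\<gamma>\<close> and \<open>W\<^sub>1\<close>,
  \<open>W\<^sub>2\<close> are parallel along \<open>V\<close>, then the derivative of \<open>g\<^sub>V(W\<^sub>1, W\<^sub>2)\<close> is \<open>(\<nabla>\<^sub>\<gamma>\<^sub>' g)\<^sub>V(W\<^sub>1, W\<^sub>2)\<close>. Hence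
  \<open>\<nabla>g = 0\<close> makes parallel transport isometric. Conversely, near every \<open>v \<in> A\<close> the nonlinear transport
  equation can be solved along a short coordinate line in any direction, and differentiating the
  preserved quantity at the initial point gives \<open>\<nabla>g = 0\<close> at \<open>v\<close>. It remains that a torsion-free connection
  with \<open>\<nabla>g = 0\<close> is unique: the difference \<open>B\<close> of two such forms \<open>\<Gamma>\<^sub>v\<close> satisfies
  \<open>2 C(B(a, y), b, d) + g(B(a, b), d) + g(b, B(a, d)) = 0\<close> with the Cartan tensor \<open>C\<close>, which vanishes when
  one argument is the vector \<open>y\<close> of fibre coordinates of \<open>v\<close>; contracting more and more slots with \<open>y\<close>
  gives \<open>B(y, y) = 0\<close>, then \<open>B(a, y) = 0\<close>, and then \<open>B = 0\<close> as for the Levi-Civita connection.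
\<close>


text \<open>The two transport equations behave differently. Transport along a given reference field
  is linear, so it exists on the whole interval; the equation of a field that is its own reference
  is nonlinear and is solved for a short time only. One direction therefore takes the self-parallel
  field from the hypothesis that transport is defined and constructs only the linear fields; the
  other needs no more than a short line through \<open>v\<close>, because it evaluates a derivative
  at the initial point. Since preservation compares end points only, that line is cut at every
  intermediate parameter to obtain a constant function. Three conventions of the definitions shape
  the rest. Transports are definite descriptions, so uniqueness must be known along curves that no
  single chart contains. Smooth fields along a curve live on a closed interval with one-sided
  derivatives, so the calculus has to cover intervals as well as open sets. Connections accept only
  global fields, so local computations are carried out on cut-off extensions.\<close>

section \<open>Calculus of smooth maps\<close>

text \<open>A property of open sets and of nondegenerate intervals that makes the derivative within the set unique.\<close>

definition thick :: "'a::euclidean_space set \<Rightarrow> bool" where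
  "thick S \<longleftrightarrow> (\<forall>x\<in>S. \<forall>i\<in>Basis. \<forall>e>0. \<exists>d. 0 < \<bar>d\<bar> \<and> \<bar>d\<bar> < e \<and> x + d *\<^sub>R i \<in> S)"

lemma thick_Int_open:
  assumes "thick S" "open U" shows "thick (S \<inter> U)"
  unfolding thick_def
proof (intro ballI allI impI)
  fix x i :: 'a and e :: real
  assume x: "x \<in> S \<inter> U" and i: "i \<in> Basis" and e: "e > 0"
  from x \<open>open U\<close> obtain r where r: "r > 0" "\<And>y. dist y x < r \<Longrightarrow> y \<in> U"
    by (auto simp: open_dist)
  from \<open>thick S\<close> x i e r obtain d where "0 < \<bar>d\<bar>" "\<bar>d\<bar> < min e r" "x + d *\<^sub>R i \<in> S"
    unfolding thick_def by (metis IntD1 min_less_iff_conj)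
  moreover have "x + d *\<^sub>R i \<in> U"
    using calculation i by (intro r) (auto simp: dist_norm)
  ultimately show "\<exists>d. 0 < \<bar>d\<bar> \<and> \<bar>d\<bar> < e \<and> x + d *\<^sub>R i \<in> S \<inter> U" by auto
qed

lemma thick_UNIV: "thick UNIV"
  unfolding thick_def
proof (intro ballI allI impI)
  fix e :: real assume "e > 0"
  then show "\<exists>d. 0 < \<bar>d\<bar> \<and> \<bar>d\<bar> < e \<and> x + d *\<^sub>R i \<in> UNIV" for x i :: 'a
    by (intro exI[of _ "e / 2"]) auto
qed

lemma thick_open: "open S \<Longrightarrow> thick S"
  using thick_Int_open[OF thick_UNIV] by simp

lemma thick_interval: "a < b \<Longrightarrow> thick {a..b::real}"
  unfolding thick_def
proof (intro ballI allI impI)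
  fix x i e :: real
  assume *: "a < b" "x \<in> {a..b}" "i \<in> Basis" "0 < e"
  show "\<exists>d. 0 < \<bar>d\<bar> \<and> \<bar>d\<bar> < e \<and> x + d *\<^sub>R i \<in> {a..b}"
  proof (cases "x < b")
    case True
    with * show ?thesis by (intro exI[of _ "min (e/2) (b - x)"]) auto
  next
    case False
    \<comment> \<open>Here \<open>x = b\<close>, so only a step to the left stays in the
      interval.\<close>
    with * show ?thesis by (intro exI[of _ "- min (e/2) (b - a)"]) auto
  qed
qed

text \<open>\<open>frechet_derivative\<close> picks some derivative; on a thick set there is only
  one, since points of the set approach \<open>x\<close> along every axis.\<close>

lemma thick_frechet_derivative:
  assumes "thick S" "x \<in> S" "(f has_derivative f') (at x within S)"
  shows "frechet_derivative f (at x within S) = f'"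
proof (rule frechet_derivative_unique_within)
  show "(f has_derivative frechet_derivative f (at x within S)) (at x within S)"
    using assms(3) differentiableI frechet_derivative_works by blast
qed (use assms in \<open>auto simp: thick_def\<close>)

lemma has_derivative_cong_on:
  "x \<in> S \<Longrightarrow> (\<And>y. y \<in> S \<Longrightarrow> f y = g y) \<Longrightarrow>
    (f has_derivative f') (at x within S) \<longleftrightarrow> (g has_derivative f') (at x within S)"
  by (auto intro: has_derivative_transform[of x S g f] has_derivative_transform[of x S f g])

lemma frechet_derivative_cong_on:
  "x \<in> S \<Longrightarrow> (\<And>y. y \<in> S \<Longrightarrow> f y = g y) \<Longrightarrow>
    frechet_derivative f (at x within S) = frechet_derivative g (at x within S)"
  unfolding frechet_derivative_def by (simp add: has_derivative_cong_on[of x S f g])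

lemma Ck_on_cong:
  "(\<And>x. x \<in> S \<Longrightarrow> f x = g x) \<Longrightarrow> Ck_on k S f \<longleftrightarrow> Ck_on k S g"
proof (induction k arbitrary: f g)
  case 0
  then show ?case by (auto cong: continuous_on_cong)
next
  case (Suc k)
  have "f differentiable_on S \<longleftrightarrow> g differentiable_on S"
    unfolding differentiable_on_def differentiable_def
    by (simp add: has_derivative_cong_on[of _ S f g] Suc.prems)
  moreover have "Ck_on k S (\<lambda>x. frechet_derivative f (at x within S) h) \<longleftrightarrow>
      Ck_on k S (\<lambda>x. frechet_derivative g (at x within S) h)" for h
    by (rule Suc.IH) (use frechet_derivative_cong_on[of _ S f g] Suc.prems in auto)
  ultimately show ?case by simp
qed

lemma smooth_on_cong:
  "(\<And>x. x \<in> S \<Longrightarrow> f x = g x) \<Longrightarrow> smooth_on S f \<longleftrightarrow> smooth_on S g"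
  unfolding smooth_on_def using Ck_on_cong by metis

text \<open>Any explicit family of derivatives may be supplied, because on a thick set it is the one
  that \<open>Ck_on\<close> refers to.\<close>

lemma Ck_on_SucI:
  assumes "thick S" "\<And>x. x \<in> S \<Longrightarrow> (f has_derivative f' x) (at x within S)"
    "\<And>h. Ck_on k S (\<lambda>x. f' x h)"
  shows "Ck_on (Suc k) S f"
proof -
  have "Ck_on k S (\<lambda>x. frechet_derivative f (at x within S) h) \<longleftrightarrow> Ck_on k S (\<lambda>x. f' x h)" for h
    by (rule Ck_on_cong) (use thick_frechet_derivative assms in metis)
  moreover have "f differentiable_on S"
    unfolding differentiable_on_def differentiable_def using assms(2) by blast
  ultimately show ?thesis using assms(3) by simp
qed

lemma Ck_on_Suc_has_derivative:
  "Ck_on (Suc k) S f \<Longrightarrow> x \<in> S \<Longrightarrow>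
    (f has_derivative frechet_derivative f (at x within S)) (at x within S)"
  by (auto simp: differentiable_on_def frechet_derivative_works)

lemma Ck_on_Suc_imp: "Ck_on (Suc k) S f \<Longrightarrow> Ck_on k S f"
proof (induction k arbitrary: f)
  case 0
  then show ?case by (auto intro: differentiable_imp_continuous_on)
next
  case (Suc k)
  then have "Ck_on k S (\<lambda>x. frechet_derivative f (at x within S) h)" for h
    by (metis Ck_on.simps(2))
  with Suc.prems show ?case by simp
qed

lemma Ck_on_continuous: "Ck_on k S f \<Longrightarrow> continuous_on S f"
  by (cases k) (auto intro: differentiable_imp_continuous_on)

lemma Ck_on_subset:
  "thick T \<Longrightarrow> T \<subseteq> S \<Longrightarrow> Ck_on k S f \<Longrightarrow> Ck_on k T f"
proof (induction k arbitrary: f)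
  case 0
  then show ?case by (auto intro: continuous_on_subset)
next
  case (Suc k)
  show ?case
  proof (rule Ck_on_SucI[where f' = "\<lambda>x. frechet_derivative f (at x within S)"])
    show "(f has_derivative frechet_derivative f (at x within S)) (at x within T)" if "x \<in> T" for x
      using Ck_on_Suc_has_derivative[OF Suc.prems(3), of x] that Suc.prems(2)
      by (auto intro: has_derivative_subset)
  qed (use Suc in auto)
qed

text \<open>Intersecting with an open neighbourhood of \<open>x\<close> does not change
  \<open>at x within S\<close>, so derivatives within the piece are derivatives within
  \<open>S\<close>.\<close>

lemma Ck_on_locally:
  assumes "thick S" "\<And>x. x \<in> S \<Longrightarrow> \<exists>U. open U \<and> x \<in> U \<and> Ck_on k (S \<inter> U) f"
  shows "Ck_on k S f"
  using assms(2)
proof (induction k arbitrary: f)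
  case 0
  show ?case
    unfolding Ck_on.simps continuous_on_eq_continuous_within
  proof
    fix x assume "x \<in> S"
    with 0[of x] obtain U where "open U" "x \<in> U" "continuous_on (S \<inter> U) f" by auto
    then have "continuous (at x within S \<inter> U) f"
      using \<open>x \<in> S\<close> by (simp add: continuous_on_eq_continuous_within)
    moreover have "at x within S \<inter> U = at x within S"
      by (rule at_within_nhd[of x U]) (use \<open>open U\<close> \<open>x \<in> U\<close> in auto)
    ultimately show "continuous (at x within S) f" by simp
  qed
next
  case (Suc k)
  have eq: "at x within S \<inter> U = at x within S" if "open U" "x \<in> U" for x U
    by (rule at_within_nhd[of x U]) (use that in auto)
  show ?case
  proof (rule Ck_on_SucI[OF \<open>thick S\<close>, where f' = "\<lambda>x. frechet_derivative f (at x within S)"])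
    fix x assume "x \<in> S"
    then obtain U where U: "open U" "x \<in> U" "Ck_on (Suc k) (S \<inter> U) f" using Suc.prems by blast
    show "(f has_derivative frechet_derivative f (at x within S)) (at x within S)"
      using Ck_on_Suc_has_derivative[OF U(3), of x] eq[OF U(1,2)] U \<open>x \<in> S\<close> by simp
  next
    fix h
    show "Ck_on k S (\<lambda>x. frechet_derivative f (at x within S) h)"
    proof (rule Suc.IH)
      fix x assume "x \<in> S"
      then obtain U where U: "open U" "x \<in> U" "Ck_on (Suc k) (S \<inter> U) f" using Suc.prems by blast
      have "Ck_on k (S \<inter> U) (\<lambda>x. frechet_derivative f (at x within S \<inter> U) h)" using U(3) by simp
      then have "Ck_on k (S \<inter> U) (\<lambda>x. frechet_derivative f (at x within S) h)"
        by (rule Ck_on_cong[THEN iffD1, rotated]) (use eq[OF U(1)] in simp)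
      with U show "\<exists>U. open U \<and> x \<in> U \<and> Ck_on k (S \<inter> U) (\<lambda>x. frechet_derivative f (at x within S) h)"
        by blast
    qed
  qed
qed

lemma smooth_on_locally:
  assumes "thick S" "\<And>x. x \<in> S \<Longrightarrow> \<exists>U. open U \<and> x \<in> U \<and> smooth_on (S \<inter> U) f"
  shows "smooth_on S f"
  using assms Ck_on_locally unfolding smooth_on_def by metis

lemma smooth_on_subset: "smooth_on S f \<Longrightarrow> thick T \<Longrightarrow> T \<subseteq> S \<Longrightarrow> smooth_on T f"
  unfolding smooth_on_def using Ck_on_subset by metis

lemma smooth_on_continuous: "smooth_on S f \<Longrightarrow> continuous_on S f"
  unfolding smooth_on_def using Ck_on_continuous by metis

lemma smooth_on_has_derivative:
  "smooth_on S f \<Longrightarrow> x \<in> S \<Longrightarrow>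
    (f has_derivative frechet_derivative f (at x within S)) (at x within S)"
  unfolding smooth_on_def using Ck_on_Suc_has_derivative by blast

lemma smooth_on_open_has_derivative:
  "smooth_on S f \<Longrightarrow> open S \<Longrightarrow> x \<in> S \<Longrightarrow> (f has_derivative frechet_derivative f (at x)) (at x)"
  using smooth_on_has_derivative[of S f x] at_within_open[of x S] by simp

lemma smooth_on_frechet_derivative:
  "smooth_on S f \<Longrightarrow> smooth_on S (\<lambda>x. frechet_derivative f (at x within S) h)"
  unfolding smooth_on_def by (metis Ck_on.simps(2))

lemma smooth_on_open_frechet_derivative:
  assumes "smooth_on S f" "open S" shows "smooth_on S (\<lambda>x. frechet_derivative f (at x) h)"
proof -
  have "smooth_on S (\<lambda>x. frechet_derivative f (at x within S) h)"
    by (rule smooth_on_frechet_derivative[OF assms(1)])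
  then show ?thesis
    by (rule smooth_on_cong[THEN iffD1, rotated]) (simp add: at_within_open_NO_MATCH \<open>open S\<close>)
qed

lemma Ck_on_const: "thick S \<Longrightarrow> Ck_on k S (\<lambda>x. c)"
proof (induction k arbitrary: c)
  case (Suc k)
  then show ?case by (intro Ck_on_SucI[where f' = "\<lambda>x h. 0"]) auto
qed auto

lemma Ck_on_bounded_linear: "thick S \<Longrightarrow> bounded_linear f \<Longrightarrow> Ck_on k S f"
proof (cases k)
  case (Suc k')
  assume "thick S" "bounded_linear f"
  then show ?thesis unfolding Suc
    by (intro Ck_on_SucI[where f' = "\<lambda>x. f"] Ck_on_const bounded_linear_imp_has_derivative) auto
qed (auto intro: linear_continuous_on)

lemma Ck_on_bounded_linear_compose:
  "thick S \<Longrightarrow> bounded_linear g \<Longrightarrow> Ck_on k S f \<Longrightarrow> Ck_on k S (\<lambda>x. g (f x))"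
proof (induction k arbitrary: f)
  case 0
  then show ?case by (auto intro: continuous_on_compose2[OF linear_continuous_on])
next
  case (Suc k)
  show ?case
  proof (rule Ck_on_SucI[where f' = "\<lambda>x h. g (frechet_derivative f (at x within S) h)"])
    show "((\<lambda>x. g (f x)) has_derivative (\<lambda>h. g (frechet_derivative f (at x within S) h))) (at x within S)"
      if "x \<in> S" for x
      by (intro bounded_linear.has_derivative[OF Suc.prems(2)] Ck_on_Suc_has_derivative[OF Suc.prems(3) that])
  qed (use Suc in auto)
qed

lemma Ck_on_add:
  "thick S \<Longrightarrow> Ck_on k S f \<Longrightarrow> Ck_on k S g \<Longrightarrow> Ck_on k S (\<lambda>x. f x + g x)"
proof (induction k arbitrary: f g)
  case 0
  then show ?case by (auto intro: continuous_on_add)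
next
  case (Suc k)
  show ?case
    by (rule Ck_on_SucI[where f' = "\<lambda>x h. frechet_derivative f (at x within S) h
          + frechet_derivative g (at x within S) h"])
       (use Suc in \<open>auto intro!: has_derivative_add Ck_on_Suc_has_derivative\<close>)
qed

lemma Ck_on_sum:
  "thick S \<Longrightarrow> (\<And>i. i \<in> I \<Longrightarrow> Ck_on k S (f i)) \<Longrightarrow> Ck_on k S (\<lambda>x. \<Sum>i\<in>I. f i x)"
  by (induction I rule: infinite_finite_induct) (auto intro: Ck_on_add Ck_on_const)

text \<open>The product rule yields two products of lower order, hence the induction with both
  factors arbitrary.\<close>

lemma Ck_on_bounded_bilinear:
  "thick S \<Longrightarrow> bounded_bilinear B \<Longrightarrow> Ck_on k S f \<Longrightarrow> Ck_on k S g \<Longrightarrow> Ck_on k S (\<lambda>x. B (f x) (g x))"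
proof (induction k arbitrary: f g)
  case 0
  then show ?case by (auto intro: bounded_bilinear.continuous_on)
next
  case (Suc k)
  have f: "Ck_on k S f" "Ck_on k S (\<lambda>x. frechet_derivative f (at x within S) h)" for h
    using Suc.prems Ck_on_Suc_imp by auto
  have g: "Ck_on k S g" "Ck_on k S (\<lambda>x. frechet_derivative g (at x within S) h)" for h
    using Suc.prems Ck_on_Suc_imp by auto
  show ?case
  proof (rule Ck_on_SucI[where f' = "\<lambda>x h. B (f x) (frechet_derivative g (at x within S) h)
        + B (frechet_derivative f (at x within S) h) (g x)"])
    fix x assume "x \<in> S"
    then show "((\<lambda>x. B (f x) (g x)) has_derivative (\<lambda>h. B (f x) (frechet_derivative g (at x within S) h)
        + B (frechet_derivative f (at x within S) h) (g x))) (at x within S)"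
      using Suc.prems by (intro bounded_bilinear.FDERIV Ck_on_Suc_has_derivative)
  next
    show "Ck_on k S (\<lambda>x. B (f x) (frechet_derivative g (at x within S) h)
        + B (frechet_derivative f (at x within S) h) (g x))" for h
      using Suc f g by (intro Ck_on_add Suc.IH)
  qed fact
qed

text \<open>By the chain rule the derivative is a linear map at a moving point applied to a moving
  vector, which is no composition. Expanded over \<open>Basis\<close>, it is a sum of products of a
  component of the derivative of \<open>f\<close> with a composition to which the induction
  hypothesis applies.\<close>

lemma Ck_on_compose:
  fixes f :: "'a::euclidean_space \<Rightarrow> 'b::euclidean_space" and g :: "'b \<Rightarrow> 'c::real_normed_vector"
  shows "thick S \<Longrightarrow> f ` S \<subseteq> T \<Longrightarrow> Ck_on k S f \<Longrightarrow> Ck_on k T g \<Longrightarrow> Ck_on k S (\<lambda>x. g (f x))"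
proof (induction k arbitrary: g)
  case 0
  then show ?case by (auto intro: continuous_on_compose2)
next
  case (Suc k)
  let ?f' = "\<lambda>x. frechet_derivative f (at x within S)"
  let ?g' = "\<lambda>x. frechet_derivative g (at x within T)"
  have lin: "bounded_linear (?g' (f x))" if "x \<in> S" for x
    by (rule has_derivative_bounded_linear[OF Ck_on_Suc_has_derivative]) (use Suc.prems that in blast)+
  show ?case
  proof (rule Ck_on_SucI[where f' = "\<lambda>x h. ?g' (f x) (?f' x h)"])
    fix x assume "x \<in> S"
    show "((\<lambda>x. g (f x)) has_derivative (\<lambda>h. ?g' (f x) (?f' x h))) (at x within S)"
      by (rule has_derivative_in_compose2[where g' = ?g' and t = T,
            OF Ck_on_Suc_has_derivative[OF Suc.prems(4)] Suc.prems(2) \<open>x \<in> S\<close>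
            Ck_on_Suc_has_derivative[OF Suc.prems(3) \<open>x \<in> S\<close>]])
  next
    fix h
    have f: "Ck_on k S f" by (rule Ck_on_Suc_imp[OF Suc.prems(3)])
    have g: "Ck_on k S (\<lambda>x. ?g' (f x) b)" for b
      by (rule Suc.IH[OF Suc.prems(1,2) f]) (use Suc.prems(4) in simp)
    have "Ck_on k S (\<lambda>x. ?f' x h \<bullet> b)" for b
      by (rule Ck_on_bounded_linear_compose[OF Suc.prems(1) bounded_linear_inner_left])
         (use Suc.prems(3) in simp)
    then have "Ck_on k S (\<lambda>x. \<Sum>b\<in>Basis. (?f' x h \<bullet> b) *\<^sub>R ?g' (f x) b)"
      by (intro Ck_on_sum Suc.prems(1) Ck_on_bounded_bilinear[OF _ bounded_bilinear_scaleR] g)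
    then show "Ck_on k S (\<lambda>x. ?g' (f x) (?f' x h))"
    proof (rule Ck_on_cong[THEN iffD1, rotated])
      fix x assume "x \<in> S"
      have "?g' (f x) (?f' x h) = ?g' (f x) (\<Sum>b\<in>Basis. (?f' x h \<bullet> b) *\<^sub>R b)"
        by (simp add: euclidean_representation)
      also have "\<dots> = (\<Sum>b\<in>Basis. (?f' x h \<bullet> b) *\<^sub>R ?g' (f x) b)"
        using lin[OF \<open>x \<in> S\<close>] by (simp add: linear_sum linear_cmul bounded_linear.linear)
      finally show "(\<Sum>b\<in>Basis. (?f' x h \<bullet> b) *\<^sub>R ?g' (f x) b) = ?g' (f x) (?f' x h)" by simp
    qed
  qed fact
qed

section \<open>Closure properties of smooth maps\<close>

lemma smooth_on_const [intro]: "thick S \<Longrightarrow> smooth_on S (\<lambda>x. c)"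
  by (simp add: smooth_on_def Ck_on_const)

lemma smooth_on_bounded_linear: "thick S \<Longrightarrow> bounded_linear f \<Longrightarrow> smooth_on S f"
  by (simp add: smooth_on_def Ck_on_bounded_linear)

lemma smooth_on_bounded_linear_compose:
  "bounded_linear g \<Longrightarrow> thick S \<Longrightarrow> smooth_on S f \<Longrightarrow> smooth_on S (\<lambda>x. g (f x))"
  by (simp add: smooth_on_def Ck_on_bounded_linear_compose)

lemma smooth_on_add:
  "thick S \<Longrightarrow> smooth_on S f \<Longrightarrow> smooth_on S g \<Longrightarrow> smooth_on S (\<lambda>x. f x + g x)"
  by (simp add: smooth_on_def Ck_on_add)

lemma smooth_on_sum:
  "thick S \<Longrightarrow> (\<And>i. i \<in> I \<Longrightarrow> smooth_on S (f i)) \<Longrightarrow> smooth_on S (\<lambda>x. \<Sum>i\<in>I. f i x)"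
  by (simp add: smooth_on_def Ck_on_sum)

lemma smooth_on_bounded_bilinear:
  "bounded_bilinear B \<Longrightarrow> thick S \<Longrightarrow> smooth_on S f \<Longrightarrow> smooth_on S g \<Longrightarrow>
    smooth_on S (\<lambda>x. B (f x) (g x))"
  by (simp add: smooth_on_def Ck_on_bounded_bilinear)

lemmas smooth_on_scaleR = smooth_on_bounded_bilinear[OF bounded_bilinear_scaleR]
lemmas smooth_on_mult = smooth_on_bounded_bilinear[OF bounded_bilinear_mult]
lemmas smooth_on_inner = smooth_on_bounded_bilinear[OF bounded_bilinear_inner]

lemma smooth_on_compose:
  fixes f :: "'a::euclidean_space \<Rightarrow> 'b::euclidean_space" and g :: "'b \<Rightarrow> 'c::real_normed_vector"
  shows "smooth_on T g \<Longrightarrow> smooth_on S f \<Longrightarrow> thick S \<Longrightarrow> f ` S \<subseteq> T \<Longrightarrow> smooth_on S (\<lambda>x. g (f x))"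
  unfolding smooth_on_def using Ck_on_compose by metis

lemma smooth_on_ident: "thick S \<Longrightarrow> smooth_on S (\<lambda>x. x)"
  by (intro smooth_on_bounded_linear bounded_linear_ident)

lemma smooth_on_uminus: "thick S \<Longrightarrow> smooth_on S f \<Longrightarrow> smooth_on S (\<lambda>x. - f x)"
  by (intro smooth_on_bounded_linear_compose[OF bounded_linear_minus[OF bounded_linear_ident]])

lemma smooth_on_diff:
  "thick S \<Longrightarrow> smooth_on S f \<Longrightarrow> smooth_on S g \<Longrightarrow> smooth_on S (\<lambda>x. f x - g x)"
  using smooth_on_add[OF _ _ smooth_on_uminus, of S f g] by simp

lemma Ck_on_Pair:
  fixes f :: "'a::euclidean_space \<Rightarrow> 'b::real_normed_vector" and g :: "'a \<Rightarrow> 'c::real_normed_vector"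
  assumes "thick S" "Ck_on k S f" "Ck_on k S g"
  shows "Ck_on k S (\<lambda>x. (f x, g x))"
proof -
  have l: "bounded_linear (\<lambda>y::'b. (y, 0::'c))" "bounded_linear (\<lambda>y::'c. (0::'b, y))"
    by (auto intro!: bounded_linear_Pair bounded_linear_zero bounded_linear_ident)
  have "Ck_on k S (\<lambda>x. (f x, 0) + (0, g x))"
    by (rule Ck_on_add[OF assms(1) Ck_on_bounded_linear_compose[OF assms(1) l(1) assms(2)]
        Ck_on_bounded_linear_compose[OF assms(1) l(2) assms(3)]])
  then show ?thesis by simp
qed

lemma smooth_on_Pair:
  "thick S \<Longrightarrow> smooth_on S f \<Longrightarrow> smooth_on S g \<Longrightarrow> smooth_on S (\<lambda>x. (f x, g x))"
  by (simp add: smooth_on_def Ck_on_Pair)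

lemmas smooth_on_fst = smooth_on_bounded_linear_compose[OF bounded_linear_fst]
lemmas smooth_on_snd = smooth_on_bounded_linear_compose[OF bounded_linear_snd]
lemmas smooth_on_vec_nth = smooth_on_bounded_linear_compose[OF bounded_linear_vec_nth]

lemma smooth_on_vec_lambda:
  fixes f :: "'n::finite \<Rightarrow> 'a::euclidean_space \<Rightarrow> real"
  assumes "thick S" "\<And>i. smooth_on S (f i)"
  shows "smooth_on S (\<lambda>x. \<chi> i. f i x)"
proof -
  have "smooth_on S (\<lambda>x. \<Sum>i\<in>UNIV. f i x *\<^sub>R axis i (1::real))"
    by (intro smooth_on_sum smooth_on_scaleR smooth_on_const assms)
  moreover have "(\<Sum>i\<in>UNIV. f i x *\<^sub>R axis i (1::real)) = (\<chi> i. f i x)" for x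
    by (simp add: vec_eq_iff axis_def if_distrib sum.delta' cong: if_cong)
  ultimately show ?thesis by simp
qed

lemma linear_eq_sum_axis:
  fixes f :: "real^'n::finite \<Rightarrow> 'b::real_vector"
  assumes "linear f" shows "f x = (\<Sum>i\<in>UNIV. x $ i *\<^sub>R f (axis i 1))"
proof -
  have "x = (\<Sum>i\<in>UNIV. x $ i *\<^sub>R axis i (1::real))"
    by (simp add: vec_eq_iff axis_def if_distrib sum.delta' cong: if_cong)
  then have "f x = f (\<Sum>i\<in>UNIV. x $ i *\<^sub>R axis i (1::real))" by simp
  then show ?thesis using assms by (simp add: linear_sum linear_cmul)
qed

text \<open>\<open>Ck_on\<close> speaks of derivatives in a fixed direction. A varying direction is
  reduced to the fixed axis vectors by linearity.\<close>

lemma smooth_on_frechet_derivative_apply: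
  fixes f :: "real^'n::finite \<Rightarrow> 'b::real_normed_vector"
  assumes "smooth_on T f" "open T" "smooth_on S \<phi>" "smooth_on S h" "thick S" "\<phi> ` S \<subseteq> T"
  shows "smooth_on S (\<lambda>x. frechet_derivative f (at (\<phi> x)) (h x))"
proof -
  have "smooth_on S (\<lambda>x. \<Sum>i\<in>UNIV. h x $ i *\<^sub>R frechet_derivative f (at (\<phi> x)) (axis i 1))"
    by (intro smooth_on_sum smooth_on_scaleR smooth_on_vec_nth assms
        smooth_on_compose[OF smooth_on_open_frechet_derivative[OF assms(1,2)] assms(3)])
  then show ?thesis
  proof (rule smooth_on_cong[THEN iffD1, rotated])
    fix x assume "x \<in> S"
    then have "(f has_derivative frechet_derivative f (at (\<phi> x))) (at (\<phi> x))"
      using assms by (intro smooth_on_open_has_derivative[of T]) auto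
    then show "(\<Sum>i\<in>UNIV. h x $ i *\<^sub>R frechet_derivative f (at (\<phi> x)) (axis i 1))
        = frechet_derivative f (at (\<phi> x)) (h x)"
      using linear_eq_sum_axis[OF has_derivative_linear] by metis
  qed
qed

section \<open>Ordinary differential equations, symmetry of second derivatives, bump functions\<close>

lemma smooth_on_locally_lipschitz:
  fixes f :: "'a::euclidean_space \<Rightarrow> 'b::real_normed_vector"
  assumes f: "smooth_on S f" and S: "open S" and p: "p \<in> S"
  obtains r K where "r > 0" "K \<ge> 0" "cball p r \<subseteq> S"
    "\<And>x y. x \<in> cball p r \<Longrightarrow> y \<in> cball p r \<Longrightarrow> norm (f x - f y) \<le> K * norm (x - y)"
proof -
  obtain r where r: "r > 0" "cball p r \<subseteq> S"
    using S p open_contains_cball by metis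
  let ?f' = "\<lambda>x. frechet_derivative f (at x)"
  have cont: "continuous_on (cball p r) (\<lambda>x. ?f' x b)" for b
    by (rule continuous_on_subset[OF smooth_on_continuous[OF smooth_on_open_frechet_derivative[OF f S]] r(2)])
  have "\<exists>B. \<forall>x\<in>cball p r. norm (?f' x b) \<le> B" for b
    using compact_imp_bounded[OF compact_continuous_image[OF cont compact_cball], of b]
    unfolding bounded_iff by auto
  then obtain B where B: "\<And>b x. x \<in> cball p r \<Longrightarrow> norm (?f' x b) \<le> B b" by metis
  \<comment> \<open>In finite dimension bounds for the derivative on the basis vectors suffice:
    their sum bounds the operator norm.\<close>
  define K where "K = (\<Sum>b\<in>Basis. B b)"
  have "B b \<ge> 0" for b
    using B[of p b] r(1) norm_ge_zero order_trans by (metis centre_in_cball less_imp_le)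
  then have K: "K \<ge> 0" unfolding K_def by (intro sum_nonneg) auto
  have der: "(f has_derivative ?f' x) (at x)" if "x \<in> cball p r" for x
    using smooth_on_open_has_derivative[OF f S] that r(2) by blast
  have on: "onorm (?f' x) \<le> K" if "x \<in> cball p r" for x
  proof (rule onorm_le)
    fix h
    have lin: "linear (?f' x)" using der[OF that] has_derivative_linear by blast
    have "?f' x h = ?f' x (\<Sum>b\<in>Basis. (h \<bullet> b) *\<^sub>R b)" by (simp add: euclidean_representation)
    also have "\<dots> = (\<Sum>b\<in>Basis. (h \<bullet> b) *\<^sub>R ?f' x b)"
      using lin by (simp add: linear_sum linear_cmul)
    finally have "norm (?f' x h) \<le> (\<Sum>b\<in>Basis. norm ((h \<bullet> b) *\<^sub>R ?f' x b))"
      using norm_sum by metis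
    also have "\<dots> \<le> (\<Sum>b\<in>Basis. norm h * B b)"
      by (intro sum_mono) (use B[OF that] in \<open>auto intro!: mult_mono Basis_le_norm\<close>)
    finally show "norm (?f' x h) \<le> K * norm h"
      by (simp add: K_def sum_distrib_left mult.commute)
  qed
  have "norm (f x - f y) \<le> K * norm (x - y)" if "x \<in> cball p r" "y \<in> cball p r" for x y
    by (rule differentiable_bound[OF convex_cball _ on that])
       (use der has_derivative_at_withinI in blast)+
  with r K that show ?thesis by blast
qed

text \<open>Gronwall's estimate: multiplied by the weight \<open>exp (- 2 * K * s)\<close>, the
  squared distance of the two solutions does not increase, and it is 0 at \<open>a\<close>. The
  bound is required only along the two solutions, so a local Lipschitz constant suffices.\<close>

lemma ode_unique:
  fixes y z :: "real \<Rightarrow> 'a::euclidean_space"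
  assumes y: "\<And>t. t \<in> {a..b} \<Longrightarrow> (y has_vector_derivative y' t) (at t within {a..b})"
    and z: "\<And>t. t \<in> {a..b} \<Longrightarrow> (z has_vector_derivative z' t) (at t within {a..b})"
    and K: "\<And>t. t \<in> {a..b} \<Longrightarrow> norm (y' t - z' t) \<le> K * norm (y t - z t)"
    and a: "y a = z a" and t: "t \<in> {a..b}"
  shows "y t = z t"
proof (rule ccontr)
  assume ne: "y t \<noteq> z t"
  with a t have "a < t" by (cases "a = t") auto
  define \<phi> where "\<phi> s = ((y s - z s) \<bullet> (y s - z s)) * exp (- 2 * K * s)" for s
  define \<phi>' where "\<phi>' s = (2 * ((y' s - z' s) \<bullet> (y s - z s)) - 2 * K * ((y s - z s) \<bullet> (y s - z s)))
      * exp (- 2 * K * s)" for s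
  have "\<exists>s\<in>{a<..<t}. \<phi> t - \<phi> a = (\<lambda>h. h * \<phi>' s) (t - a)"
  proof (rule mvt_simple[OF \<open>a < t\<close>])
    fix s assume s: "a \<le> s" "s \<le> t"
    have 1: "((\<lambda>s. y s - z s) has_derivative (\<lambda>h. h *\<^sub>R (y' s - z' s))) (at s within {a..t})"
      using has_vector_derivative_within_subset[OF has_vector_derivative_diff[OF y[of s] z[of s]], of "{a..t}"]
        s t by (auto simp: has_vector_derivative_def)
    have 2: "((\<lambda>s. exp (- 2 * K * s)) has_derivative (\<lambda>h. h * (- 2 * K * exp (- 2 * K * s))))
        (at s within {a..t})"
      by (auto intro!: derivative_eq_intros)
    show "(\<phi> has_derivative (\<lambda>h. h * \<phi>' s)) (at s within {a..t})"
      unfolding \<phi>_def[abs_def]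
      by (rule has_derivative_eq_rhs[OF has_derivative_mult[OF has_derivative_inner[OF 1 1] 2]])
         (auto simp: \<phi>'_def fun_eq_iff algebra_simps inner_commute)
  qed
  then obtain s where s: "s \<in> {a<..<t}" "\<phi> t - \<phi> a = (t - a) * \<phi>' s" by auto
  have "(y' s - z' s) \<bullet> (y s - z s) \<le> norm (y' s - z' s) * norm (y s - z s)"
    by (rule norm_cauchy_schwarz)
  also have "\<dots> \<le> K * norm (y s - z s) * norm (y s - z s)"
    by (intro mult_right_mono K) (use s t in auto)
  also have "\<dots> = K * ((y s - z s) \<bullet> (y s - z s))"
    by (simp add: dot_square_norm power2_eq_square)
  finally have "\<phi>' s \<le> 0" unfolding \<phi>'_def by (intro mult_nonpos_nonneg) auto
  then have "\<phi> t - \<phi> a \<le> 0"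
    unfolding s(2) using \<open>a < t\<close> by (intro mult_nonneg_nonpos) auto
  moreover have "\<phi> a = 0" using a by (simp add: \<phi>_def)
  moreover have "\<phi> t > 0" using ne by (simp add: \<phi>_def)
  ultimately show False by simp
qed

text \<open>Picard iteration as a contraction. The fixed point theorem is applied to bounded
  continuous functions on the whole line: \<open>clamp\<close> extends a function on
  \<open>{a..b}\<close> by its end values, and only values on \<open>{a..b}\<close> enter the
  integral. The number \<open>(b - a) * K\<close> is the contraction factor in the sup norm.\<close>

lemma ode_exists_lipschitz:
  fixes F :: "real \<Rightarrow> 'a::euclidean_space \<Rightarrow> 'a"
  assumes ab: "a \<le> b" and K: "K \<ge> 0" "(b - a) * K < 1"
    and cont: "continuous_on ({a..b} \<times> UNIV) (\<lambda>(t, y). F t y)"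
    and lip: "\<And>t y z. t \<in> {a..b} \<Longrightarrow> norm (F t y - F t z) \<le> K * norm (y - z)"
  obtains y where "y a = y0"
    "\<And>t. t \<in> {a..b} \<Longrightarrow> (y has_vector_derivative F t (y t)) (at t within {a..b})"
proof -
  define P where "P g t = y0 + integral {a..t} (\<lambda>s. F s (apply_bcontfun g s))" for g t
  have cF: "continuous_on {a..b} (\<lambda>s. F s (apply_bcontfun g s))" for g
  proof -
    have "continuous_on {a..b} (\<lambda>s. (s, apply_bcontfun g s))"
      by (rule continuous_on_Pair[OF continuous_on_id continuous_on_apply_bcontfun])
    from continuous_on_compose2[OF cont this] show ?thesis by auto
  qed
  have cP: "continuous_on (cbox a b) (P g)" for g
    unfolding P_def
    using indefinite_integral_continuous_1[OF integrable_continuous_real[OF cF[of g]]]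
    by (auto intro!: continuous_intros)
  have "\<exists>h. \<forall>x. apply_bcontfun h x = P g (clamp a b x)" for g
    using continuous_on_cbox_bcontfunE[OF cP[of g]] by metis
  then obtain T where T: "\<And>g x. apply_bcontfun (T g) x = P g (clamp a b x)" by metis
  have clamp: "clamp a b t \<in> {a..b}" for t :: real
    using clamp_in_interval[of a b t] ab by auto
  have "\<exists>!g. T g = g"
  proof (rule banach_fix_type)
    show "0 \<le> (b - a) * K" "(b - a) * K < 1" using K ab by auto
    show "\<forall>g h. dist (T g) (T h) \<le> (b - a) * K * dist g h"
    proof (intro allI dist_bound)
      fix g h and x :: real
      define u where "u = clamp a b x"
      have u: "u \<in> {a..b}" unfolding u_def by (rule clamp)
      have sub: "{a..u} \<subseteq> {a..b}" using u by auto
      have "P g u - P h u = integral {a..u} (\<lambda>s. F s (g s) - F s (h s))"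
        unfolding P_def
        by (subst integral_diff)
           (use continuous_on_subset[OF cF sub] integrable_continuous_real in auto)
      moreover have "norm (integral {a..u} (\<lambda>s. F s (g s) - F s (h s))) \<le> (K * dist g h) * (u - a)"
      proof (rule integral_bound)
        show "continuous_on {a..u} (\<lambda>s. F s (g s) - F s (h s))"
          using continuous_on_subset[OF cF sub] by (intro continuous_on_diff) auto
        fix s assume "s \<in> {a..u}"
        then have "norm (F s (g s) - F s (h s)) \<le> K * norm (g s - h s)" using sub by (intro lip) auto
        also have "\<dots> \<le> K * dist g h"
          using dist_bounded[of g s h] K by (intro mult_left_mono) (auto simp: dist_norm)
        finally show "norm (F s (g s) - F s (h s)) \<le> K * dist g h" .
      qed (use u in auto)
      moreover have "(K * dist g h) * (u - a) \<le> (K * dist g h) * (b - a)"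
        using u K by (intro mult_left_mono) auto
      ultimately show "dist (T g x) (T h x) \<le> (b - a) * K * dist g h"
        by (simp add: T u_def[symmetric] dist_norm mult_ac)
    qed
  qed
  then obtain g where g: "T g = g" by auto
  show ?thesis
  proof
    have eq: "apply_bcontfun g t = P g t" if "t \<in> {a..b}" for t
      using T[of g t] that g by (simp add: clamp_cancel_cbox)
    show "apply_bcontfun g a = y0" using eq[of a] ab by (simp add: P_def)
    fix t assume t: "t \<in> {a..b}"
    have "(P g has_vector_derivative F t (g t)) (at t within {a..b})"
      unfolding P_def[abs_def]
      using integral_has_vector_derivative[OF cF t] by (auto intro!: derivative_eq_intros)
    then show "(apply_bcontfun g has_vector_derivative F t (g t)) (at t within {a..b})"
      by (rule has_vector_derivative_transform[OF t, rotated]) (use eq in auto)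
  qed
qed

lemma ode_exists_locally:
  fixes F :: "real \<times> 'a::euclidean_space \<Rightarrow> 'a"
  assumes F: "smooth_on S F" and S: "open S" and p: "(0, y0) \<in> S"
  obtains e y where "e > 0" "y 0 = y0"
    "\<And>t. t \<in> {0..e} \<Longrightarrow> (t, y t) \<in> S"
    "\<And>t. t \<in> {0..e} \<Longrightarrow> (y has_vector_derivative F (t, y t)) (at t within {0..e})"
proof -
  obtain r K where r: "r > 0" "K \<ge> 0" "cball (0, y0) r \<subseteq> S"
    and lip: "\<And>x y. x \<in> cball (0, y0) r \<Longrightarrow> y \<in> cball (0, y0) r \<Longrightarrow> norm (F x - F y) \<le> K * norm (x - y)"
    using smooth_on_locally_lipschitz[OF F S p] by metis
  \<comment> \<open>The norm of a pair is at most the sum of the norms, so half the radius in each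
    factor stays in the ball of radius \<open>r\<close>.\<close>
  define d where "d = r / 2"
  have d: "d > 0" using r by (simp add: d_def)
  have in_ball: "(t, y) \<in> cball (0, y0) r" if "t \<in> {0..d}" "y \<in> cball y0 d" for t y
  proof -
    have "norm ((0, y0) - (t, y)) \<le> norm (0 - t) + norm (y0 - y)"
      using norm_Pair_le[of "0 - t" "y0 - y"] by simp
    with that show ?thesis by (simp add: dist_norm d_def)
  qed
  have cont: "continuous_on ({0..d} \<times> cball y0 d) F"
    using smooth_on_continuous[OF F] by (rule continuous_on_subset) (use in_ball r in blast)
  have "compact ({0..d} \<times> cball y0 d)" by (intro compact_Times) auto
  then obtain B where B: "\<And>z. z \<in> {0..d} \<times> cball y0 d \<Longrightarrow> norm (F z) \<le> B"
    using compact_imp_bounded[OF compact_continuous_image[OF cont]] unfolding bounded_iff by blast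
  have B0: "B \<ge> 0" using order_trans[OF norm_ge_zero B[of "(0, y0)"]] d by simp
  \<comment> \<open>Composing \<open>F\<close> with the projection to a ball makes it globally Lipschitz.\<close>
  define c where "c = closest_point (cball y0 d)"
  have c: "c y \<in> cball y0 d" for y
    unfolding c_def by (rule closest_point_in_set) (use d in auto)
  \<comment> \<open>\<open>d / (B + 1)\<close> prevents the solution from leaving the ball at speed
    \<open>B\<close>, and \<open>1 / (2 * (K + 1))\<close> makes the contraction factor less than 1;
    adding 1 covers \<open>B = 0\<close> and \<open>K = 0\<close>.\<close>
  define e where "e = min d (min (d / (B + 1)) (1 / (2 * (K + 1))))"
  have e: "e > 0" "e \<le> d" "e \<le> d / (B + 1)" "e \<le> 1 / (2 * (K + 1))"
    using d B0 r unfolding e_def by (auto intro!: divide_pos_pos)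
  have eB: "B * e \<le> d"
  proof -
    have "B * e \<le> B * (d / (B + 1))" using e B0 by (intro mult_left_mono)
    also have "\<dots> \<le> d" using B0 d by (simp add: field_simps)
    finally show ?thesis .
  qed
  have eK: "(e - 0) * K < 1"
  proof -
    have "e * K \<le> (1 / (2 * (K + 1))) * K" using e r by (intro mult_right_mono)
    also have "\<dots> < 1" using r by (simp add: field_simps)
    finally show ?thesis by simp
  qed
  obtain y where y: "y 0 = y0"
    "\<And>t. t \<in> {0..e} \<Longrightarrow> (y has_vector_derivative F (t, c (y t))) (at t within {0..e})"
  proof (rule ode_exists_lipschitz[where F = "\<lambda>t y. F (t, c y)" and a = 0 and b = e and K = K and ?y0.0 = y0])
    have "continuous_on UNIV c"
      unfolding c_def by (rule continuous_on_closest_point) (use d in auto)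
    then have "continuous_on ({0..e} \<times> UNIV) (\<lambda>z. (fst z, c (snd z)))"
      using continuous_on_compose2[OF _ continuous_on_snd[OF continuous_on_id], of UNIV c "{0..e} \<times> UNIV"]
      by (intro continuous_on_Pair continuous_on_fst[OF continuous_on_id]) auto
    moreover have "(\<lambda>z. (fst z, c (snd z))) ` ({0..e} \<times> UNIV) \<subseteq> {0..d} \<times> cball y0 d"
      using c e by auto
    ultimately show "continuous_on ({0..e} \<times> UNIV) (\<lambda>(t, y). F (t, c y))"
      using continuous_on_compose2[OF cont] by (simp add: case_prod_beta)
    fix t y z assume t: "t \<in> {0..e}"
    have "norm (F (t, c y) - F (t, c z)) \<le> K * norm ((t, c y) - (t, c z))"
      by (intro lip in_ball c) (use t e in auto)
    also have "\<dots> = K * dist (c y) (c z)" by (simp add: dist_norm norm_Pair)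
    also have "\<dots> \<le> K * dist y z"
      unfolding c_def using r d by (intro mult_left_mono closest_point_lipschitz) auto
    finally show "norm (F (t, c y) - F (t, c z)) \<le> K * norm (y - z)" by (simp add: dist_norm)
  qed (use e eK r in auto)
  \<comment> \<open>The truncated right-hand side has norm at most \<open>B\<close>, so the solution
    never leaves the ball and the truncation is not felt.\<close>
  have yb: "y t \<in> cball y0 d" if t: "t \<in> {0..e}" for t
  proof -
    have "norm (y t - y 0) \<le> B * norm (t - 0)"
    proof (rule differentiable_bound[of "{0..e}"])
      fix s assume s: "s \<in> {0..e}"
      show "(y has_derivative (\<lambda>h. h *\<^sub>R F (s, c (y s)))) (at s within {0..e})"
        using y(2)[OF s] by (simp add: has_vector_derivative_def)
      have "norm (F (s, c (y s))) \<le> B" by (rule B) (use s e c in auto)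
      then show "onorm (\<lambda>h. h *\<^sub>R F (s, c (y s))) \<le> B"
        by (intro onorm_le) (simp add: mult.commute[of B] mult_left_mono)
    qed (use t e in auto)
    also have "\<dots> \<le> B * e" using t B0 by (intro mult_left_mono) auto
    finally show ?thesis using eB y(1) by (simp add: dist_norm norm_minus_commute)
  qed
  have cy: "c (y t) = y t" if "t \<in> {0..e}" for t
    unfolding c_def by (rule closest_point_self[OF yb[OF that]])
  show ?thesis
  proof (rule that[of e y, OF e(1) y(1)])
    fix t assume t: "t \<in> {0..e}"
    show "(t, y t) \<in> S" using in_ball[OF _ yb[OF t]] t e r by auto
    show "(y has_vector_derivative F (t, y t)) (at t within {0..e})"
      using y(2)[OF t] cy[OF t] by simp
  qed
qed

text \<open>Bootstrapping: if \<open>y\<close> is of class \<open>k\<close>, so is the right-hand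
  side, which is the derivative of \<open>y\<close>. Time enters through the smooth map
  \<open>u\<close>, so that \<open>S\<close> may be an interval with one-sided derivatives.\<close>

lemma ode_solution_smooth:
  fixes G :: "'u::euclidean_space \<times> 'a::euclidean_space \<Rightarrow> 'a" and S :: "real set"
  assumes S: "thick S" and G: "smooth_on Z G" and u: "smooth_on S u"
    and in_Z: "\<And>t. t \<in> S \<Longrightarrow> (u t, y t) \<in> Z"
    and y: "\<And>t. t \<in> S \<Longrightarrow> (y has_vector_derivative G (u t, y t)) (at t within S)"
  shows "smooth_on S y"
proof -
  have "Ck_on k S y" for k
  proof (induction k)
    case 0
    show ?case
      unfolding Ck_on.simps
      by (rule has_derivative_continuous_on) (use y in \<open>simp add: has_vector_derivative_def\<close>)
  next
    case (Suc k)
    show ?case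
    proof (rule Ck_on_SucI[OF S])
      show "(y has_derivative (\<lambda>h. h *\<^sub>R G (u t, y t))) (at t within S)" if "t \<in> S" for t
        using y[OF that] by (simp add: has_vector_derivative_def)
      fix h :: real
      have "Ck_on k S (\<lambda>t. (u t, y t))"
        by (rule Ck_on_Pair[OF S _ Suc]) (use u in \<open>simp add: smooth_on_def\<close>)
      then have "Ck_on k S (\<lambda>t. G (u t, y t))"
        by (rule Ck_on_compose[OF S, where g = G and T = Z, rotated])
           (use G in_Z in \<open>auto simp: smooth_on_def\<close>)
      then show "Ck_on k S (\<lambda>t. h *\<^sub>R G (u t, y t))"
        by (rule Ck_on_bounded_linear_compose[OF S bounded_linear_scaleR_right])
    qed
  qed
  then show ?thesis by (simp add: smooth_on_def)
qed

text \<open>The second difference of \<open>f\<close> along \<open>u\<close> and \<open>w\<close>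
  does not change when they are swapped. Two applications of the mean value theorem turn it into
  \<open>h * h\<close> times a mixed derivative at a point near \<open>x\<close>, and continuity of
  the mixed derivatives finishes the argument.\<close>

lemma second_derivative_symmetric:
  fixes f :: "'a::euclidean_space \<Rightarrow> real"
  assumes f: "smooth_on S f" and S: "open S" and x: "x \<in> S"
  shows "frechet_derivative (\<lambda>z. frechet_derivative f (at z) u) (at x) w
       = frechet_derivative (\<lambda>z. frechet_derivative f (at z) w) (at x) u"
proof -
  define f1 where "f1 u z = frechet_derivative f (at z) u" for u z
  define f2 where "f2 u w z = frechet_derivative (f1 u) (at z) w" for u w z
  have sm1: "smooth_on S (f1 u)" for u
    unfolding f1_def[abs_def] by (rule smooth_on_open_frechet_derivative[OF f S])
  have c2: "continuous_on S (f2 u w)" for u w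
    unfolding f2_def[abs_def]
    by (intro smooth_on_continuous smooth_on_open_frechet_derivative[OF sm1 S])
  have d0: "((\<lambda>s. f (a + s *\<^sub>R v)) has_real_derivative f1 v (a + s *\<^sub>R v)) (at s)"
    if "a + s *\<^sub>R v \<in> S" for a v s
  proof -
    have der: "(f has_derivative frechet_derivative f (at (a + s *\<^sub>R v))) (at (a + s *\<^sub>R v))"
      by (rule smooth_on_open_has_derivative[OF f S that])
    have "((\<lambda>s. a + s *\<^sub>R v) has_derivative (\<lambda>h. h *\<^sub>R v)) (at s)"
      by (auto intro!: derivative_eq_intros)
    from has_derivative_compose[OF this der] show ?thesis
      unfolding has_field_derivative_def f1_def
      by (rule has_derivative_eq_rhs)
         (simp add: fun_eq_iff linear_cmul[OF has_derivative_linear[OF der]] mult.commute)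
  qed
  have d1: "((\<lambda>s. f1 w (a + s *\<^sub>R v)) has_real_derivative f2 w v (a + s *\<^sub>R v)) (at s)"
    if "a + s *\<^sub>R v \<in> S" for a v w s
  proof -
    have der: "(f1 w has_derivative frechet_derivative (f1 w) (at (a + s *\<^sub>R v))) (at (a + s *\<^sub>R v))"
      by (rule smooth_on_open_has_derivative[OF sm1 S that])
    have "((\<lambda>s. a + s *\<^sub>R v) has_derivative (\<lambda>h. h *\<^sub>R v)) (at s)"
      by (auto intro!: derivative_eq_intros)
    from has_derivative_compose[OF this der] show ?thesis
      unfolding has_field_derivative_def f2_def
      by (rule has_derivative_eq_rhs)
         (simp add: fun_eq_iff linear_cmul[OF has_derivative_linear[OF der]] mult.commute)
  qed
  obtain r where r: "r > 0" "ball x r \<subseteq> S" using S x open_contains_ball by metis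
  \<comment> \<open>The summand 1 keeps the bound strict even when \<open>u\<close> and
    \<open>w\<close> vanish.\<close>
  have near: "x + s *\<^sub>R u + t *\<^sub>R w \<in> ball x (h * (norm u + norm w + 1))"
    if "0 \<le> s" "s \<le> h" "0 \<le> t" "t \<le> h" "h > 0" for s t h u w
  proof -
    have "norm (s *\<^sub>R u + t *\<^sub>R w) \<le> s * norm u + t * norm w"
      using norm_triangle_ineq[of "s *\<^sub>R u" "t *\<^sub>R w"] that by simp
    also have "\<dots> \<le> h * norm u + h * norm w" using that by (intro add_mono mult_right_mono) auto
    also have "\<dots> < h * (norm u + norm w + 1)" using that by (simp add: algebra_simps)
    finally have "norm (s *\<^sub>R u + t *\<^sub>R w) < h * (norm u + norm w + 1)" .
    moreover have "dist x (x + s *\<^sub>R u + t *\<^sub>R w) = norm (s *\<^sub>R u + t *\<^sub>R w)"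
      by (metis add.assoc dist_add_cancel dist_0_norm add.right_neutral)
    ultimately show ?thesis by simp
  qed
  have mvt: "\<exists>q\<in>ball x (h * (norm u + norm w + 1)).
      f (x + h *\<^sub>R u + h *\<^sub>R w) - f (x + h *\<^sub>R u) - f (x + h *\<^sub>R w) + f x = h * h * f2 u w q"
    if h: "h > 0" "h * (norm u + norm w + 1) \<le> r" for h u w
  proof -
    have inS: "x + s *\<^sub>R u + t *\<^sub>R w \<in> S" if "0 \<le> s" "s \<le> h" "0 \<le> t" "t \<le> h" for s t
      using near[of s h t u w] that h r by (meson ball_subset_cball subset_ball subsetD)
    then have inS2: "x + h *\<^sub>R w + s *\<^sub>R u \<in> S" if "0 \<le> s" "s \<le> h" for s
      using that h(1) by (metis add.assoc add.commute less_imp_le order_refl)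
    have "\<exists>\<xi>>0. \<xi> < h \<and> (f (x + h *\<^sub>R w + h *\<^sub>R u) - f (x + h *\<^sub>R u)) - (f (x + h *\<^sub>R w + 0 *\<^sub>R u) - f (x + 0 *\<^sub>R u))
        = (h - 0) * (f1 u (x + h *\<^sub>R w + \<xi> *\<^sub>R u) - f1 u (x + \<xi> *\<^sub>R u))"
      by (rule MVT2[of 0 h "\<lambda>s. f (x + h *\<^sub>R w + s *\<^sub>R u) - f (x + s *\<^sub>R u)"
            "\<lambda>s. f1 u (x + h *\<^sub>R w + s *\<^sub>R u) - f1 u (x + s *\<^sub>R u)"])
         (use h inS2 inS[of _ 0] in \<open>auto intro!: DERIV_diff d0\<close>)
    then obtain \<xi> where xi: "0 < \<xi>" "\<xi> < h"
      "f (x + h *\<^sub>R u + h *\<^sub>R w) - f (x + h *\<^sub>R u) - f (x + h *\<^sub>R w) + f x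
        = h * (f1 u (x + \<xi> *\<^sub>R u + h *\<^sub>R w) - f1 u (x + \<xi> *\<^sub>R u))"
      by (auto simp: algebra_simps)
    have "\<exists>\<eta>>0. \<eta> < h \<and> f1 u (x + \<xi> *\<^sub>R u + h *\<^sub>R w) - f1 u (x + \<xi> *\<^sub>R u + 0 *\<^sub>R w)
        = (h - 0) * f2 u w (x + \<xi> *\<^sub>R u + \<eta> *\<^sub>R w)"
      by (rule MVT2[of 0 h "\<lambda>t. f1 u (x + \<xi> *\<^sub>R u + t *\<^sub>R w)"]) (use h xi inS in \<open>auto intro!: d1\<close>)
    then obtain \<eta> where eta: "0 < \<eta>" "\<eta> < h"
      "f1 u (x + \<xi> *\<^sub>R u + h *\<^sub>R w) - f1 u (x + \<xi> *\<^sub>R u) = h * f2 u w (x + \<xi> *\<^sub>R u + \<eta> *\<^sub>R w)"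
      by auto
    show ?thesis
      using near[of \<xi> h \<eta> u w] xi eta h by (intro bexI[of _ "x + \<xi> *\<^sub>R u + \<eta> *\<^sub>R w"]) (auto simp: mult_ac)
  qed
  have "f2 u w x = f2 w u x"
  proof (rule ccontr)
    assume ne: "f2 u w x \<noteq> f2 w u x"
    define \<epsilon> where "\<epsilon> = \<bar>f2 u w x - f2 w u x\<bar> / 2"
    have "\<epsilon> > 0" using ne by (simp add: \<epsilon>_def)
    have "\<exists>d>0. \<forall>q\<in>S. dist q x < d \<longrightarrow> dist (f2 u w q) (f2 u w x) < \<epsilon>" for u w
      using c2[of u w] x \<open>\<epsilon> > 0\<close> unfolding continuous_on_iff by blast
    then obtain d1 d2 where d: "d1 > 0" "d2 > 0"
      "\<And>q. q \<in> S \<Longrightarrow> dist q x < d1 \<Longrightarrow> dist (f2 u w q) (f2 u w x) < \<epsilon>"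
      "\<And>q. q \<in> S \<Longrightarrow> dist q x < d2 \<Longrightarrow> dist (f2 w u q) (f2 w u x) < \<epsilon>"
      by metis
    define m where "m = min r (min d1 d2)"
    have m: "m > 0" "m \<le> r" "m \<le> d1" "m \<le> d2" using r d by (auto simp: m_def)
    define h where "h = m / (norm u + norm w + 1)"
    have N: "norm u + norm w + 1 > 0" using norm_ge_zero[of u] norm_ge_zero[of w] by linarith
    have h: "h > 0" "h * (norm u + norm w + 1) = m" using m N by (auto simp: h_def)
    obtain q1 where q1: "q1 \<in> ball x m"
      "f (x + h *\<^sub>R u + h *\<^sub>R w) - f (x + h *\<^sub>R u) - f (x + h *\<^sub>R w) + f x = h * h * f2 u w q1"
      using mvt[OF h(1), of u w] h m by auto
    obtain q2 where q2: "q2 \<in> ball x m"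
      "f (x + h *\<^sub>R w + h *\<^sub>R u) - f (x + h *\<^sub>R w) - f (x + h *\<^sub>R u) + f x = h * h * f2 w u q2"
      using mvt[OF h(1), of w u] h m by (auto simp: add.commute)
    have "h * h * f2 u w q1 = h * h * f2 w u q2"
      unfolding q1(2)[symmetric] q2(2)[symmetric] by (simp add: algebra_simps)
    then have "f2 u w q1 = f2 w u q2" using h by simp
    moreover have "dist (f2 u w q1) (f2 u w x) < \<epsilon>" "dist (f2 w u q2) (f2 w u x) < \<epsilon>"
      using q1 q2 m r(2) by (auto intro!: d simp: dist_commute)
    ultimately show False unfolding \<epsilon>_def by (auto simp: dist_real_def abs_if split: if_splits)
  qed
  then show ?thesis unfolding f2_def f1_def[abs_def] .
qed

section \<open>The flat function and Euclidean bump functions\<close>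

definition flat :: "nat \<Rightarrow> real \<Rightarrow> real" where
  "flat n t = (if t > 0 then inverse t ^ n / exp (inverse t) else 0)"

lemma flat_tendsto_0: "(flat n \<longlongrightarrow> 0) (at 0)"
proof (rule filterlim_split_at)
  show "(flat n \<longlongrightarrow> 0) (at_left 0)"
    by (rule tendsto_eventually) (auto simp: eventually_at_filter flat_def)
  have "((\<lambda>t. inverse t ^ n / exp (inverse t)) \<longlongrightarrow> (0::real)) (at_right 0)"
    by (rule filterlim_compose[OF tendsto_power_div_exp_0 filterlim_inverse_at_top_right])
  then show "(flat n \<longlongrightarrow> 0) (at_right 0)"
    by (rule Lim_transform_eventually) (auto simp: eventually_at_filter flat_def)
qed

text \<open>Differentiation stays in the span of the family \<open>flat n\<close>, which is the
  reason for the parameter: bumps are built from \<open>flat 0\<close> alone, but its smoothness is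
  proved by an induction on the order for all \<open>n\<close> at once.\<close>

lemma DERIV_flat: "(flat n has_real_derivative flat (n + 2) t - n * flat (n + 1) t) (at t)"
proof (cases t "0 :: real" rule: linorder_cases)
  case less
  have "((\<lambda>t. 0) has_real_derivative 0) (at t)" by simp
  then have "(flat n has_real_derivative 0) (at t)"
    by (rule has_field_derivative_transform_within_open[of _ _ _ "{..<0}"])
       (use less in \<open>auto simp: flat_def\<close>)
  with less show ?thesis by (simp add: flat_def)
next
  case equal
  \<comment> \<open>The difference quotient of \<open>flat n\<close> at 0 is
    \<open>flat (Suc n)\<close>, which tends to 0.\<close>
  have "((\<lambda>s. (flat n s - flat n 0) / (s - 0)) \<longlongrightarrow> 0) (at 0)"
    by (rule Lim_transform_eventually[OF flat_tendsto_0[of "Suc n"]])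
       (auto simp: eventually_at_filter flat_def divide_inverse)
  then have "(flat n has_real_derivative 0) (at 0)"
    by (simp add: has_field_derivative_iff)
  with equal show ?thesis by (simp add: flat_def)
next
  case greater
  have "((\<lambda>t. inverse t ^ n * exp (- inverse t)) has_real_derivative
      real n * inverse t ^ (n - 1) * (- (inverse t * inverse t)) * exp (- inverse t)
      + inverse t ^ n * (exp (- inverse t) * (inverse t * inverse t))) (at t)"
    using greater by (auto intro!: derivative_eq_intros simp: power2_eq_square algebra_simps)
  \<comment> \<open>The case split on \<open>n\<close> is for the truncated exponent
    \<open>n - 1\<close>; for \<open>n = 0\<close> its factor \<open>real n\<close>
    vanishes.\<close>
  moreover have "real n * inverse t ^ (n - 1) * (- (inverse t * inverse t)) * exp (- inverse t)
      + inverse t ^ n * (exp (- inverse t) * (inverse t * inverse t))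
      = flat (n + 2) t - n * flat (n + 1) t"
    using greater by (cases n) (auto simp: flat_def exp_minus divide_inverse algebra_simps)
  ultimately have "((\<lambda>t. inverse t ^ n * exp (- inverse t)) has_real_derivative
      flat (n + 2) t - n * flat (n + 1) t) (at t)" by simp
  then show ?thesis
    by (rule has_field_derivative_transform_within_open[of _ _ _ "{0<..}"])
       (use greater in \<open>auto simp: flat_def exp_minus divide_inverse\<close>)
qed

lemma smooth_on_flat: "smooth_on UNIV (flat n)"
proof -
  have "Ck_on k UNIV (flat n)" for k
  proof (induction k arbitrary: n)
    case 0
    show ?case
      unfolding Ck_on.simps
      by (intro continuous_at_imp_continuous_on ballI) (rule DERIV_isCont[OF DERIV_flat])
  next
    case (Suc k)
    show ?case
    proof (rule Ck_on_SucI[OF thick_UNIV])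
      show "(flat n has_derivative (\<lambda>h. (flat (n + 2) t - n * flat (n + 1) t) * h)) (at t)" for t
        using DERIV_flat[of n t] by (simp add: has_field_derivative_def)
      fix h :: real
      have "Ck_on k UNIV (\<lambda>t. flat (n + 2) t + (- n) * flat (n + 1) t)"
        by (intro Ck_on_add thick_UNIV Suc Ck_on_bounded_linear_compose[OF _ bounded_linear_mult_right])
      then have "Ck_on k UNIV (\<lambda>t. (flat (n + 2) t + (- n) * flat (n + 1) t) * h)"
        by (rule Ck_on_bounded_linear_compose[OF thick_UNIV bounded_linear_mult_left])
      then show "Ck_on k UNIV (\<lambda>t. (flat (n + 2) t - n * flat (n + 1) t) * h)" by simp
    qed
  qed
  then show ?thesis by (simp add: smooth_on_def)
qed

lemma flat_0_mono: "s \<le> t \<Longrightarrow> flat 0 s \<le> flat 0 t"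
  by (auto simp: flat_def divide_simps)

text \<open>The plateau comes from nesting \<open>flat 0\<close>, which vanishes on the negative reals: no quotient is needed.\<close>

lemma smooth_bump_exists:
  fixes p :: "'a::euclidean_space"
  assumes "0 < r" "r < R"
  obtains \<psi> :: "'a \<Rightarrow> real" where "smooth_on UNIV \<psi>"
    "\<And>x. x \<in> ball p r \<Longrightarrow> \<psi> x = 1" "\<And>x. x \<notin> ball p R \<Longrightarrow> \<psi> x = 0"
proof
  define \<phi> where "\<phi> x = flat 0 ((x - p) \<bullet> (x - p) - r\<^sup>2)" for x :: 'a
  \<comment> \<open>\<open>a\<close> is the value of \<phi> on the sphere of radius
    \<open>R\<close>. Beyond that sphere \<open>a - \<phi> x\<close> is not positive and the outer
    \<open>flat 0\<close> vanishes; on the inner ball \<phi> is 0, so the outer value is the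
    constant \<open>flat 0 a\<close>, which is normalized to 1.\<close>
  define a where "a = flat 0 (R\<^sup>2 - r\<^sup>2)"
  have a: "a > 0" using assms by (simp add: a_def flat_def power2_strict_mono)
  let ?\<psi> = "\<lambda>x. inverse (flat 0 a) * flat 0 (a - \<phi> x)"
  have *: "flat 0 a > 0" using a by (simp add: flat_def)
  have q: "smooth_on UNIV (\<lambda>x::'a. (x - p) \<bullet> (x - p) - r\<^sup>2)"
    by (intro smooth_on_diff smooth_on_inner smooth_on_ident smooth_on_const thick_UNIV)
  have "smooth_on UNIV \<phi>"
    unfolding \<phi>_def[abs_def] by (rule smooth_on_compose[OF smooth_on_flat q thick_UNIV]) simp
  then have "smooth_on UNIV (\<lambda>x. a - \<phi> x)"
    by (intro smooth_on_diff smooth_on_const thick_UNIV)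
  then have "smooth_on UNIV (\<lambda>x. flat 0 (a - \<phi> x))"
    by (rule smooth_on_compose[OF smooth_on_flat _ thick_UNIV]) simp
  then show "smooth_on UNIV ?\<psi>"
    by (intro smooth_on_mult smooth_on_const thick_UNIV)
  have sq: "(x - p) \<bullet> (x - p) = (dist p x)\<^sup>2" for x
    by (simp add: dist_norm dot_square_norm norm_minus_commute)
  show "?\<psi> x = 1" if "x \<in> ball p r" for x
  proof -
    have "(dist p x)\<^sup>2 \<le> r\<^sup>2" using that by (intro power_mono) auto
    then have "\<phi> x = 0" by (simp add: \<phi>_def flat_def sq)
    then show ?thesis using * by simp
  qed
  show "?\<psi> x = 0" if "x \<notin> ball p R" for x
  proof -
    have "R\<^sup>2 \<le> (dist p x)\<^sup>2" using that assms by (intro power_mono) auto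
    then have "a \<le> \<phi> x" unfolding a_def \<phi>_def sq by (intro flat_0_mono) simp
    then show ?thesis by (simp add: flat_def)
  qed
qed

section \<open>Charts and tangent vectors\<close>

abbreviation dtrans :: "('a, 'n::finite) chart \<Rightarrow> ('a, 'n) chart \<Rightarrow> real^'n \<Rightarrow> real^'n \<Rightarrow> real^'n" where
  "dtrans c c' x \<equiv> frechet_derivative (transition c c') (at x)"

lemma tadd_apply [simp]: "tadd \<xi> \<eta> c = \<xi> c + \<eta> c"
  by (simp add: tadd_def)

lemma tscale_apply [simp]: "tscale r \<xi> c = r *\<^sub>R \<xi> c"
  by (simp add: tscale_def)

lemma tzero_apply [simp]: "tzero c = 0"
  by (simp add: tzero_def)

lemma transition_apply: "transition c c' x = snd c' (chart_inv c x)"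
  by (simp add: transition_def)

locale manifold =
  fixes M :: "('a::{t2_space, second_countable_topology}, 'n::finite) chart set"
  assumes manifold: "smooth_manifold M"
begin

lemma is_chart: "c \<in> M \<Longrightarrow> is_chart c"
  using manifold unfolding smooth_manifold_def by blast

lemma chart_homeomorphism: "c \<in> M \<Longrightarrow> homeomorphism (fst c) (snd c ` fst c) (snd c) (chart_inv c)"
  using is_chart unfolding is_chart_def chart_inv_def by blast

lemma open_chart_domain: "c \<in> M \<Longrightarrow> open (fst c)"
  using is_chart unfolding is_chart_def by blast

lemma open_chart_image: "c \<in> M \<Longrightarrow> open (snd c ` fst c)"
  using is_chart unfolding is_chart_def by blast

lemma continuous_on_chart: "c \<in> M \<Longrightarrow> continuous_on (fst c) (snd c)"
  using chart_homeomorphism homeomorphism_cont1 by blast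

lemma continuous_on_chart_inv: "c \<in> M \<Longrightarrow> continuous_on (snd c ` fst c) (chart_inv c)"
  using chart_homeomorphism homeomorphism_cont2 by blast

lemma chart_inv_chart: "c \<in> M \<Longrightarrow> p \<in> fst c \<Longrightarrow> chart_inv c (snd c p) = p"
  using chart_homeomorphism homeomorphism_apply1 by blast

lemma chart_chart_inv: "c \<in> M \<Longrightarrow> x \<in> snd c ` fst c \<Longrightarrow> snd c (chart_inv c x) = x"
  by (auto simp: chart_inv_chart)

lemma chart_inv_in: "c \<in> M \<Longrightarrow> x \<in> snd c ` fst c \<Longrightarrow> chart_inv c x \<in> fst c"
  by (auto simp: chart_inv_chart)

lemma chart_exists: obtains c where "c \<in> M" "p \<in> fst c"
  using manifold unfolding smooth_manifold_def by (metis UNIV_I UN_E)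

lemma open_chart_image_Int:
  assumes "c \<in> M" "open V" shows "open (snd c ` (fst c \<inter> V))"
proof -
  have "open (snd c ` fst c \<inter> chart_inv c -` V)"
    by (rule continuous_open_preimage[OF continuous_on_chart_inv[OF assms(1)] open_chart_image[OF assms(1)] assms(2)])
  moreover have "snd c ` fst c \<inter> chart_inv c -` V = snd c ` (fst c \<inter> V)"
    using chart_inv_chart[OF assms(1)] by auto
  ultimately show ?thesis by simp
qed

lemma eventually_chart_inv:
  assumes c: "c \<in> M" and p: "p \<in> fst c" and P: "\<forall>\<^sub>F q in nhds p. P q"
  obtains S where "open S" "snd c p \<in> S" "S \<subseteq> snd c ` fst c" "\<And>x. x \<in> S \<Longrightarrow> P (chart_inv c x)"
proof -
  obtain V where V: "open V" "p \<in> V" "\<And>q. q \<in> V \<Longrightarrow> P q"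
    using P unfolding eventually_nhds by auto
  show ?thesis
  proof
    show "open (snd c ` (fst c \<inter> V))" by (rule open_chart_image_Int[OF c V(1)])
  qed (use V p chart_inv_chart[OF c] in auto)
qed

lemma smooth_on_transition:
  assumes "c \<in> M" "c' \<in> M"
  shows "smooth_on (snd c ` (fst c \<inter> fst c')) (transition c c')"
  using manifold assms unfolding smooth_manifold_def compatible_def by blast

lemma open_overlap: "c \<in> M \<Longrightarrow> c' \<in> M \<Longrightarrow> open (snd c ` (fst c \<inter> fst c'))"
  using open_chart_image_Int open_chart_domain by blast

lemma transition_has_derivative:
  assumes "c \<in> M" "c' \<in> M" "p \<in> fst c" "p \<in> fst c'"
  shows "(transition c c' has_derivative dtrans c c' (snd c p)) (at (snd c p))"
  by (rule smooth_on_open_has_derivative[OF smooth_on_transition[OF assms(1,2)] open_overlap[OF assms(1,2)]])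
     (use assms in auto)

lemma linear_dtrans:
  "c \<in> M \<Longrightarrow> c' \<in> M \<Longrightarrow> p \<in> fst c \<Longrightarrow> p \<in> fst c' \<Longrightarrow> linear (dtrans c c' (snd c p))"
  using transition_has_derivative has_derivative_linear by blast

text \<open>The chain rule for a composition of transition maps. This identity makes
  \<open>coord_vec\<close> a tangent vector, that is, consistent in all charts.\<close>

lemma dtrans_cocycle:
  assumes c: "c \<in> M" "c' \<in> M" "c'' \<in> M" and p: "p \<in> fst c" "p \<in> fst c'" "p \<in> fst c''"
  shows "dtrans c' c'' (snd c' p) (dtrans c c' (snd c p) y) = dtrans c c'' (snd c p) y"
proof -
  have t: "transition c c' (snd c p) = snd c' p"
    by (simp add: transition_apply chart_inv_chart c p)
  have "((\<lambda>x. transition c' c'' (transition c c' x)) has_derivative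
      (\<lambda>y. dtrans c' c'' (snd c' p) (dtrans c c' (snd c p) y))) (at (snd c p))"
    by (rule has_derivative_compose[OF transition_has_derivative])
       (use t c p transition_has_derivative[OF c(2,3) p(2,3)] in simp_all)
  then have "(transition c c'' has_derivative
      (\<lambda>y. dtrans c' c'' (snd c' p) (dtrans c c' (snd c p) y))) (at (snd c p))"
    by (rule has_derivative_transform_within_open[OF _ open_overlap[OF c(1,2)]])
       (use c p in \<open>auto simp: transition_apply chart_inv_chart\<close>)
  from has_derivative_unique[OF this transition_has_derivative[OF c(1,3) p(1,3)]]
  show ?thesis by metis
qed

lemma dtrans_self:
  assumes c: "c \<in> M" and p: "p \<in> fst c"
  shows "dtrans c c (snd c p) y = y"
proof -
  have "((\<lambda>x. x) has_derivative (\<lambda>y. y)) (at (snd c p))" by simp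
  then have "(transition c c has_derivative (\<lambda>y. y)) (at (snd c p))"
    by (rule has_derivative_transform_within_open[OF _ open_chart_image[OF c]])
       (use c p in \<open>auto simp: transition_apply chart_inv_chart\<close>)
  from has_derivative_unique[OF this transition_has_derivative[OF c c p p]]
  show ?thesis by metis
qed

section \<open>Tangent vectors and their components\<close>

lemma tangent_change:
  "\<xi> \<in> tangent_space M p \<Longrightarrow> c \<in> M \<Longrightarrow> c' \<in> M \<Longrightarrow> p \<in> fst c \<Longrightarrow> p \<in> fst c' \<Longrightarrow>
    \<xi> c' = dtrans c c' (snd c p) (\<xi> c)"
  unfolding tangent_space_def by blast

lemma tangent_outside:
  "\<xi> \<in> tangent_space M p \<Longrightarrow> \<not> (c \<in> M \<and> p \<in> fst c) \<Longrightarrow> \<xi> c = 0"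
  unfolding tangent_space_def by blast

text \<open>Components in the other charts around \<open>p\<close> follow by the change of charts,
  and the remaining ones are 0 by convention; so identities of tangent vectors can be checked in a
  single chart.\<close>

lemma tangent_eqI:
  assumes "\<xi> \<in> tangent_space M p" "\<eta> \<in> tangent_space M p" "c \<in> M" "p \<in> fst c" "\<xi> c = \<eta> c"
  shows "\<xi> = \<eta>"
proof
  fix c'
  show "\<xi> c' = \<eta> c'"
  proof (cases "c' \<in> M \<and> p \<in> fst c'")
    case True
    then show ?thesis using tangent_change assms by metis
  next
    case False
    then show ?thesis using tangent_outside assms by metis
  qed
qed

lemma coord_vec_tangent:
  assumes "c \<in> M" "p \<in> fst c" shows "coord_vec M c p y \<in> tangent_space M p"
  unfolding tangent_space_def coord_vec_def using assms by (auto simp: dtrans_cocycle)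

lemma coord_vec_self [simp]: "c \<in> M \<Longrightarrow> p \<in> fst c \<Longrightarrow> coord_vec M c p y c = y"
  by (simp add: coord_vec_def dtrans_self)

lemma coord_vec_apply: "c' \<in> M \<Longrightarrow> p \<in> fst c' \<Longrightarrow> coord_vec M c p y c' = dtrans c c' (snd c p) y"
  by (simp add: coord_vec_def)

lemma coord_vec_tangent_component:
  "\<xi> \<in> tangent_space M p \<Longrightarrow> c \<in> M \<Longrightarrow> p \<in> fst c \<Longrightarrow> coord_vec M c p (\<xi> c) = \<xi>"
  by (rule tangent_eqI) (auto intro: coord_vec_tangent)

lemma tadd_tangent:
  assumes "\<xi> \<in> tangent_space M p" "\<eta> \<in> tangent_space M p" shows "tadd \<xi> \<eta> \<in> tangent_space M p"
  unfolding tangent_space_def mem_Collect_eq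
proof (intro conjI ballI allI impI)
  fix c c' assume c: "c \<in> M" "c' \<in> M" "p \<in> fst c \<and> p \<in> fst c'"
  then show "tadd \<xi> \<eta> c' = dtrans c c' (snd c p) (tadd \<xi> \<eta> c)"
    using tangent_change[OF assms(1) c(1,2)] tangent_change[OF assms(2) c(1,2)] linear_dtrans[OF c(1,2)]
    by (simp add: linear_add)
qed (simp add: tangent_outside[OF assms(1)] tangent_outside[OF assms(2)])

lemma tscale_tangent:
  assumes "\<xi> \<in> tangent_space M p" shows "tscale r \<xi> \<in> tangent_space M p"
  unfolding tangent_space_def mem_Collect_eq
proof (intro conjI ballI allI impI)
  fix c c' assume c: "c \<in> M" "c' \<in> M" "p \<in> fst c \<and> p \<in> fst c'"
  then show "tscale r \<xi> c' = dtrans c c' (snd c p) (tscale r \<xi> c)"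
    using tangent_change[OF assms(1) c(1,2)] linear_dtrans[OF c(1,2)]
    by (simp add: linear_cmul)
qed (simp add: tangent_outside[OF assms])

lemma tzero_tangent: "tzero \<in> tangent_space M p"
  unfolding tangent_space_def by (auto simp: linear_0 linear_dtrans)

lemma coord_vec_add:
  assumes "c \<in> M" "p \<in> fst c"
  shows "coord_vec M c p (y + z) = tadd (coord_vec M c p y) (coord_vec M c p z)"
  by (rule tangent_eqI[OF _ _ assms]) (use assms in \<open>auto intro!: tadd_tangent coord_vec_tangent\<close>)

lemma coord_vec_scale:
  assumes "c \<in> M" "p \<in> fst c"
  shows "coord_vec M c p (r *\<^sub>R y) = tscale r (coord_vec M c p y)"
  by (rule tangent_eqI[OF _ _ assms]) (use assms in \<open>auto intro!: tscale_tangent coord_vec_tangent\<close>)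

section \<open>Extension of local functions and fields to the manifold\<close>

lemma smooth_on_chart_change:
  assumes c: "c \<in> M" "c' \<in> M" and h: "smooth_on (snd c ` fst c) h"
  shows "smooth_on (snd c' ` (fst c' \<inter> fst c)) (\<lambda>x. h (snd c (chart_inv c' x)))"
proof -
  have "smooth_on (snd c' ` (fst c' \<inter> fst c)) (\<lambda>x. h (transition c' c x))"
    by (rule smooth_on_compose[OF h smooth_on_transition[OF c(2,1)] thick_open[OF open_overlap[OF c(2,1)]]])
       (use c in \<open>auto simp: transition_apply chart_inv_chart\<close>)
  then show ?thesis by (simp add: transition_apply)
qed

text \<open>The domain of \<open>c'\<close> is covered by its overlap with \<open>c\<close> and its
  part outside the closed set \<open>K\<close>; both are open, and on the second \<open>f\<close>
  vanishes.\<close>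

lemma smooth_on_extend_zero:
  fixes f :: "'a \<Rightarrow> 'b::real_normed_vector"
  assumes c: "c \<in> M" "c' \<in> M" and K: "closed K" "K \<subseteq> fst c" "\<And>q. q \<notin> K \<Longrightarrow> f q = 0"
    and f: "smooth_on (snd c' ` (fst c' \<inter> fst c)) (\<lambda>x. f (chart_inv c' x))"
  shows "smooth_on (snd c' ` fst c') (\<lambda>x. f (chart_inv c' x))"
proof (rule smooth_on_locally[OF thick_open[OF open_chart_image[OF c(2)]]])
  fix x assume x: "x \<in> snd c' ` fst c'"
  then obtain q where q: "q \<in> fst c'" "x = snd c' q" by auto
  show "\<exists>U. open U \<and> x \<in> U \<and> smooth_on (snd c' ` fst c' \<inter> U) (\<lambda>x. f (chart_inv c' x))"
  proof (cases "q \<in> fst c")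
    case True
    have "snd c' ` fst c' \<inter> snd c' ` (fst c' \<inter> fst c) = snd c' ` (fst c' \<inter> fst c)" by auto
    then show ?thesis
      using f q True open_overlap[OF c(2,1)] by (intro exI[of _ "snd c' ` (fst c' \<inter> fst c)"]) auto
  next
    case False
    let ?U = "snd c' ` (fst c' \<inter> - K)"
    have U: "open ?U" using K(1) by (intro open_chart_image_Int c) auto
    have "smooth_on (snd c' ` fst c' \<inter> ?U) (\<lambda>x. 0::'b)"
      by (intro smooth_on_const thick_open open_Int U open_chart_image c)
    then have "smooth_on (snd c' ` fst c' \<inter> ?U) (\<lambda>x. f (chart_inv c' x))"
      by (rule smooth_on_cong[THEN iffD1, rotated]) (use K(3) chart_inv_chart[OF c(2)] in auto)
    then show ?thesis using U q False K(2) by (intro exI[of _ ?U]) auto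
  qed
qed

text \<open>A Euclidean bump is transported by the chart and extended by 0. The set \<open>K\<close>
  is compact as the image of a closed ball, hence closed in the Hausdorff space, which makes the
  extension smooth in all charts.\<close>

lemma bump_function_exists:
  assumes c: "c \<in> M" and p: "p \<in> fst c" "p \<in> V" and V: "open V"
  obtains \<psi> K where "closed K" "K \<subseteq> fst c \<inter> V" "smooth_function M \<psi>"
    "\<forall>\<^sub>F q in nhds p. \<psi> q = 1" "\<And>q. q \<notin> K \<Longrightarrow> \<psi> q = 0"
proof -
  have "snd c p \<in> snd c ` (fst c \<inter> V)" using p by auto
  with open_chart_image_Int[OF c V] obtain R where
    R: "R > 0" "cball (snd c p) R \<subseteq> snd c ` (fst c \<inter> V)"
    using open_contains_cball by metis
  then have R': "cball (snd c p) R \<subseteq> snd c ` fst c" by auto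
  obtain b where b: "smooth_on UNIV b" "\<And>x. x \<in> ball (snd c p) (R/2) \<Longrightarrow> b x = 1"
      "\<And>x. x \<notin> ball (snd c p) R \<Longrightarrow> b x = (0::real)"
    using smooth_bump_exists[of "R/2" R "snd c p"] R(1) by auto
  define K where "K = chart_inv c ` cball (snd c p) R"
  define \<psi> where "\<psi> q = (if q \<in> fst c then b (snd c q) else 0)" for q
  have "compact K"
    unfolding K_def
    by (rule compact_continuous_image[OF continuous_on_subset[OF continuous_on_chart_inv[OF c] R']]) simp
  then have K: "closed K" by (rule compact_imp_closed)
  have KV: "K \<subseteq> fst c \<inter> V" unfolding K_def using R(2) chart_inv_chart[OF c] by auto
  have \<psi>0: "\<psi> q = 0" if "q \<notin> K" for q
  proof (cases "q \<in> fst c")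
    case True
    then have "snd c q \<notin> ball (snd c p) R"
      using that chart_inv_chart[OF c True] unfolding K_def by (metis ball_subset_cball imageI subsetD)
    with True b(3) show ?thesis by (simp add: \<psi>_def)
  qed (simp add: \<psi>_def)
  have "smooth_on (snd c' ` fst c') (\<lambda>x. \<psi> (chart_inv c' x))" if c': "c' \<in> M" for c'
  proof (rule smooth_on_extend_zero[OF c c' K _ \<psi>0])
    have "smooth_on (snd c' ` (fst c' \<inter> fst c)) (\<lambda>x. b (snd c (chart_inv c' x)))"
      by (intro smooth_on_chart_change c c' smooth_on_subset[OF b(1)] thick_open open_chart_image) auto
    then show "smooth_on (snd c' ` (fst c' \<inter> fst c)) (\<lambda>x. \<psi> (chart_inv c' x))"
      by (rule smooth_on_cong[THEN iffD1, rotated]) (auto simp: \<psi>_def chart_inv_chart[OF c'])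
  qed (use KV in auto)
  then have sm: "smooth_function M \<psi>" by (simp add: smooth_function_def o_def)
  have "open (fst c \<inter> snd c -` ball (snd c p) (R/2))"
    by (rule continuous_open_preimage[OF continuous_on_chart[OF c] open_chart_domain[OF c]]) simp
  then have "\<forall>\<^sub>F q in nhds p. \<psi> q = 1"
    unfolding eventually_nhds
    by (intro exI[of _ "fst c \<inter> snd c -` ball (snd c p) (R/2)"]) (use p R b(2) in \<open>auto simp: \<psi>_def\<close>)
  with that K KV sm \<psi>0 show ?thesis by blast
qed

lemma smooth_functionD:
  "smooth_function M f \<Longrightarrow> c \<in> M \<Longrightarrow> smooth_on (snd c ` fst c) (\<lambda>x. f (chart_inv c x))"
  by (simp add: smooth_function_def o_def)

lemma local_function_extends:
  assumes c: "c \<in> M" and p: "p \<in> fst c" and h: "smooth_on (snd c ` fst c) h"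
  obtains f where "smooth_function M f" "\<forall>\<^sub>F q in nhds p. f q = h (snd c q)"
proof -
  obtain \<psi> K where \<psi>': "closed K" "K \<subseteq> fst c \<inter> UNIV" and \<psi>: "smooth_function M \<psi>"
    "\<forall>\<^sub>F q in nhds p. \<psi> q = 1" "\<And>q. q \<notin> K \<Longrightarrow> \<psi> q = 0"
    by (rule bump_function_exists[OF c p UNIV_I open_UNIV]) (rule that)
  have K: "K \<subseteq> fst c" using \<psi>' by simp
  have "smooth_on (snd c' ` fst c') (\<lambda>x. \<psi> (chart_inv c' x) * h (snd c (chart_inv c' x)))" if c': "c' \<in> M" for c'
  proof (rule smooth_on_extend_zero[OF c c' \<psi>'(1) K])
    have o: "thick (snd c' ` (fst c' \<inter> fst c))" by (intro thick_open open_overlap c c')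
    show "smooth_on (snd c' ` (fst c' \<inter> fst c)) (\<lambda>x. \<psi> (chart_inv c' x) * h (snd c (chart_inv c' x)))"
      by (intro smooth_on_mult o smooth_on_chart_change[OF c c' h]
          smooth_on_subset[OF smooth_functionD[OF \<psi>(1) c']]) auto
  qed (simp add: \<psi>(3))
  then have "smooth_function M (\<lambda>q. \<psi> q * h (snd c q))" by (simp add: smooth_function_def o_def)
  moreover have "\<forall>\<^sub>F q in nhds p. \<psi> q * h (snd c q) = h (snd c q)"
    using \<psi>(2) by eventually_elim simp
  ultimately show ?thesis using that by blast
qed

text \<open>Multiplication by a bump function makes the field global without changing it near
  \<open>p\<close>. This supplies global fields with prescribed components, on which a connection
  can be evaluated.\<close>

lemma local_vector_field_extends:
  assumes c: "c \<in> M" and p: "p \<in> fst c" and h: "smooth_on (snd c ` fst c) h"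
  obtains X where "X \<in> vector_fields M" "\<forall>\<^sub>F q in nhds p. X q = coord_vec M c q (h (snd c q))"
proof -
  obtain \<psi> K where \<psi>': "closed K" "K \<subseteq> fst c \<inter> UNIV" and \<psi>: "smooth_function M \<psi>"
    "\<forall>\<^sub>F q in nhds p. \<psi> q = 1" "\<And>q. q \<notin> K \<Longrightarrow> \<psi> q = 0"
    by (rule bump_function_exists[OF c p UNIV_I open_UNIV]) (rule that)
  have K: "K \<subseteq> fst c" using \<psi>' by simp
  define X where "X q = tscale (\<psi> q) (coord_vec M c q (h (snd c q)))" for q
  have X0: "X q = tzero" if "q \<notin> K" for q
    using \<psi>(3)[OF that] by (auto simp: X_def tscale_def tzero_def)
  have "X q \<in> tangent_space M q" for q
  proof (cases "q \<in> fst c")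
    case True
    then show ?thesis unfolding X_def by (intro tscale_tangent coord_vec_tangent c)
  next
    case False
    with K have "X q = tzero" by (intro X0) blast
    then show ?thesis by (simp add: tzero_tangent)
  qed
  moreover have "smooth_on (snd c' ` fst c') (\<lambda>x. X (chart_inv c' x) c')" if c': "c' \<in> M" for c'
  proof (rule smooth_on_extend_zero[OF c c' \<psi>'(1) K, where f = "\<lambda>q. X q c'"])
    show "X q c' = 0" if "q \<notin> K" for q using X0[OF that] by simp
    let ?S = "snd c' ` (fst c' \<inter> fst c)"
    have o: "thick ?S" by (intro thick_open open_overlap c c')
    \<comment> \<open>In \<open>c'\<close> the component vector is the local field pushed forward by
      \<open>dtrans c c'\<close>; its base point and its argument both move, each read in the
      coordinates of \<open>c\<close>.\<close>
    have "smooth_on ?S (\<lambda>x. \<psi> (chart_inv c' x) *\<^sub>R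
        dtrans c c' (transition c' c x) (h (snd c (chart_inv c' x))))"
    proof (intro smooth_on_scaleR o)
      show "smooth_on ?S (\<lambda>x. \<psi> (chart_inv c' x))"
        by (rule smooth_on_subset[OF smooth_functionD[OF \<psi>(1) c'] o]) auto
      show "smooth_on ?S (\<lambda>x. dtrans c c' (transition c' c x) (h (snd c (chart_inv c' x))))"
        by (rule smooth_on_frechet_derivative_apply[OF smooth_on_transition[OF c c'] open_overlap[OF c c']
              smooth_on_transition[OF c' c] smooth_on_chart_change[OF c c' h] o])
           (auto simp: transition_apply chart_inv_chart[OF c'])
    qed
    then show "smooth_on ?S (\<lambda>x. X (chart_inv c' x) c')"
      by (rule smooth_on_cong[THEN iffD1, rotated])
         (auto simp: X_def coord_vec_apply c c' transition_apply chart_inv_chart)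
  qed
  ultimately have "X \<in> vector_fields M" by (simp add: vector_fields_def)
  moreover have "\<forall>\<^sub>F q in nhds p. X q = coord_vec M c q (h (snd c q))"
    using \<psi>(2) by eventually_elim (simp add: X_def tscale_def)
  ultimately show ?thesis using that by blast
qed

lemma extension_exists:
  assumes c: "c \<in> M" "p \<in> fst c" shows "\<exists>X. is_extension M c i p X"
proof -
  have "smooth_on (snd c ` fst c) (\<lambda>x. axis i (1::real) :: real^'n)"
    by (intro smooth_on_const thick_open open_chart_image c)
  then obtain X where "X \<in> vector_fields M" "\<forall>\<^sub>F q in nhds p. X q = coord_vec M c q (axis i 1)"
    by (rule local_vector_field_extends[OF c]) (rule that)
  then show ?thesis unfolding is_extension_def coord_frame_def by blast
qed

lemma vector_fieldD:
  assumes "X \<in> vector_fields M"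
  shows "X p \<in> tangent_space M p" "c \<in> M \<Longrightarrow> smooth_on (snd c ` fst c) (\<lambda>x. X (chart_inv c x) c)"
  using assms by (auto simp: vector_fields_def)

lemma tadd_vector_field:
  assumes "X \<in> vector_fields M" "Y \<in> vector_fields M"
  shows "(\<lambda>p. tadd (X p) (Y p)) \<in> vector_fields M"
  unfolding vector_fields_def mem_Collect_eq
proof (intro conjI allI ballI)
  show "tadd (X p) (Y p) \<in> tangent_space M p" for p
    by (intro tadd_tangent vector_fieldD(1) assms)
  show "smooth_on (snd c ` fst c) (\<lambda>x. tadd (X (chart_inv c x)) (Y (chart_inv c x)) c)" if "c \<in> M" for c
    unfolding tadd_apply by (intro smooth_on_add thick_open open_chart_image vector_fieldD(2) assms that)
qed

lemma tscale_vector_field: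
  assumes "smooth_function M f" "X \<in> vector_fields M"
  shows "(\<lambda>p. tscale (f p) (X p)) \<in> vector_fields M"
  unfolding vector_fields_def mem_Collect_eq
proof (intro conjI allI ballI)
  show "tscale (f p) (X p) \<in> tangent_space M p" for p
    by (intro tscale_tangent vector_fieldD(1) assms)
  show "smooth_on (snd c ` fst c) (\<lambda>x. tscale (f (chart_inv c x)) (X (chart_inv c x)) c)" if "c \<in> M" for c
    unfolding tscale_apply
    by (intro smooth_on_scaleR thick_open open_chart_image vector_fieldD(2) smooth_functionD assms that)
qed

lemma tzero_vector_field: "(\<lambda>p. tzero) \<in> vector_fields M"
  unfolding vector_fields_def
  by (auto intro!: tzero_tangent smooth_on_const thick_open open_chart_image)

lemma smooth_function_const: "smooth_function M (\<lambda>p. r)"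
  unfolding smooth_function_def o_def by (auto intro!: smooth_on_const thick_open open_chart_image)

text \<open>By the chain rule the chart that \<open>SOME\<close> picks in \<open>tvec_apply\<close>
  is immaterial.\<close>

lemma tvec_apply_chart:
  assumes f: "smooth_function M f" and \<xi>: "\<xi> \<in> tangent_space M p" and c: "c \<in> M" "p \<in> fst c"
  shows "tvec_apply M p \<xi> f = frechet_derivative (\<lambda>x. f (chart_inv c x)) (at (snd c p)) (\<xi> c)"
proof -
  define c0 where "c0 = (SOME c. c \<in> M \<and> p \<in> fst c)"
  have c0: "c0 \<in> M" "p \<in> fst c0"
    unfolding c0_def using someI[of "\<lambda>c. c \<in> M \<and> p \<in> fst c" c] c by auto
  have der: "((\<lambda>x. f (chart_inv c x)) has_derivative frechet_derivative (\<lambda>x. f (chart_inv c x)) (at (snd c p))) (at (snd c p))"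
    if "c \<in> M" "p \<in> fst c" for c
    by (rule smooth_on_open_has_derivative[OF smooth_functionD[OF f that(1)] open_chart_image[OF that(1)]])
       (use that in auto)
  have t: "transition c c0 (snd c p) = snd c0 p" by (simp add: transition_apply chart_inv_chart c)
  have "((\<lambda>x. f (chart_inv c0 (transition c c0 x))) has_derivative
      (\<lambda>y. frechet_derivative (\<lambda>x. f (chart_inv c0 x)) (at (snd c0 p)) (dtrans c c0 (snd c p) y))) (at (snd c p))"
    by (rule has_derivative_compose[OF transition_has_derivative[OF c(1) c0(1) c(2) c0(2)]])
       (use der[OF c0] t in simp)
  then have "((\<lambda>x. f (chart_inv c x)) has_derivative
      (\<lambda>y. frechet_derivative (\<lambda>x. f (chart_inv c0 x)) (at (snd c0 p)) (dtrans c c0 (snd c p) y))) (at (snd c p))"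
    by (rule has_derivative_transform_within_open[OF _ open_overlap[OF c(1) c0(1)]])
       (use c c0 in \<open>auto simp: transition_apply chart_inv_chart\<close>)
  from has_derivative_unique[OF this der[OF c]]
  have "frechet_derivative (\<lambda>x. f (chart_inv c x)) (at (snd c p)) (\<xi> c)
      = frechet_derivative (\<lambda>x. f (chart_inv c0 x)) (at (snd c0 p)) (dtrans c c0 (snd c p) (\<xi> c))"
    by metis
  also have "dtrans c c0 (snd c p) (\<xi> c) = \<xi> c0"
    using tangent_change[OF \<xi> c(1) c0(1) c(2) c0(2)] by simp
  finally show ?thesis by (simp add: tvec_apply_def c0_def[symmetric] o_def)
qed

end

section \<open>Anisotropic connections in charts\<close>

lemma tscale_0 [simp]: "tscale 0 \<xi> = tzero"
  by (simp add: tscale_def tzero_def)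

lemma tscale_1 [simp]: "tscale 1 \<xi> = \<xi>"
  by (simp add: tscale_def)

lemma tadd_tzero [simp]: "tadd \<xi> tzero = \<xi>"
  by (simp add: tadd_def tzero_def)

definition tsum :: "'i set \<Rightarrow> ('i \<Rightarrow> ('a, 'n::finite) tvec) \<Rightarrow> ('a, 'n) tvec" where
  "tsum I \<xi> = (\<lambda>c. \<Sum>i\<in>I. \<xi> i c)"

lemma tsum_apply [simp]: "tsum I \<xi> c = (\<Sum>i\<in>I. \<xi> i c)"
  by (simp add: tsum_def)

lemma tsum_empty [simp]: "tsum {} \<xi> = tzero"
  by (simp add: tsum_def tzero_def)

lemma tsum_insert [simp]: "finite I \<Longrightarrow> i \<notin> I \<Longrightarrow> tsum (insert i I) \<xi> = tadd (\<xi> i) (tsum I \<xi>)"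
  by (simp add: tsum_def tadd_def)

lemma sum_vec_nth_axis: "(\<Sum>i\<in>UNIV. x $ i *\<^sub>R axis i (1::real)) = (x :: real^'n::finite)"
  by (simp add: vec_eq_iff axis_def if_distrib sum.delta' cong: if_cong)

text \<open>The bilinear form of the overview, with the direction of differentiation first. Working
  with forms instead of indices lets changes of charts act through \<open>dtrans\<close>.\<close>

definition conn_form :: "('a::topological_space, 'n::finite) chart set \<Rightarrow> ('a, 'n) operator \<Rightarrow> ('a, 'n) chart
    \<Rightarrow> ('a, 'n) tbundle \<Rightarrow> real^'n \<Rightarrow> real^'n \<Rightarrow> real^'n" where
  "conn_form M D c v a b = (\<chi> k. \<Sum>i\<in>UNIV. \<Sum>j\<in>UNIV. christoffel M D c v k i j * a $ i * b $ j)"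

lemma bounded_linear_conn_form_right: "bounded_linear (conn_form M D c v a)"
  unfolding linear_conv_bounded_linear[symmetric]
  by (rule linearI) (auto simp: conn_form_def vec_eq_iff algebra_simps sum.distrib sum_distrib_left)

lemma bounded_linear_conn_form_left: "bounded_linear (\<lambda>a. conn_form M D c v a b)"
  unfolding linear_conv_bounded_linear[symmetric]
  by (rule linearI) (auto simp: conn_form_def vec_eq_iff algebra_simps sum.distrib sum_distrib_left)

lemma conn_form_axis: "conn_form M D c v (axis i 1) (axis j 1) $ k = christoffel M D c v k i j"
  by (simp add: conn_form_def axis_def mult_delta_right mult_delta_left)

lemma is_extension_eq:
  assumes "is_extension M c i p X" "is_extension M c i p Y" shows "\<forall>\<^sub>F q in nhds p. X q = Y q"
proof -
  have "\<forall>\<^sub>F q in nhds p. X q = coord_frame M c i q" "\<forall>\<^sub>F q in nhds p. Y q = coord_frame M c i q"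
    using assms unfolding is_extension_def by auto
  then show ?thesis by eventually_elim simp
qed

context manifold begin

lemma tsum_vector_field:
  "finite I \<Longrightarrow> (\<And>i. i \<in> I \<Longrightarrow> X i \<in> vector_fields M) \<Longrightarrow> (\<lambda>p. tsum I (\<lambda>i. X i p)) \<in> vector_fields M"
  by (induction I rule: finite_induct) (auto intro: tzero_vector_field tadd_vector_field)

lemma tsum_tangent:
  "finite I \<Longrightarrow> (\<And>i. i \<in> I \<Longrightarrow> \<xi> i \<in> tangent_space M p) \<Longrightarrow> tsum I \<xi> \<in> tangent_space M p"
  by (induction I rule: finite_induct) (auto intro: tzero_tangent tadd_tangent)

lemma eventually_in_chart: "c \<in> M \<Longrightarrow> p \<in> fst c \<Longrightarrow> \<forall>\<^sub>F q in nhds p. q \<in> fst c"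
  using open_chart_domain eventually_nhds_in_open by blast

text \<open>The rules for connections admit only global coefficient functions, so the components of
  \<open>X\<close> are replaced by global functions that agree with them near
  \<open>p\<close>.\<close>

lemma vector_field_expansion:
  assumes X: "X \<in> vector_fields M" and c: "c \<in> M" "p \<in> fst c" and E: "\<And>i. is_extension M c i p (E i)"
  obtains f where "\<And>i. smooth_function M (f i)" "\<And>i. \<forall>\<^sub>F q in nhds p. f i q = X q c $ i"
    "\<forall>\<^sub>F q in nhds p. X q = tsum UNIV (\<lambda>i. tscale (f i q) (E i q))"
proof -
  have "\<exists>g. smooth_function M g \<and> (\<forall>\<^sub>F q in nhds p. g q = X (chart_inv c (snd c q)) c $ i)" for i
  proof -
    have "smooth_on (snd c ` fst c) (\<lambda>x. X (chart_inv c x) c $ i)"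
      by (intro smooth_on_vec_nth thick_open open_chart_image vector_fieldD(2) X c)
    then obtain g where "smooth_function M g" "\<forall>\<^sub>F q in nhds p. g q = X (chart_inv c (snd c q)) c $ i"
      by (rule local_function_extends[OF c]) (rule that)
    then show ?thesis by blast
  qed
  then obtain f where f: "\<And>i. smooth_function M (f i)"
    "\<And>i. \<forall>\<^sub>F q in nhds p. f i q = X (chart_inv c (snd c q)) c $ i" by metis
  have f': "\<forall>\<^sub>F q in nhds p. f i q = X q c $ i" for i
    using f(2)[of i] eventually_in_chart[OF c] by eventually_elim (simp add: chart_inv_chart c)
  have Ev: "\<forall>\<^sub>F q in nhds p. E i q = coord_frame M c i q" for i
    using E unfolding is_extension_def by blast
  have f'': "\<forall>\<^sub>F q in nhds p. \<forall>i. f i q = X q c $ i" by (intro eventually_all_finite f')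
  have Ev': "\<forall>\<^sub>F q in nhds p. \<forall>i. E i q = coord_frame M c i q" by (intro eventually_all_finite Ev)
  have "\<forall>\<^sub>F q in nhds p. X q = tsum UNIV (\<lambda>i. tscale (f i q) (E i q))"
    using eventually_in_chart[OF c] f'' Ev'
  proof eventually_elim
    case (elim q)
    have "E i q \<in> tangent_space M q" for i
      using E vector_fieldD(1) unfolding is_extension_def by blast
    then have "tsum UNIV (\<lambda>i. tscale (f i q) (E i q)) \<in> tangent_space M q"
      by (intro tsum_tangent tscale_tangent) auto
    then show ?case
      by (intro tangent_eqI[OF vector_fieldD(1)[OF X] _ c(1) elim(1)])
         (use elim in \<open>simp_all add: coord_frame_def c sum_vec_nth_axis\<close>)
  qed
  with f(1) f' that show ?thesis by blast
qed

end

locale bundle_domain = manifold M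
  for M :: "('a::{t2_space, second_countable_topology}, 'n::finite) chart set" +
  fixes A :: "('a, 'n) tbundle set"
  assumes A_open: "open_in_bundle M A"
begin

lemma A_tangent: "v \<in> A \<Longrightarrow> snd v \<in> tangent_space M (fst v)"
  using A_open unfolding open_in_bundle_def tangent_bundle_def by auto

lemma open_coord_dom: "c \<in> M \<Longrightarrow> open (coord_dom c A)"
  using A_open unfolding open_in_bundle_def by blast

lemma from_to_coords:
  assumes "v \<in> A" "c \<in> M" "fst v \<in> fst c" shows "from_coords M c (to_coords c v) = v"
proof (rule prod_eqI)
  show "fst (from_coords M c (to_coords c v)) = fst v"
    using assms by (simp add: from_coords_def to_coords_def chart_inv_chart)
  show "snd (from_coords M c (to_coords c v)) = snd v"
    using assms by (simp add: from_coords_def to_coords_def chart_inv_chart coord_vec_tangent_component A_tangent)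
qed

lemma to_coords_in_coord_dom: "v \<in> A \<Longrightarrow> fst v \<in> fst c \<Longrightarrow> to_coords c v \<in> coord_dom c A"
  by (auto simp: coord_dom_def)

lemma coord_domE:
  assumes "z \<in> coord_dom c A" "c \<in> M"
  obtains v where "v \<in> A" "fst v \<in> fst c" "z = to_coords c v" "from_coords M c z = v"
  using assms from_to_coords unfolding coord_dom_def by blast

end

locale connection = bundle_domain M A
  for M :: "('a::{t2_space, second_countable_topology}, 'n::finite) chart set" and A +
  fixes D :: "('a, 'n) operator"
  assumes conn: "anisotropic_connection M A D"
begin

section \<open>Algebraic rules and locality of a connection\<close>

lemma D_anisotropic: "X \<in> vector_fields M \<Longrightarrow> Y \<in> vector_fields M \<Longrightarrow> D X Y \<in> anisotropic_vector_fields M A"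
  using conn unfolding anisotropic_connection_def by blast

lemma D_tangent: "X \<in> vector_fields M \<Longrightarrow> Y \<in> vector_fields M \<Longrightarrow> v \<in> A \<Longrightarrow> D X Y v \<in> tangent_space M (fst v)"
  using D_anisotropic unfolding anisotropic_vector_fields_def by blast

lemma D_smooth: "X \<in> vector_fields M \<Longrightarrow> Y \<in> vector_fields M \<Longrightarrow> c \<in> M \<Longrightarrow>
    smooth_on (coord_dom c A) (\<lambda>z. D X Y (from_coords M c z) c)"
  using D_anisotropic unfolding anisotropic_vector_fields_def by blast

lemma D_add_right: "X \<in> vector_fields M \<Longrightarrow> Y \<in> vector_fields M \<Longrightarrow> Z \<in> vector_fields M \<Longrightarrow> v \<in> A \<Longrightarrow>
    D X (\<lambda>p. tadd (Y p) (Z p)) v = tadd (D X Y v) (D X Z v)"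
  using conn unfolding anisotropic_connection_def by blast

lemma D_add_left: "X \<in> vector_fields M \<Longrightarrow> Y \<in> vector_fields M \<Longrightarrow> Z \<in> vector_fields M \<Longrightarrow> v \<in> A \<Longrightarrow>
    D (\<lambda>p. tadd (X p) (Y p)) Z v = tadd (D X Z v) (D Y Z v)"
  using conn unfolding anisotropic_connection_def by blast

lemma D_scale_right: "X \<in> vector_fields M \<Longrightarrow> Y \<in> vector_fields M \<Longrightarrow> smooth_function M f \<Longrightarrow> v \<in> A \<Longrightarrow>
    D X (\<lambda>p. tscale (f p) (Y p)) v =
      tadd (tscale (tvec_apply M (fst v) (X (fst v)) f) (Y (fst v))) (tscale (f (fst v)) (D X Y v))"
  using conn unfolding anisotropic_connection_def by blast

lemma D_scale_left:
  assumes "X \<in> vector_fields M" "Y \<in> vector_fields M" "smooth_function M f" "v \<in> A"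
  shows "D (\<lambda>p. tscale (f p) (X p)) Y v = tscale (f (fst v)) (D X Y v)"
proof -
  \<comment> \<open>The axiom is stated for combinations of two terms; the second one gets the
    coefficient 0.\<close>
  have "D (\<lambda>p. tadd (tscale (f p) (X p)) (tscale 0 (X p))) Y v
      = tadd (tscale (f (fst v)) (D X Y v)) (tscale 0 (D X Y v))"
    using conn assms smooth_function_const[of 0] unfolding anisotropic_connection_def by blast
  then show ?thesis by simp
qed

lemma D_zero_right:
  assumes "X \<in> vector_fields M" "v \<in> A" shows "D X (\<lambda>p. tzero) v = tzero"
proof
  fix c
  show "D X (\<lambda>p. tzero) v c = tzero c"
    \<comment> \<open>Additivity for \<open>tzero\<close> plus \<open>tzero\<close> gives a vector
      that equals its own double.\<close>
    using D_add_right[OF assms(1) tzero_vector_field tzero_vector_field assms(2), THEN fun_cong, of c] by simp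
qed

lemma D_zero_left:
  assumes "Y \<in> vector_fields M" "v \<in> A" shows "D (\<lambda>p. tzero) Y v = tzero"
proof
  fix c
  show "D (\<lambda>p. tzero) Y v c = tzero c"
    using D_add_left[OF tzero_vector_field tzero_vector_field assms, THEN fun_cong, of c] by simp
qed

lemma D_sum_right:
  assumes "X \<in> vector_fields M" "v \<in> A" "finite I" "\<And>i. i \<in> I \<Longrightarrow> Y i \<in> vector_fields M"
  shows "D X (\<lambda>p. tsum I (\<lambda>i. Y i p)) v = tsum I (\<lambda>i. D X (Y i) v)"
  using assms(3,4)
proof (induction I rule: finite_induct)
  case empty
  show ?case unfolding tsum_empty using assms by (intro D_zero_right)
next
  case (insert i I)
  have Y: "Y i \<in> vector_fields M" "(\<lambda>p. tsum I (\<lambda>i. Y i p)) \<in> vector_fields M"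
    using insert by (auto intro!: tsum_vector_field simp del: tsum_apply)
  have "D X (\<lambda>p. tadd (Y i p) (tsum I (\<lambda>i. Y i p))) v = tadd (D X (Y i) v) (D X (\<lambda>p. tsum I (\<lambda>i. Y i p)) v)"
    by (intro D_add_right assms(1,2) Y)
  with insert show ?case unfolding tsum_insert[OF insert.hyps] by (simp only: insert_iff simp_thms)
qed

lemma D_sum_left:
  assumes "Y \<in> vector_fields M" "v \<in> A" "finite I" "\<And>i. i \<in> I \<Longrightarrow> X i \<in> vector_fields M"
  shows "D (\<lambda>p. tsum I (\<lambda>i. X i p)) Y v = tsum I (\<lambda>i. D (X i) Y v)"
  using assms(3,4)
proof (induction I rule: finite_induct)
  case empty
  show ?case unfolding tsum_empty using assms by (intro D_zero_left)
next
  case (insert i I)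
  have X: "X i \<in> vector_fields M" "(\<lambda>p. tsum I (\<lambda>i. X i p)) \<in> vector_fields M"
    using insert by (auto intro!: tsum_vector_field simp del: tsum_apply)
  have "D (\<lambda>p. tadd (X i p) (tsum I (\<lambda>i. X i p))) Y v = tadd (D (X i) Y v) (D (\<lambda>p. tsum I (\<lambda>i. X i p)) Y v)"
    by (intro D_add_left assms(1,2) X)
  with insert show ?case unfolding tsum_insert[OF insert.hyps] by (simp only: insert_iff simp_thms)
qed

text \<open>A bump function supported where \<open>X\<close> and \<open>X'\<close> agree makes the
  two products globally equal, so that the rules for scaled fields can compare a connection on
  \<open>X\<close> with the same connection on \<open>X'\<close>.\<close>

lemma cutoff_exists:
  assumes "\<forall>\<^sub>F q in nhds p. X q = X' q"
  obtains \<psi> where "smooth_function M \<psi>" "\<psi> p = 1" "(\<lambda>q. tscale (\<psi> q) (X q)) = (\<lambda>q. tscale (\<psi> q) (X' q))"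
proof -
  obtain V where V: "open V" "p \<in> V" "\<And>q. q \<in> V \<Longrightarrow> X q = X' q"
    using assms unfolding eventually_nhds by blast
  obtain c where c: "c \<in> M" "p \<in> fst c" by (rule chart_exists)
  obtain \<psi> K where K: "K \<subseteq> fst c \<inter> V" and \<psi>: "smooth_function M \<psi>" "\<forall>\<^sub>F q in nhds p. \<psi> q = 1"
    "\<And>q. q \<notin> K \<Longrightarrow> \<psi> q = 0"
    by (rule bump_function_exists[OF c V(2,1)]) (rule that)
  have "tscale (\<psi> q) (X q) = tscale (\<psi> q) (X' q)" for q
  proof (cases "q \<in> K")
    case True
    then show ?thesis using K V(3) by auto
  qed (simp add: \<psi>(3))
  with \<psi>(1) eventually_nhds_x_imp_x[OF \<psi>(2)] that show ?thesis by blast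
qed

lemma D_local_left:
  assumes "X \<in> vector_fields M" "X' \<in> vector_fields M" "Y \<in> vector_fields M" "v \<in> A"
    "\<forall>\<^sub>F q in nhds (fst v). X q = X' q"
  shows "D X Y v = D X' Y v"
proof -
  obtain \<psi> where \<psi>: "smooth_function M \<psi>" "\<psi> (fst v) = 1"
    "(\<lambda>q. tscale (\<psi> q) (X q)) = (\<lambda>q. tscale (\<psi> q) (X' q))"
    by (rule cutoff_exists[OF assms(5)])
  show ?thesis
    using D_scale_left[OF assms(1,3) \<psi>(1) assms(4)] D_scale_left[OF assms(2,3) \<psi>(1) assms(4)]
    unfolding \<psi>(2,3) by simp
qed

lemma D_local_right:
  assumes "X \<in> vector_fields M" "Y \<in> vector_fields M" "Y' \<in> vector_fields M" "v \<in> A"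
    "\<forall>\<^sub>F q in nhds (fst v). Y q = Y' q"
  shows "D X Y v = D X Y' v"
proof -
  obtain \<psi> where \<psi>: "smooth_function M \<psi>" "\<psi> (fst v) = 1"
    "(\<lambda>q. tscale (\<psi> q) (Y q)) = (\<lambda>q. tscale (\<psi> q) (Y' q))"
    by (rule cutoff_exists[OF assms(5)])
  have eq: "Y (fst v) = Y' (fst v)" by (rule eventually_nhds_x_imp_x[OF assms(5)])
  \<comment> \<open>The Leibniz terms of the two sides coincide because \<open>Y\<close> and
    \<open>Y'\<close> agree at the base point, so they cancel.\<close>
  have "tadd (tscale (tvec_apply M (fst v) (X (fst v)) \<psi>) (Y (fst v))) (D X Y v)
      = tadd (tscale (tvec_apply M (fst v) (X (fst v)) \<psi>) (Y (fst v))) (D X Y' v)"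
    using D_scale_right[OF assms(1,2) \<psi>(1) assms(4)] D_scale_right[OF assms(1,3) \<psi>(1) assms(4)]
    unfolding \<psi>(2,3) eq by simp
  then show ?thesis by (simp add: tadd_def fun_eq_iff)
qed

lemma D_local:
  assumes "X \<in> vector_fields M" "X' \<in> vector_fields M" "Y \<in> vector_fields M" "Y' \<in> vector_fields M" "v \<in> A"
    "\<forall>\<^sub>F q in nhds (fst v). X q = X' q" "\<forall>\<^sub>F q in nhds (fst v). Y q = Y' q"
  shows "D X Y v = D X' Y' v"
  using D_local_left[OF assms(1,2,3,5,6)] D_local_right[OF assms(2,3,4,5,7)] by simp

text \<open>By locality the extensions picked by \<open>SOME\<close> can be replaced by any others,
  in particular by a pair that does not change with the base point.\<close>

lemma christoffel_extension:
  assumes v: "v \<in> A" and E: "is_extension M c i (fst v) E" and F: "is_extension M c j (fst v) F"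
  shows "christoffel M D c v k i j = D E F v c $ k"
proof -
  let ?X = "SOME X. is_extension M c i (fst v) X" and ?Y = "SOME Y. is_extension M c j (fst v) Y"
  have X: "is_extension M c i (fst v) ?X" and Y: "is_extension M c j (fst v) ?Y"
    using someI[of "is_extension M c i (fst v)", OF E] someI[of "is_extension M c j (fst v)", OF F] by auto
  have "\<forall>\<^sub>F q in nhds (fst v). ?X q = E q" by (rule is_extension_eq[OF X E])
  moreover have "\<forall>\<^sub>F q in nhds (fst v). ?Y q = F q" by (rule is_extension_eq[OF Y F])
  ultimately have "D ?X ?Y v = D E F v"
    using X Y E F v unfolding is_extension_def by (intro D_local) auto
  then show ?thesis by (simp add: christoffel_def)
qed

text \<open>Both fields are expanded in a frame that extends the coordinate fields. Linearity over
  functions handles the coefficients of \<open>X\<close>; the Leibniz rule on those of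
  \<open>Y\<close> produces the derivative term, and the values on pairs of frame fields are the
  Christoffel symbols.\<close>

lemma D_chart:
  assumes X: "X \<in> vector_fields M" and Y: "Y \<in> vector_fields M" and v: "v \<in> A"
    and c: "c \<in> M" "fst v \<in> fst c"
  shows "D X Y v c = frechet_derivative (\<lambda>x. Y (chart_inv c x) c) (at (snd c (fst v))) (X (fst v) c)
      + conn_form M D c v (X (fst v) c) (Y (fst v) c)"
proof -
  define p where "p = fst v"
  let ?Yc = "\<lambda>x. Y (chart_inv c x) c"
  have p: "p \<in> fst c" using c by (simp add: p_def)
  obtain E where E: "\<And>i. is_extension M c i p (E i)" using extension_exists[OF c(1) p] by metis
  have EV: "E i \<in> vector_fields M" for i using E unfolding is_extension_def by blast
  have Ep: "E i p c = axis i 1" for i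
  proof -
    have "\<forall>\<^sub>F q in nhds p. E i q = coord_frame M c i q"
      using E[of i] unfolding is_extension_def by blast
    from eventually_nhds_x_imp_x[OF this] show ?thesis by (simp add: coord_frame_def c(1) p)
  qed
  obtain f where f: "\<And>i. smooth_function M (f i)" "\<And>i. \<forall>\<^sub>F q in nhds p. f i q = X q c $ i"
    "\<forall>\<^sub>F q in nhds p. X q = tsum UNIV (\<lambda>i. tscale (f i q) (E i q))"
    by (rule vector_field_expansion[OF X c(1) p E]) (rule that)
  obtain g where g: "\<And>i. smooth_function M (g i)" "\<And>i. \<forall>\<^sub>F q in nhds p. g i q = Y q c $ i"
    "\<forall>\<^sub>F q in nhds p. Y q = tsum UNIV (\<lambda>i. tscale (g i q) (E i q))"
    by (rule vector_field_expansion[OF Y c(1) p E]) (rule that)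
  have fp: "f i p = X p c $ i" for i by (rule eventually_nhds_x_imp_x[OF f(2)])
  have gp: "g i p = Y p c $ i" for i by (rule eventually_nhds_x_imp_x[OF g(2)])
  have derY: "(?Yc has_derivative frechet_derivative ?Yc (at (snd c p))) (at (snd c p))"
    by (rule smooth_on_open_has_derivative[OF vector_fieldD(2)[OF Y c(1)] open_chart_image[OF c(1)]]) (use p in auto)
  \<comment> \<open>Only the values of \<open>g j\<close> near \<open>p\<close> matter, and there it
    is the \<open>j\<close>-th component of \<open>Y\<close>.\<close>
  have gder: "tvec_apply M p (E i p) (g j) = frechet_derivative ?Yc (at (snd c p)) (axis i 1) $ j" for i j
  proof -
    obtain S where S: "open S" "snd c p \<in> S" "\<And>x. x \<in> S \<Longrightarrow> g j (chart_inv c x) = Y (chart_inv c x) c $ j"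
      by (rule eventually_chart_inv[OF c(1) p g(2)[of j]]) (rule that)
    have "((\<lambda>x. ?Yc x $ j) has_derivative (\<lambda>h. frechet_derivative ?Yc (at (snd c p)) h $ j)) (at (snd c p))"
      by (rule bounded_linear.has_derivative[OF bounded_linear_vec_nth derY])
    then have "((\<lambda>x. g j (chart_inv c x)) has_derivative (\<lambda>h. frechet_derivative ?Yc (at (snd c p)) h $ j)) (at (snd c p))"
      by (rule has_derivative_transform_within_open[OF _ S(1,2)]) (simp add: S(3))
    then have "frechet_derivative (\<lambda>x. g j (chart_inv c x)) (at (snd c p))
        = (\<lambda>h. frechet_derivative ?Yc (at (snd c p)) h $ j)"
      by (rule frechet_derivative_at[symmetric])
    then show ?thesis
      by (simp add: tvec_apply_chart[OF g(1) vector_fieldD(1)[OF EV] c(1) p] Ep)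
  qed
  have inner: "D (E i) Y v c = frechet_derivative ?Yc (at (snd c p)) (axis i 1)
      + (\<Sum>j\<in>UNIV. Y p c $ j *\<^sub>R D (E i) (E j) v c)" for i
  proof -
    have "D (E i) Y v = D (E i) (\<lambda>q. tsum UNIV (\<lambda>j. tscale (g j q) (E j q))) v"
      using g(3) unfolding p_def
      by (intro D_local_right EV Y v tsum_vector_field tscale_vector_field g(1)) auto
    also have "\<dots> = tsum UNIV (\<lambda>j. D (E i) (\<lambda>q. tscale (g j q) (E j q)) v)"
      by (intro D_sum_right EV v tscale_vector_field g(1)) auto
    finally have "D (E i) Y v c = (\<Sum>j\<in>UNIV. frechet_derivative ?Yc (at (snd c p)) (axis i 1) $ j *\<^sub>R axis j 1
        + Y p c $ j *\<^sub>R D (E i) (E j) v c)"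
      by (simp add: D_scale_right[OF EV EV g(1) v] p_def[symmetric] gder gp Ep)
    also have "\<dots> = frechet_derivative ?Yc (at (snd c p)) (axis i 1)
        + (\<Sum>j\<in>UNIV. Y p c $ j *\<^sub>R D (E i) (E j) v c)"
      by (simp add: sum.distrib sum_vec_nth_axis)
    finally show ?thesis .
  qed
  have "D X Y v = D (\<lambda>q. tsum UNIV (\<lambda>i. tscale (f i q) (E i q))) Y v"
    using f(3) unfolding p_def
    by (intro D_local_left X Y v tsum_vector_field tscale_vector_field EV f(1)) auto
  also have "\<dots> = tsum UNIV (\<lambda>i. D (\<lambda>q. tscale (f i q) (E i q)) Y v)"
    by (intro D_sum_left EV Y v tscale_vector_field f(1)) auto
  finally have "D X Y v c = (\<Sum>i\<in>UNIV. X p c $ i *\<^sub>R D (E i) Y v c)"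
    by (simp add: D_scale_left[OF EV Y f(1) v] p_def[symmetric] fp)
  also have "\<dots> = (\<Sum>i\<in>UNIV. X p c $ i *\<^sub>R frechet_derivative ?Yc (at (snd c p)) (axis i 1))
      + (\<Sum>i\<in>UNIV. \<Sum>j\<in>UNIV. (X p c $ i * Y p c $ j) *\<^sub>R D (E i) (E j) v c)"
    by (simp add: inner scaleR_add_right sum.distrib scaleR_sum_right)
  also have "(\<Sum>i\<in>UNIV. X p c $ i *\<^sub>R frechet_derivative ?Yc (at (snd c p)) (axis i 1))
      = frechet_derivative ?Yc (at (snd c p)) (X p c)"
    by (rule linear_eq_sum_axis[OF has_derivative_linear[OF derY], symmetric])
  also have "(\<Sum>i\<in>UNIV. \<Sum>j\<in>UNIV. (X p c $ i * Y p c $ j) *\<^sub>R D (E i) (E j) v c)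
      = conn_form M D c v (X p c) (Y p c)"
    by (simp add: vec_eq_iff conn_form_def christoffel_extension[OF v E[unfolded p_def] E[unfolded p_def]] mult_ac)
  finally show ?thesis by (simp add: p_def)
qed

text \<open>\<open>D X Y\<close> is computed in both charts for fields with constant components
  \<open>a\<close> and \<open>b\<close> in \<open>c\<close>. The derivative term vanishes in
  \<open>c\<close> and is a second derivative of the transition map in \<open>c'\<close>.\<close>

lemma conn_form_change:
  assumes v: "v \<in> A" and c: "c \<in> M" "c' \<in> M" "fst v \<in> fst c" "fst v \<in> fst c'"
  defines "x \<equiv> snd c (fst v)"
  shows "conn_form M D c' v (dtrans c c' x a) (dtrans c c' x b)
      = dtrans c c' x (conn_form M D c v a b) - frechet_derivative (\<lambda>z. dtrans c c' z b) (at x) a"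
proof -
  define p where "p = fst v"
  have p: "p \<in> fst c" "p \<in> fst c'" using c by (auto simp: p_def)
  have const: "smooth_on (snd c ` fst c) (\<lambda>x. w)" for w :: "real^'n"
    by (intro smooth_on_const thick_open open_chart_image c)
  obtain X where X: "X \<in> vector_fields M" "\<forall>\<^sub>F q in nhds p. X q = coord_vec M c q a"
    by (rule local_vector_field_extends[OF c(1) p(1) const[of a]]) (rule that)
  obtain Y where Y: "Y \<in> vector_fields M" "\<forall>\<^sub>F q in nhds p. Y q = coord_vec M c q b"
    by (rule local_vector_field_extends[OF c(1) p(1) const[of b]]) (rule that)
  have Xp: "X p = coord_vec M c p a" and Yp: "Y p = coord_vec M c p b"
    using eventually_nhds_x_imp_x[OF X(2)] eventually_nhds_x_imp_x[OF Y(2)] by auto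
  obtain S where S: "open S" "snd c p \<in> S" "S \<subseteq> snd c ` fst c"
    "\<And>x. x \<in> S \<Longrightarrow> Y (chart_inv c x) = coord_vec M c (chart_inv c x) b"
    by (rule eventually_chart_inv[OF c(1) p(1) Y(2)]) (rule that)
  have "((\<lambda>x. b) has_derivative (\<lambda>h. 0)) (at (snd c p))" by simp
  then have "((\<lambda>x. Y (chart_inv c x) c) has_derivative (\<lambda>h. 0)) (at (snd c p))"
    by (rule has_derivative_transform_within_open[OF _ S(1,2)])
       (use S c in \<open>auto simp: chart_inv_chart\<close>)
  then have "frechet_derivative (\<lambda>x. Y (chart_inv c x) c) (at (snd c p)) = (\<lambda>h. 0)"
    by (rule frechet_derivative_at[symmetric])
  then have c1: "D X Y v c = conn_form M D c v a b"
    using D_chart[OF X(1) Y(1) v c(1,3)] by (simp add: p_def[symmetric] Xp Yp c p)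
  have D2: "((\<lambda>z. dtrans c c' z b) has_derivative frechet_derivative (\<lambda>z. dtrans c c' z b) (at (snd c p))) (at (snd c p))"
    by (rule smooth_on_open_has_derivative[OF smooth_on_open_frechet_derivative[OF smooth_on_transition[OF c(1,2)]
            open_overlap[OF c(1,2)]] open_overlap[OF c(1,2)]]) (use p in auto)
  have Y': "((\<lambda>x. Y (chart_inv c' x) c') has_derivative frechet_derivative (\<lambda>x. Y (chart_inv c' x) c') (at (snd c' p))) (at (snd c' p))"
    by (rule smooth_on_open_has_derivative[OF vector_fieldD(2)[OF Y(1) c(2)] open_chart_image[OF c(2)]]) (use p in auto)
  have t: "transition c c' (snd c p) = snd c' p" by (simp add: transition_apply chart_inv_chart c p)
  have "((\<lambda>x. Y (chart_inv c' (transition c c' x)) c') has_derivative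
      (\<lambda>h. frechet_derivative (\<lambda>x. Y (chart_inv c' x) c') (at (snd c' p)) (dtrans c c' (snd c p) h))) (at (snd c p))"
    by (rule has_derivative_compose[OF transition_has_derivative[OF c(1,2) p]]) (simp add: t Y')
  \<comment> \<open>Near \<open>snd c p\<close> the components of \<open>Y\<close> in
    \<open>c'\<close>, read in the coordinates of \<open>c\<close>, are
    \<open>dtrans c c' x b\<close>.\<close>
  moreover have "((\<lambda>x. Y (chart_inv c' (transition c c' x)) c') has_derivative
      frechet_derivative (\<lambda>z. dtrans c c' z b) (at (snd c p))) (at (snd c p))"
  proof (rule has_derivative_transform_within_open[OF D2])
    show "open (S \<inter> snd c ` (fst c \<inter> fst c'))" by (intro open_Int S open_overlap c)
    show "snd c p \<in> S \<inter> snd c ` (fst c \<inter> fst c')" using S p by auto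
    fix x assume x: "x \<in> S \<inter> snd c ` (fst c \<inter> fst c')"
    then obtain q where q: "q \<in> fst c" "q \<in> fst c'" "x = snd c q" by auto
    have "Y q = coord_vec M c q b" using S(4)[of x] x q by (simp add: chart_inv_chart c)
    then show "dtrans c c' x b = Y (chart_inv c' (transition c c' x)) c'"
      by (simp add: q transition_apply chart_inv_chart c coord_vec_apply)
  qed
  ultimately have "(\<lambda>h. frechet_derivative (\<lambda>x. Y (chart_inv c' x) c') (at (snd c' p)) (dtrans c c' (snd c p) h))
      = frechet_derivative (\<lambda>z. dtrans c c' z b) (at (snd c p))"
    by (rule has_derivative_unique)
  then have d: "frechet_derivative (\<lambda>x. Y (chart_inv c' x) c') (at (snd c' p)) (dtrans c c' (snd c p) a)
      = frechet_derivative (\<lambda>z. dtrans c c' z b) (at (snd c p)) a"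
    by metis
  have "D X Y v c' = dtrans c c' (snd c p) (D X Y v c)"
    using tangent_change[OF D_tangent[OF X(1) Y(1) v] c] by (simp add: p_def)
  moreover have "D X Y v c' = frechet_derivative (\<lambda>z. dtrans c c' z b) (at (snd c p)) a
      + conn_form M D c' v (dtrans c c' (snd c p) a) (dtrans c c' (snd c p) b)"
    using D_chart[OF X(1) Y(1) v c(2,4)] by (simp add: p_def[symmetric] Xp Yp coord_vec_apply c p d)
  ultimately show ?thesis by (simp add: c1 x_def p_def algebra_simps)
qed

text \<open>A pair of extensions at one base point extends the coordinate fields at all nearby
  points too, so near a given point the symbols are components of the single smooth section
  \<open>D E F\<close>.\<close>

lemma smooth_on_christoffel:
  assumes c: "c \<in> M"
  shows "smooth_on (coord_dom c A) (\<lambda>z. christoffel M D c (from_coords M c z) k i j)"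
proof (rule smooth_on_locally[OF thick_open[OF open_coord_dom[OF c]]])
  fix z assume "z \<in> coord_dom c A"
  then obtain v where v: "v \<in> A" "fst v \<in> fst c" "z = to_coords c v"
    by (rule coord_domE[OF _ c])
  obtain E where E: "is_extension M c i (fst v) E" using extension_exists[OF c v(2)] by blast
  obtain F where F: "is_extension M c j (fst v) F" using extension_exists[OF c v(2)] by blast
  have "\<forall>\<^sub>F p in nhds (fst v). (\<forall>\<^sub>F q in nhds p. E q = coord_frame M c i q)
      \<and> (\<forall>\<^sub>F q in nhds p. F q = coord_frame M c j q)"
    using E F unfolding is_extension_def eventually_eventually eventually_conj_iff by blast
  then have "\<forall>\<^sub>F p in nhds (fst v). is_extension M c i p E \<and> is_extension M c j p F"
    using E F unfolding is_extension_def by simp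
  then obtain S where S: "open S" "snd c (fst v) \<in> S" "S \<subseteq> snd c ` fst c"
    "\<And>x. x \<in> S \<Longrightarrow> is_extension M c i (chart_inv c x) E \<and> is_extension M c j (chart_inv c x) F"
    by (rule eventually_chart_inv[OF c v(2)]) (rule that)
  have U: "open (S \<times> (UNIV :: (real^'n) set))" by (intro open_Times S) auto
  have "smooth_on (coord_dom c A \<inter> S \<times> UNIV) (\<lambda>z. D E F (from_coords M c z) c $ k)"
    using E F unfolding is_extension_def
    by (intro smooth_on_vec_nth thick_open open_Int open_coord_dom c U
        smooth_on_subset[OF D_smooth]) auto
  then have "smooth_on (coord_dom c A \<inter> S \<times> UNIV) (\<lambda>z. christoffel M D c (from_coords M c z) k i j)"
  proof (rule smooth_on_cong[THEN iffD1, rotated])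
    fix z assume z: "z \<in> coord_dom c A \<inter> S \<times> UNIV"
    then have "z \<in> coord_dom c A" by blast
    then obtain w where w: "w \<in> A" "from_coords M c z = w" by (rule coord_domE[OF _ c])
    have "fst w = chart_inv c (fst z)" using w(2) by (auto simp: from_coords_def)
    then have "is_extension M c i (fst w) E" "is_extension M c j (fst w) F" using S(4)[of "fst z"] z by auto
    then show "D E F (from_coords M c z) c $ k = christoffel M D c (from_coords M c z) k i j"
      using christoffel_extension w by metis
  qed
  then show "\<exists>U. open U \<and> z \<in> U \<and> smooth_on (coord_dom c A \<inter> U) (\<lambda>z. christoffel M D c (from_coords M c z) k i j)"
    using U S(2) v(3) by (intro exI[of _ "S \<times> UNIV"]) (auto simp: to_coords_def)
qed

lemma smooth_on_conn_form:
  assumes c: "c \<in> M" and S: "thick S" and z: "smooth_on S z" "z ` S \<subseteq> coord_dom c A"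
    and ab: "smooth_on S a" "smooth_on S b"
  shows "smooth_on S (\<lambda>s. conn_form M D c (from_coords M c (z s)) (a s) (b s))"
  unfolding conn_form_def
  by (intro smooth_on_vec_lambda smooth_on_sum smooth_on_mult smooth_on_vec_nth S ab
      smooth_on_compose[OF smooth_on_christoffel[OF c] z(1) S z(2)])

end

section \<open>The fundamental tensor in charts\<close>

text \<open>In the application \<open>B\<close> is the difference of two connection forms, and
  \<open>C l b d\<close> is the derivative of \<open>g b d\<close> in the fibre direction
  \<open>l\<close>, that is, twice the Cartan tensor. This term contains the unknown
  \<open>B a y\<close>, so the usual Levi-Civita argument becomes available only after
  \<open>B a y\<close> is shown to vanish.\<close>

lemma linear_form_uniqueness:
  fixes g :: "'v::real_vector \<Rightarrow> 'v \<Rightarrow> real" and C :: "'v \<Rightarrow> 'v \<Rightarrow> 'v \<Rightarrow> real" and B :: "'v \<Rightarrow> 'v \<Rightarrow> 'v"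
  assumes g_sym: "\<And>a b. g a b = g b a"
    and g_nondeg: "\<And>a. (\<And>b. g a b = 0) \<Longrightarrow> a = 0"
    and C_0: "\<And>b d. C 0 b d = 0" and C_y: "\<And>l d. C l y d = 0"
    and B_sym: "\<And>a b. B a b = B b a"
    and eq: "\<And>a b d. C (B a y) b d + g (B a b) d + g b (B a d) = 0"
  shows "B a b = 0"
proof -
  \<comment> \<open>With \<open>b = d = y\<close> the Cartan term drops out by \<open>C_y\<close>.
    With only \<open>b = y\<close> it does so too, and this isolates \<open>B y y\<close> in the
    next fact.\<close>
  have 1: "g (B a y) y = 0" for a
    using eq[of a y y] C_y g_sym[of y "B a y"] by simp
  have "g (B y y) d = 0" for d
    using eq[of y y d] C_y[of "B y y" d] 1[of d] g_sym[of y "B y d"] B_sym[of y d] by simp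
  then have yy: "B y y = 0" by (rule g_nondeg)
  \<comment> \<open>As an endomorphism in \<open>b\<close>, \<open>B b y\<close> is skew with
    respect to \<open>g\<close> by the instance \<open>a = y\<close>; the next fact, with
    \<open>y\<close> in the middle slot, says that it is also self-adjoint.\<close>
  have anti: "g (B b y) d + g (B d y) b = 0" for b d
    using eq[of y b d] C_0[of b d] yy g_sym[of b "B y d"] B_sym[of y b] B_sym[of y d] by simp
  have sym: "g (B b y) d = g (B d y) b" for b d
    using eq[of b y d] eq[of d y b] C_y[of "B b y" d] C_y[of "B d y" b] B_sym[of b d] by simp
  have "g (B b y) d = 0" for b d
    using anti[of b d] sym[of b d] by simp
  then have by0: "B b y = 0" for b by (intro g_nondeg)
  \<comment> \<open>Now the Cartan term is gone: \<open>g (B a b) d\<close> is skew in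
    \<open>b\<close> and \<open>d\<close> and symmetric in \<open>a\<close> and \<open>b\<close>.
    Six alternating swaps return the expression with the opposite sign.\<close>
  have anti': "g (B a b) d = - g (B a d) b" for a b d
    using eq[of a b d] C_0[of b d] by0[of a] g_sym[of b "B a d"] by simp
  have "g (B a b) d = 0" for d
  proof -
    have "g (B a b) d = - g (B a d) b" by (rule anti')
    also have "\<dots> = - g (B d a) b" using B_sym[of a d] by simp
    also have "\<dots> = g (B d b) a" using anti'[of d a b] by simp
    also have "\<dots> = g (B b d) a" using B_sym[of b d] by simp
    also have "\<dots> = - g (B b a) d" by (rule anti')
    also have "\<dots> = - g (B a b) d" using B_sym[of a b] by simp
    finally show ?thesis by simp
  qed
  then show ?thesis by (rule g_nondeg)
qed

text \<open>Half the Hessian of \<open>L\<close> along the fibre, with the derivatives nested in the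
  order of \<open>fundamental_tensor\<close>. Writing it with total derivatives on pairs makes the
  results on smoothness and on the symmetry of second derivatives applicable.\<close>

definition metric_form :: "('a::topological_space, 'n::finite) chart set \<Rightarrow> (('a, 'n) tbundle \<Rightarrow> real) \<Rightarrow> ('a, 'n) chart
    \<Rightarrow> (real^'n) \<times> (real^'n) \<Rightarrow> real^'n \<Rightarrow> real^'n \<Rightarrow> real" where
  "metric_form M L c z a b = 1/2 * frechet_derivative
      (\<lambda>z. frechet_derivative (\<lambda>z. L (from_coords M c z)) (at z) (0, b)) (at z) (0, a)"

text \<open>The vector \<open>(a, - conn_form M D c v a (snd v c))\<close> is the horizontal lift of
  \<open>a\<close> at \<open>v\<close>. A single derivative along it combines the base and fibre
  derivatives of \<open>cov_deriv_metric\<close>, and it is also the velocity of a self-parallel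
  field over a curve with velocity \<open>a\<close>.\<close>

definition cov_form :: "('a::topological_space, 'n::finite) chart set \<Rightarrow> (('a, 'n) tbundle \<Rightarrow> real) \<Rightarrow> ('a, 'n) operator
    \<Rightarrow> ('a, 'n) chart \<Rightarrow> ('a, 'n) tbundle \<Rightarrow> real^'n \<Rightarrow> real^'n \<Rightarrow> real^'n \<Rightarrow> real" where
  "cov_form M L D c v a b d =
      frechet_derivative (\<lambda>z. metric_form M L c z b d) (at (to_coords c v)) (a, - conn_form M D c v a (snd v c))
      - metric_form M L c (to_coords c v) (conn_form M D c v a b) d
      - metric_form M L c (to_coords c v) b (conn_form M D c v a d)"

lemma has_real_derivative_along_line:
  fixes f :: "'a::real_normed_vector \<Rightarrow> real"
  assumes "(f has_derivative f') (at a)"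
  shows "((\<lambda>s. f (a + s *\<^sub>R v)) has_real_derivative f' v) (at 0)"
proof -
  have "((\<lambda>s. a + s *\<^sub>R v) has_derivative (\<lambda>h. h *\<^sub>R v)) (at 0)"
    by (auto intro!: derivative_eq_intros)
  from has_derivative_compose[OF this, of f f'] assms
  have "((\<lambda>s. f (a + s *\<^sub>R v)) has_derivative (\<lambda>h. f' (h *\<^sub>R v))) (at 0)" by simp
  then show ?thesis
    unfolding has_field_derivative_def
    by (rule has_derivative_eq_rhs)
       (simp add: fun_eq_iff linear_cmul[OF has_derivative_linear[OF assms]] mult.commute)
qed

text \<open>\<open>g\<close> has to be known only while the line stays in \<open>S\<close>: the
  inner derivative in \<open>fundamental_tensor\<close> is computed only over points of the
  domain.\<close>

lemma deriv_along_line: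
  fixes f :: "'a::real_normed_vector \<Rightarrow> real"
  assumes f: "(f has_derivative f') (at a)" and S: "open S" "a \<in> S" and g: "\<And>s. a + s *\<^sub>R v \<in> S \<Longrightarrow> g s = f (a + s *\<^sub>R v)"
  shows "deriv g 0 = f' v"
proof (rule DERIV_imp_deriv)
  have "open ((\<lambda>s. a + s *\<^sub>R v) -` S)"
    by (intro open_vimage S continuous_intros)
  then show "(g has_real_derivative f' v) (at 0)"
    by (rule has_field_derivative_transform_within_open[OF has_real_derivative_along_line[OF f]])
       (use S g in auto)
qed

locale metric = bundle_domain M A
  for M :: "('a::{t2_space, second_countable_topology}, 'n::finite) chart set" and A +
  fixes L :: "('a, 'n) tbundle \<Rightarrow> real"
  assumes conic: "fibrewise_conic A" and finsler: "pseudo_finsler M A L"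
begin

lemma smooth_on_L: "c \<in> M \<Longrightarrow> smooth_on (coord_dom c A) (\<lambda>z. L (from_coords M c z))"
  using finsler unfolding pseudo_finsler_def o_def by blast

lemma smooth_on_L_deriv: "c \<in> M \<Longrightarrow>
    smooth_on (coord_dom c A) (\<lambda>z. frechet_derivative (\<lambda>z. L (from_coords M c z)) (at z) h)"
  by (intro smooth_on_open_frechet_derivative smooth_on_L open_coord_dom)

lemma smooth_on_metric_form: "c \<in> M \<Longrightarrow> smooth_on (coord_dom c A) (\<lambda>z. metric_form M L c z a b)"
  unfolding metric_form_def
  by (intro smooth_on_mult smooth_on_const smooth_on_open_frechet_derivative[OF smooth_on_L_deriv] open_coord_dom
      thick_open)

lemma metric_form_sym:
  assumes c: "c \<in> M" and z: "z \<in> coord_dom c A"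
  shows "metric_form M L c z a b = metric_form M L c z b a"
  unfolding metric_form_def
  using second_derivative_symmetric[OF smooth_on_L[OF c] open_coord_dom[OF c] z, of "(0, b)" "(0, a)"] by simp

lemma linear_metric_form_left:
  assumes c: "c \<in> M" and z: "z \<in> coord_dom c A"
  shows "linear (\<lambda>a. metric_form M L c z a b)"
proof -
  have lin: "linear (frechet_derivative (\<lambda>z. frechet_derivative (\<lambda>z. L (from_coords M c z)) (at z) (0, b)) (at z))"
    by (rule has_derivative_linear[OF smooth_on_open_has_derivative[OF smooth_on_L_deriv[OF c] open_coord_dom[OF c] z]])
  show ?thesis
  proof (rule linearI)
    show "metric_form M L c z (a + a') b = metric_form M L c z a b + metric_form M L c z a' b" for a a'
      using linear_add[OF lin, of "(0, a)" "(0, a')"] by (simp add: metric_form_def algebra_simps)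
    show "metric_form M L c z (r *\<^sub>R a) b = r *\<^sub>R metric_form M L c z a b" for r a
      using linear_cmul[OF lin, of r "(0, a)"] by (simp add: metric_form_def algebra_simps)
  qed
qed

lemma linear_metric_form_right:
  assumes c: "c \<in> M" and z: "z \<in> coord_dom c A"
  shows "linear (metric_form M L c z a)"
proof -
  have "(\<lambda>b. metric_form M L c z b a) = metric_form M L c z a"
    by (intro ext metric_form_sym assms)
  with linear_metric_form_left[OF assms, of a] show ?thesis by simp
qed

lemma metric_form_eq_sum:
  assumes c: "c \<in> M" and z: "z \<in> coord_dom c A"
  shows "metric_form M L c z a b = (\<Sum>i\<in>UNIV. \<Sum>j\<in>UNIV. a $ i * b $ j * metric_form M L c z (axis i 1) (axis j 1))"
proof -
  have "metric_form M L c z a b = (\<Sum>i\<in>UNIV. a $ i *\<^sub>R metric_form M L c z (axis i 1) b)"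
    by (rule linear_eq_sum_axis[OF linear_metric_form_left[OF assms]])
  also have "\<dots> = (\<Sum>i\<in>UNIV. a $ i *\<^sub>R (\<Sum>j\<in>UNIV. b $ j *\<^sub>R metric_form M L c z (axis i 1) (axis j 1)))"
    by (intro sum.cong refl arg_cong2[of _ _ _ _ scaleR] linear_eq_sum_axis[OF linear_metric_form_right[OF assms]])
  finally show ?thesis by (simp add: sum_distrib_left mult_ac)
qed

lemma metric_form_has_derivative:
  assumes c: "c \<in> M" and z: "z \<in> coord_dom c A"
  shows "((\<lambda>z. metric_form M L c z a b) has_derivative
      frechet_derivative (\<lambda>z. metric_form M L c z a b) (at z)) (at z)"
  by (rule smooth_on_open_has_derivative[OF smooth_on_metric_form[OF c] open_coord_dom[OF c] z])

text \<open>In a chart the variations of \<open>v\<close> within its fibre are straight lines, so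
  the iterated derivatives in one variable become directional derivatives.\<close>

lemma fundamental_tensor_chart:
  assumes v: "v \<in> A" and c: "c \<in> M" "fst v \<in> fst c"
    and u: "u \<in> tangent_space M (fst v)" and w: "w \<in> tangent_space M (fst v)"
  shows "fundamental_tensor L v u w = metric_form M L c (to_coords c v) (u c) (w c)"
proof -
  let ?Lc = "\<lambda>z. L (from_coords M c z)"
  define z where "z = to_coords c v"
  have z: "z \<in> coord_dom c A" unfolding z_def by (rule to_coords_in_coord_dom[OF v c(2)])
  note O = open_coord_dom[OF c(1)]
  have shift: "L (fst v, tadd (tadd (snd v) (tscale t u)) (tscale s w)) = ?Lc (z + t *\<^sub>R (0, u c) + s *\<^sub>R (0, w c))" for t s
  proof -
    have "coord_vec M c (fst v) (snd z + t *\<^sub>R u c + s *\<^sub>R w c) = tadd (tadd (snd v) (tscale t u)) (tscale s w)"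
      unfolding coord_vec_add[OF c] coord_vec_scale[OF c] z_def to_coords_def snd_conv
      by (simp only: coord_vec_tangent_component[OF A_tangent[OF v] c] coord_vec_tangent_component[OF u c]
          coord_vec_tangent_component[OF w c])
    then show ?thesis
      by (simp add: from_coords_def z_def to_coords_def chart_inv_chart c del: tadd_apply tscale_apply)
  qed
  have inner: "deriv (\<lambda>s. L (fst v, tadd (tadd (snd v) (tscale t u)) (tscale s w))) 0
      = frechet_derivative ?Lc (at (z + t *\<^sub>R (0, u c))) (0, w c)"
    if "z + t *\<^sub>R (0, u c) \<in> coord_dom c A" for t
    by (rule deriv_along_line[OF smooth_on_open_has_derivative[OF smooth_on_L[OF c(1)] O that] O that shift])
  have "deriv (\<lambda>t. deriv (\<lambda>s. L (fst v, tadd (tadd (snd v) (tscale t u)) (tscale s w))) 0) 0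
      = frechet_derivative (\<lambda>z. frechet_derivative ?Lc (at z) (0, w c)) (at z) (0, u c)"
    by (rule deriv_along_line[OF smooth_on_open_has_derivative[OF smooth_on_L_deriv[OF c(1)] O z] O z inner])
  then show ?thesis by (simp add: fundamental_tensor_def metric_form_def z_def)
qed

lemma metric_coeff_eq:
  assumes c: "c \<in> M" and z: "(x, y) \<in> coord_dom c A"
  shows "metric_coeff M L c i j x y = metric_form M L c (x, y) (axis i 1) (axis j 1)"
proof -
  obtain v where v: "v \<in> A" "fst v \<in> fst c" "(x, y) = to_coords c v" "from_coords M c (x, y) = v"
    by (rule coord_domE[OF z c])
  show ?thesis
    unfolding metric_coeff_def Let_def v(4) coord_frame_def
    using fundamental_tensor_chart[OF v(1) c v(2) coord_vec_tangent[OF c v(2)] coord_vec_tangent[OF c v(2)]]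
    by (simp add: c v(2) v(3)[symmetric])
qed

lemma metric_form_nondegenerate:
  assumes c: "c \<in> M" and z: "z \<in> coord_dom c A" and 0: "\<And>b. metric_form M L c z a b = 0"
  shows "a = 0"
proof -
  obtain v where v: "v \<in> A" "fst v \<in> fst c" "z = to_coords c v"
    by (rule coord_domE[OF z c])
  let ?u = "coord_vec M c (fst v) a"
  have u: "?u \<in> tangent_space M (fst v)" by (rule coord_vec_tangent[OF c v(2)])
  have "fundamental_tensor L v ?u w = 0" if "w \<in> tangent_space M (fst v)" for w
    using fundamental_tensor_chart[OF v(1) c v(2) u that] 0 by (simp add: c v)
  then have "?u = tzero" using finsler u v(1) unfolding pseudo_finsler_def by blast
  then have "?u c = tzero c" by (rule fun_cong)
  then show ?thesis by (simp add: c v)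
qed

lemma frechet_metric_form_sym:
  assumes c: "c \<in> M" and z: "z \<in> coord_dom c A"
  shows "frechet_derivative (\<lambda>z. metric_form M L c z a b) (at z) = frechet_derivative (\<lambda>z. metric_form M L c z b a) (at z)"
proof -
  have "((\<lambda>z. metric_form M L c z b a) has_derivative
      frechet_derivative (\<lambda>z. metric_form M L c z a b) (at z)) (at z)"
    by (rule has_derivative_transform_within_open[OF metric_form_has_derivative[OF assms] open_coord_dom[OF c] z])
       (rule metric_form_sym[OF c])
  then show ?thesis by (rule frechet_derivative_at)
qed

lemma linear_frechet_metric_form:
  assumes c: "c \<in> M" and z: "z \<in> coord_dom c A"
  shows "linear (\<lambda>a. frechet_derivative (\<lambda>z. metric_form M L c z a b) (at z) h)"
proof (rule linearI)
  let ?F = "\<lambda>a. frechet_derivative (\<lambda>z. metric_form M L c z a b) (at z)"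
  fix a a' :: "real^'n" and r :: real
  have "((\<lambda>z. metric_form M L c z (a + a') b) has_derivative (\<lambda>h. ?F a h + ?F a' h)) (at z)"
    by (rule has_derivative_transform_within_open[OF has_derivative_add[OF metric_form_has_derivative[OF assms]
            metric_form_has_derivative[OF assms]] open_coord_dom[OF c] z])
       (simp add: linear_add[OF linear_metric_form_left[OF c]])
  from fun_cong[OF has_derivative_unique[OF this metric_form_has_derivative[OF assms]], of h]
  show "?F (a + a') h = ?F a h + ?F a' h" by simp
  have "((\<lambda>z. metric_form M L c z (r *\<^sub>R a) b) has_derivative (\<lambda>h. r *\<^sub>R ?F a h)) (at z)"
    by (rule has_derivative_transform_within_open[OF has_derivative_scaleR_right[OF metric_form_has_derivative[OF assms]]
            open_coord_dom[OF c] z])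
       (simp add: linear_cmul[OF linear_metric_form_left[OF c]])
  from fun_cong[OF has_derivative_unique[OF this metric_form_has_derivative[OF assms]], of h]
  show "?F (r *\<^sub>R a) h = r *\<^sub>R ?F a h" by simp
qed

text \<open>The Cartan tensor is a third derivative of \<open>L\<close> along the fibre, hence totally symmetric.\<close>

lemma cartan_sym:
  assumes c: "c \<in> M" and z: "z \<in> coord_dom c A"
  shows "frechet_derivative (\<lambda>z. metric_form M L c z a b) (at z) (0, l)
       = frechet_derivative (\<lambda>z. metric_form M L c z l b) (at z) (0, a)"
proof -
  let ?f = "\<lambda>z. frechet_derivative (\<lambda>z. L (from_coords M c z)) (at z) (0, b)"
  note O = open_coord_dom[OF c]
  have *: "frechet_derivative (\<lambda>z. metric_form M L c z a b) (at z) h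
      = 1/2 * frechet_derivative (\<lambda>z. frechet_derivative ?f (at z) (0, a)) (at z) h" for a h
  proof -
    have "((\<lambda>z. metric_form M L c z a b) has_derivative
        (\<lambda>h. 1/2 * frechet_derivative (\<lambda>z. frechet_derivative ?f (at z) (0, a)) (at z) h)) (at z)"
      unfolding metric_form_def
      by (intro has_derivative_mult_right smooth_on_open_has_derivative[OF _ O z]
          smooth_on_open_frechet_derivative[OF smooth_on_L_deriv[OF c] O])
    from has_derivative_unique[OF metric_form_has_derivative[OF assms] this] show ?thesis by metis
  qed
  show ?thesis
    unfolding * using second_derivative_symmetric[OF smooth_on_L_deriv[OF c] O z, of "(0, b)" "(0, a)" "(0, l)"] by simp
qed

section \<open>Homogeneity of the metric\<close>

lemma coord_dom_scale:
  assumes c: "c \<in> M" and z: "(x, y) \<in> coord_dom c A" and r: "r > 0"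
  shows "(x, r *\<^sub>R y) \<in> coord_dom c A" "L (from_coords M c (x, r *\<^sub>R y)) = r\<^sup>2 * L (from_coords M c (x, y))"
proof -
  obtain v where v: "v \<in> A" "fst v \<in> fst c" "(x, y) = to_coords c v" "from_coords M c (x, y) = v"
    by (rule coord_domE[OF z c])
  have w: "(fst v, tscale r (snd v)) \<in> A" using conic v(1) r unfolding fibrewise_conic_def by (metis prod.collapse)
  have eq: "(x, r *\<^sub>R y) = to_coords c (fst v, tscale r (snd v))" using v(3) by (simp add: to_coords_def)
  show "(x, r *\<^sub>R y) \<in> coord_dom c A"
    unfolding eq by (rule to_coords_in_coord_dom[OF w]) (simp add: v)
  have "from_coords M c (x, r *\<^sub>R y) = (fst v, tscale r (snd v))"
    unfolding eq by (rule from_to_coords[OF w c]) (simp add: v)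
  moreover have "L (fst v, tscale r (snd v)) = r\<^sup>2 * L (fst v, snd v)"
    using finsler v(1) r unfolding pseudo_finsler_def by (metis prod.collapse)
  ultimately show "L (from_coords M c (x, r *\<^sub>R y)) = r\<^sup>2 * L (from_coords M c (x, y))"
    by (simp add: v(4))
qed

text \<open>Each vertical derivative lowers the degree of homogeneity by one, which is the factor
  \<open>s / r\<close>. Two of them take \<open>L\<close> from degree 2 to degree 0.\<close>

lemma frechet_homogeneous:
  fixes f :: "(real^'n) \<times> (real^'n) \<Rightarrow> real"
  assumes c: "c \<in> M" and f: "smooth_on (coord_dom c A) f"
    and hom: "\<And>x y. (x, y) \<in> coord_dom c A \<Longrightarrow> f (x, r *\<^sub>R y) = s * f (x, y)" and r: "r > 0"
    and z: "(x, y) \<in> coord_dom c A"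
  shows "frechet_derivative f (at (x, r *\<^sub>R y)) (0, b) = s / r * frechet_derivative f (at (x, y)) (0, b)"
proof -
  note O = open_coord_dom[OF c]
  define S where "S z = (fst z, r *\<^sub>R snd z)" for z :: "(real^'n) \<times> (real^'n)"
  have S: "(S has_derivative S) (at z)" for z
    unfolding S_def by (auto intro!: derivative_eq_intros)
  have "((\<lambda>z. f (S z)) has_derivative (\<lambda>h. frechet_derivative f (at (S (x, y))) (S h))) (at (x, y))"
    by (rule has_derivative_compose[OF S smooth_on_open_has_derivative[OF f O]])
       (use coord_dom_scale(1)[OF c z r] in \<open>simp add: S_def\<close>)
  moreover have "((\<lambda>z. f (S z)) has_derivative (\<lambda>h. s * frechet_derivative f (at (x, y)) h)) (at (x, y))"
    by (rule has_derivative_transform_within_open[OF has_derivative_mult_right[OF smooth_on_open_has_derivative[OF f O z]] O z])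
       (use hom in \<open>auto simp: S_def\<close>)
  ultimately have "frechet_derivative f (at (S (x, y))) (S (0, b)) = s * frechet_derivative f (at (x, y)) (0, b)"
    using has_derivative_unique by metis
  moreover have "linear (frechet_derivative f (at (S (x, y))))"
    by (rule has_derivative_linear[OF smooth_on_open_has_derivative[OF f O]])
       (use coord_dom_scale(1)[OF c z r] in \<open>simp add: S_def\<close>)
  then have "frechet_derivative f (at (S (x, y))) (S (0, b)) = r * frechet_derivative f (at (S (x, y))) (0, b)"
    using linear_cmul[of "frechet_derivative f (at (S (x, y)))" r "(0, b)"] by (simp add: S_def)
  ultimately show ?thesis using r by (simp add: S_def field_simps)
qed

lemma metric_form_homogeneous:
  assumes c: "c \<in> M" and z: "(x, y) \<in> coord_dom c A" and r: "r > 0"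
  shows "metric_form M L c (x, r *\<^sub>R y) a b = metric_form M L c (x, y) a b"
proof -
  let ?f = "\<lambda>z. frechet_derivative (\<lambda>z. L (from_coords M c z)) (at z) (0, b)"
  have 1: "?f (x, r *\<^sub>R y) = r\<^sup>2 / r * ?f (x, y)" if "(x, y) \<in> coord_dom c A" for x y
    by (rule frechet_homogeneous[OF c smooth_on_L[OF c] coord_dom_scale(2)[OF c _ r] r that])
  have "frechet_derivative ?f (at (x, r *\<^sub>R y)) (0, a) = (r\<^sup>2 / r) / r * frechet_derivative ?f (at (x, y)) (0, a)"
    by (rule frechet_homogeneous[OF c smooth_on_L_deriv[OF c] 1 r z])
  then show ?thesis using r by (simp add: metric_form_def power2_eq_square)
qed

text \<open>The metric has degree 0 and so is constant along rays; its derivative in the fibre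
  direction \<open>y\<close> is therefore 0, and \<open>cartan_sym\<close> moves \<open>y\<close>
  from the direction into the first slot.\<close>

lemma cartan_radial:
  assumes c: "c \<in> M" and z: "(x, y) \<in> coord_dom c A"
  shows "frechet_derivative (\<lambda>z. metric_form M L c z y b) (at (x, y)) (0, l) = 0"
proof -
  let ?G = "\<lambda>z. metric_form M L c z l b"
  have d: "((\<lambda>s. ?G ((x, y) + s *\<^sub>R (0, y))) has_real_derivative frechet_derivative ?G (at (x, y)) (0, y)) (at 0)"
    by (rule has_real_derivative_along_line[OF metric_form_has_derivative[OF assms]])
  have "((\<lambda>s. ?G (x, y)) has_real_derivative 0) (at 0)" by simp
  then have "((\<lambda>s. ?G ((x, y) + s *\<^sub>R (0, y))) has_real_derivative 0) (at 0)"
  \<comment> \<open>Homogeneity is applied with the factor \<open>1 + s\<close>, which must be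
    positive.\<close>
  proof (rule has_field_derivative_transform_within_open[of _ _ _ "{-1<..}"])
    fix s :: real assume "s \<in> {-1<..}"
    then show "?G (x, y) = ?G ((x, y) + s *\<^sub>R (0, y))"
      using metric_form_homogeneous[OF assms, of "1 + s"] by (simp add: scaleR_add_left)
  qed auto
  from DERIV_unique[OF d this] show ?thesis using cartan_sym[OF assms] by metis
qed

text \<open>A product rule in which the base point and both vectors move: expansion in the
  coefficients on axis vectors reduces it to real-valued factors.\<close>

lemma has_vector_derivative_metric_form:
  assumes c: "c \<in> M" and z: "\<And>s. s \<in> S \<Longrightarrow> z s \<in> coord_dom c A" and t: "t \<in> S"
    and dz: "(z has_vector_derivative z') (at t within S)"
    and du: "(u has_vector_derivative u') (at t within S)" and dw: "(w has_vector_derivative w') (at t within S)"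
  shows "((\<lambda>s. metric_form M L c (z s) (u s) (w s)) has_vector_derivative
      frechet_derivative (\<lambda>z. metric_form M L c z (u t) (w t)) (at (z t)) z'
      + metric_form M L c (z t) u' (w t) + metric_form M L c (z t) (u t) w') (at t within S)"
proof -
  let ?G = "\<lambda>i j z. metric_form M L c z (axis i 1) (axis j 1)"
  let ?G' = "\<lambda>i j. frechet_derivative (?G i j) (at (z t))"
  note zt = z[OF t]
  have dG: "((\<lambda>s. ?G i j (z s)) has_vector_derivative ?G' i j z') (at t within S)" for i j
    by (rule vector_derivative_diff_chain_within[OF dz, unfolded o_def])
       (rule has_derivative_at_withinI[OF metric_form_has_derivative[OF c zt]])
  have du': "((\<lambda>s. u s $ i) has_vector_derivative u' $ i) (at t within S)" for i
    by (rule bounded_linear.has_vector_derivative[OF bounded_linear_vec_nth du])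
  have dw': "((\<lambda>s. w s $ i) has_vector_derivative w' $ i) (at t within S)" for i
    by (rule bounded_linear.has_vector_derivative[OF bounded_linear_vec_nth dw])
  have "((\<lambda>s. \<Sum>i\<in>UNIV. \<Sum>j\<in>UNIV. u s $ i * w s $ j * ?G i j (z s)) has_vector_derivative
      (\<Sum>i\<in>UNIV. \<Sum>j\<in>UNIV. (u t $ i * w t $ j) * ?G' i j z' + (u t $ i * w' $ j + u' $ i * w t $ j) * ?G i j (z t)))
      (at t within S)"
    by (intro has_vector_derivative_sum has_vector_derivative_mult dG du' dw')
  moreover have "frechet_derivative (\<lambda>z. metric_form M L c z (u t) (w t)) (at (z t)) z'
      = (\<Sum>i\<in>UNIV. \<Sum>j\<in>UNIV. u t $ i * w t $ j * ?G' i j z')"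
  proof -
    have "((\<lambda>z. \<Sum>i\<in>UNIV. \<Sum>j\<in>UNIV. u t $ i * w t $ j * ?G i j z) has_derivative
        (\<lambda>h. \<Sum>i\<in>UNIV. \<Sum>j\<in>UNIV. u t $ i * w t $ j * ?G' i j h)) (at (z t))"
      by (intro has_derivative_sum has_derivative_mult_right metric_form_has_derivative c zt)
    then have "((\<lambda>z. metric_form M L c z (u t) (w t)) has_derivative
        (\<lambda>h. \<Sum>i\<in>UNIV. \<Sum>j\<in>UNIV. u t $ i * w t $ j * ?G' i j h)) (at (z t))"
      by (rule has_derivative_transform_within_open[OF _ open_coord_dom[OF c] zt])
         (rule metric_form_eq_sum[OF c, symmetric])
    from has_derivative_unique[OF metric_form_has_derivative[OF c zt] this] show ?thesis by metis
  qed
  ultimately have "((\<lambda>s. \<Sum>i\<in>UNIV. \<Sum>j\<in>UNIV. u s $ i * w s $ j * ?G i j (z s)) has_vector_derivative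
      frechet_derivative (\<lambda>z. metric_form M L c z (u t) (w t)) (at (z t)) z'
      + metric_form M L c (z t) u' (w t) + metric_form M L c (z t) (u t) w') (at t within S)"
    by (simp add: metric_form_eq_sum[OF c zt, of u' "w t"] metric_form_eq_sum[OF c zt, of "u t" w']
        sum.distrib distrib_right add_ac)
  then show ?thesis
    by (rule has_vector_derivative_transform[OF t, rotated]) (rule metric_form_eq_sum[OF c z])
qed

end

locale metric_connection = metric M A L + connection M A D
  for M :: "('a::{t2_space, second_countable_topology}, 'n::finite) chart set" and A L D
begin

text \<open>Linearity splits the derivative along the horizontal lift into its base and fibre parts,
  which are the first two terms of the index formula.\<close>

lemma cov_deriv_metric_eq:
  assumes v: "v \<in> A" and c: "c \<in> M" "fst v \<in> fst c"
  shows "cov_deriv_metric M L D c v k i j = cov_form M L D c v (axis k 1) (axis i 1) (axis j 1)"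
proof -
  obtain x y where xy: "to_coords c v = (x, y)" by fastforce
  have z: "(x, y) \<in> coord_dom c A" using to_coords_in_coord_dom[OF v c(2)] xy by simp
  have y: "snd v c = y" using xy by (simp add: to_coords_def)
  let ?G = "\<lambda>z. metric_form M L c z (axis i 1) (axis j 1)"
  let ?G' = "frechet_derivative ?G (at (x, y))"
  have dG: "(?G has_derivative ?G') (at (x, y))" by (rule metric_form_has_derivative[OF c(1) z])
  have lin: "linear ?G'" by (rule has_derivative_linear[OF dG])
  have 1: "partial_deriv k (\<lambda>x'. metric_coeff M L c i j x' y) x = ?G' (axis k 1, 0)"
    unfolding partial_deriv_def
    by (rule deriv_along_line[OF dG open_coord_dom[OF c(1)] z]) (simp add: metric_coeff_eq c)
  have 2: "partial_deriv l (\<lambda>y'. metric_coeff M L c i j x y') y = ?G' (0, axis l 1)" for l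
    unfolding partial_deriv_def
    by (rule deriv_along_line[OF dG open_coord_dom[OF c(1)] z]) (simp add: metric_coeff_eq c)
  have lin2: "linear (\<lambda>h. ?G' (0, h))"
  proof (rule linearI)
    show "?G' (0, a + b) = ?G' (0, a) + ?G' (0, b)" for a b using linear_add[OF lin, of "(0, a)" "(0, b)"] by simp
    show "?G' (0, r *\<^sub>R a) = r *\<^sub>R ?G' (0, a)" for r a using linear_cmul[OF lin, of r "(0, a)"] by simp
  qed
  have nth: "conn_form M D c v (axis k 1) w $ l = (\<Sum>m\<in>UNIV. christoffel M D c v l k m * w $ m)" for w l
  proof -
    have "conn_form M D c v (axis k 1) w = (\<Sum>m\<in>UNIV. w $ m *\<^sub>R conn_form M D c v (axis k 1) (axis m 1))"
      by (rule linear_eq_sum_axis[OF bounded_linear.linear[OF bounded_linear_conn_form_right]])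
    then show ?thesis by (simp add: conn_form_axis mult.commute)
  qed
  have 3: "(\<Sum>l\<in>UNIV. \<Sum>m\<in>UNIV. christoffel M D c v l k m * y $ m * ?G' (0, axis l 1))
      = ?G' (0, conn_form M D c v (axis k 1) y)"
    unfolding linear_eq_sum_axis[OF lin2, of "conn_form M D c v (axis k 1) y"]
    by (simp add: nth sum_distrib_right)
  have 4: "(\<Sum>l\<in>UNIV. christoffel M D c v l k i * metric_coeff M L c l j x y)
      = metric_form M L c (x, y) (conn_form M D c v (axis k 1) (axis i 1)) (axis j 1)"
    unfolding linear_eq_sum_axis[OF linear_metric_form_left[OF c(1) z], of "conn_form M D c v (axis k 1) (axis i 1)"]
    by (simp add: conn_form_axis metric_coeff_eq[OF c(1) z])
  have 5: "(\<Sum>l\<in>UNIV. christoffel M D c v l k j * metric_coeff M L c i l x y)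
      = metric_form M L c (x, y) (axis i 1) (conn_form M D c v (axis k 1) (axis j 1))"
    unfolding linear_eq_sum_axis[OF linear_metric_form_right[OF c(1) z], of _ "conn_form M D c v (axis k 1) (axis j 1)"]
    by (simp add: conn_form_axis metric_coeff_eq[OF c(1) z])
  have "?G' (axis k 1, - conn_form M D c v (axis k 1) y)
      = ?G' (axis k 1, 0) - ?G' (0, conn_form M D c v (axis k 1) y)"
    using linear_diff[OF lin, of "(axis k 1, 0)" "(0, conn_form M D c v (axis k 1) y)"] by simp
  then show ?thesis
    unfolding cov_deriv_metric_def cov_form_def Let_def xy fst_conv snd_conv y 1 2 3 4 5 by simp
qed

text \<open>Trilinearity carries the vanishing of all coefficients, as in
  \<open>metric_parallel\<close>, over to arbitrary vectors.\<close>

lemma linear_cov_form: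
  assumes v: "v \<in> A" and c: "c \<in> M" "fst v \<in> fst c"
  shows "linear (\<lambda>a. cov_form M L D c v a b d)" "linear (\<lambda>b. cov_form M L D c v a b d)"
    "linear (\<lambda>d. cov_form M L D c v a b d)"
proof -
  define z where "z = to_coords c v"
  have z: "z \<in> coord_dom c A" unfolding z_def by (rule to_coords_in_coord_dom[OF v c(2)])
  let ?F = "\<lambda>b d. frechet_derivative (\<lambda>z. metric_form M L c z b d) (at z)"
  let ?g = "metric_form M L c z" and ?\<Gamma> = "conn_form M D c v"
  have F: "linear (?F b d)" for b d
    by (rule has_derivative_linear[OF metric_form_has_derivative[OF c(1) z]])
  have F1: "linear (\<lambda>b. ?F b d h)" for d h by (rule linear_frechet_metric_form[OF c(1) z])
  have F2: "linear (\<lambda>d. ?F b d h)" for b h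
    using F1[of b h] by (simp add: frechet_metric_form_sym[OF c(1) z, of b])
  have g1: "linear (\<lambda>a. ?g a b)" for b by (rule linear_metric_form_left[OF c(1) z])
  have g2: "linear (?g a)" for a by (rule linear_metric_form_right[OF c(1) z])
  have \<Gamma>1: "linear (\<lambda>a. ?\<Gamma> a b)" for b by (rule bounded_linear.linear[OF bounded_linear_conn_form_left])
  have \<Gamma>2: "linear (?\<Gamma> a)" for a by (rule bounded_linear.linear[OF bounded_linear_conn_form_right])
  have g1\<Gamma>: "linear (\<lambda>b. ?g (?\<Gamma> a b) d)" for a d using linear_compose[OF \<Gamma>2 g1] by (simp add: o_def)
  have g2\<Gamma>: "linear (\<lambda>d. ?g b (?\<Gamma> a d))" for a b using linear_compose[OF \<Gamma>2 g2] by (simp add: o_def)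
  have g1\<Gamma>': "linear (\<lambda>a. ?g (?\<Gamma> a b) d)" for b d using linear_compose[OF \<Gamma>1 g1] by (simp add: o_def)
  have g2\<Gamma>': "linear (\<lambda>a. ?g b (?\<Gamma> a d))" for b d using linear_compose[OF \<Gamma>1 g2] by (simp add: o_def)
  have "linear (\<lambda>a. (a, - ?\<Gamma> a (snd v c)))"
    by (rule linearI) (simp_all add: linear_add[OF \<Gamma>1] linear_cmul[OF \<Gamma>1])
  from linear_compose[OF this F] have F0: "linear (\<lambda>a. ?F b d (a, - ?\<Gamma> a (snd v c)))" for b d by (simp add: o_def)
  show "linear (\<lambda>a. cov_form M L D c v a b d)" "linear (\<lambda>b. cov_form M L D c v a b d)"
    "linear (\<lambda>d. cov_form M L D c v a b d)"
    unfolding cov_form_def z_def[symmetric]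
    by (intro linear_compose_sub F0 F1 F2 g1 g2 g1\<Gamma> g2\<Gamma> g1\<Gamma>' g2\<Gamma>')+
qed

lemma metric_parallel_cov_form:
  assumes "metric_parallel M A L D" and v: "v \<in> A" and c: "c \<in> M" "fst v \<in> fst c"
  shows "cov_form M L D c v a b d = 0"
proof -
  note lin = linear_cov_form[OF v c]
  have "cov_form M L D c v (axis k 1) (axis i 1) (axis j 1) = 0" for k i j
    using assms cov_deriv_metric_eq[OF v c] unfolding metric_parallel_def by metis
  then have "cov_form M L D c v (axis k 1) (axis i 1) d = 0" for k i
    by (subst linear_eq_sum_axis[OF lin(3)]) simp
  then have "cov_form M L D c v (axis k 1) b d = 0" for k
    by (subst linear_eq_sum_axis[OF lin(2)]) simp
  then show ?thesis
    by (subst linear_eq_sum_axis[OF lin(1)]) simp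
qed

end

lemma (in connection) torsion_free_conn_form:
  assumes "torsion_free M A D" and v: "v \<in> A" and c: "c \<in> M" "fst v \<in> fst c"
  shows "conn_form M D c v a b = conn_form M D c v b a"
proof -
  have sym: "christoffel M D c v k i j = christoffel M D c v k j i" for i j k
    using assms unfolding torsion_free_def by blast
  have "(\<Sum>i\<in>UNIV. \<Sum>j\<in>UNIV. christoffel M D c v k i j * a $ i * b $ j)
      = (\<Sum>j\<in>UNIV. \<Sum>i\<in>UNIV. christoffel M D c v k i j * a $ i * b $ j)" for k
    by (rule sum.swap)
  also have "\<dots> k = (\<Sum>j\<in>UNIV. \<Sum>i\<in>UNIV. christoffel M D c v k j i * b $ j * a $ i)" for k
    by (intro sum.cong refl) (simp add: sym[of k] mult_ac)
  finally show ?thesis by (simp add: conn_form_def vec_eq_iff)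
qed

lemma (in metric) conn_form_unique:
  assumes D: "metric_connection M A L D" "torsion_free M A D" "\<And>a b d. cov_form M L D c v a b d = 0"
    and D': "metric_connection M A L D'" "torsion_free M A D'" "\<And>a b d. cov_form M L D' c v a b d = 0"
    and v: "v \<in> A" and c: "c \<in> M" "fst v \<in> fst c"
  shows "conn_form M D' c v = conn_form M D c v"
proof (intro ext)
  fix a b
  interpret D: metric_connection M A L D by fact
  interpret D': metric_connection M A L D' by fact
  obtain x y where xy: "to_coords c v = (x, y)" by fastforce
  have z: "(x, y) \<in> coord_dom c A" using to_coords_in_coord_dom[OF v c(2)] xy by simp
  have y: "snd v c = y" using xy by (simp add: to_coords_def)
  let ?g = "metric_form M L c (x, y)"
  let ?F = "\<lambda>b d. frechet_derivative (\<lambda>z. metric_form M L c z b d) (at (x, y))"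
  let ?B = "\<lambda>a b. conn_form M D' c v a b - conn_form M D c v a b"
  have F: "linear (?F b d)" for b d
    by (rule has_derivative_linear[OF metric_form_has_derivative[OF c(1) z]])
  have "?B a b = 0"
  proof (rule linear_form_uniqueness[where g = ?g and B = ?B and y = y and C = "\<lambda>l b d. ?F b d (0, l)"])
    show "?g a b = ?g b a" for a b by (rule metric_form_sym[OF c(1) z])
    show "a = 0" if "\<And>b. ?g a b = 0" for a by (rule metric_form_nondegenerate[OF c(1) z that])
    show "?F b d (0, 0) = 0" for b d using linear_0[OF F] by (simp add: zero_prod_def)
    show "?F y d (0, l) = 0" for d l by (rule cartan_radial[OF c(1) z])
    show "?B a b = ?B b a" for a b
      using D.torsion_free_conn_form[OF D(2) v c, of a b] D'.torsion_free_conn_form[OF D'(2) v c, of a b] by simp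
    fix a b d
    \<comment> \<open>The two horizontal lifts of \<open>a\<close> have the same base part, so their
      difference is the vertical vector given by \<open>?B a y\<close>.\<close>
    have "?F b d (a, - conn_form M D' c v a y) = ?F b d (a, - conn_form M D c v a y) - ?F b d (0, ?B a y)"
      using linear_diff[OF F, of b d "(a, - conn_form M D c v a y)" "(0, ?B a y)"] by simp
    moreover have "?g (?B a b) d = ?g (conn_form M D' c v a b) d - ?g (conn_form M D c v a b) d"
      by (rule linear_diff[OF linear_metric_form_left[OF c(1) z]])
    moreover have "?g b (?B a d) = ?g b (conn_form M D' c v a d) - ?g b (conn_form M D c v a d)"
      by (rule linear_diff[OF linear_metric_form_right[OF c(1) z]])
    ultimately show "?F b d (0, ?B a y) + ?g (?B a b) d + ?g b (?B a d) = 0"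
      using D(3)[of a b d] D'(3)[of a b d] unfolding cov_form_def xy y by simp
  qed
  then show "conn_form M D' c v a b = conn_form M D c v a b" by simp
qed

section \<open>Parallel transport\<close>

text \<open>Product rule for a derivative applied to a moving vector at a moving point. For a
  transition map, the term with second derivatives is the one that \<open>conn_form_change\<close>
  compensates.\<close>

lemma has_vector_derivative_frechet_apply:
  fixes f :: "real^'n::finite \<Rightarrow> 'b::real_normed_vector"
  assumes f: "smooth_on T f" "open T" and x: "\<And>\<tau>. \<tau> \<in> S \<Longrightarrow> x \<tau> \<in> T" and t: "t \<in> S"
    and dx: "(x has_vector_derivative x') (at t within S)" and dw: "(w has_vector_derivative w') (at t within S)"
  shows "((\<lambda>\<tau>. frechet_derivative f (at (x \<tau>)) (w \<tau>)) has_vector_derivative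
      frechet_derivative f (at (x t)) w'
      + frechet_derivative (\<lambda>z. frechet_derivative f (at z) (w t)) (at (x t)) x') (at t within S)"
proof -
  let ?F = "\<lambda>b z. frechet_derivative f (at z) b"
  have lin: "linear (\<lambda>b. ?F b z)" if "z \<in> T" for z
    using has_derivative_linear[OF smooth_on_open_has_derivative[OF f that]] .
  have dF: "(?F b has_derivative frechet_derivative (?F b) (at z)) (at z)" if "z \<in> T" for b z
    by (rule smooth_on_open_has_derivative[OF smooth_on_open_frechet_derivative[OF f] f(2) that])
  have dFx: "((\<lambda>\<tau>. ?F b (x \<tau>)) has_vector_derivative frechet_derivative (?F b) (at (x t)) x') (at t within S)" for b
    by (rule vector_derivative_diff_chain_within[OF dx, unfolded o_def])
       (rule has_derivative_at_withinI[OF dF[OF x[OF t]]])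
  have dwi: "((\<lambda>\<tau>. w \<tau> $ i) has_vector_derivative w' $ i) (at t within S)" for i
    by (rule bounded_linear.has_vector_derivative[OF bounded_linear_vec_nth dw])
  have "((\<lambda>\<tau>. \<Sum>i\<in>UNIV. w \<tau> $ i *\<^sub>R ?F (axis i 1) (x \<tau>)) has_vector_derivative
      (\<Sum>i\<in>UNIV. w t $ i *\<^sub>R frechet_derivative (?F (axis i 1)) (at (x t)) x' + w' $ i *\<^sub>R ?F (axis i 1) (x t)))
      (at t within S)"
    by (intro has_vector_derivative_sum has_vector_derivative_scaleR dFx dwi[unfolded has_real_derivative_iff_has_vector_derivative[symmetric]])
  moreover have "(\<Sum>i\<in>UNIV. w t $ i *\<^sub>R frechet_derivative (?F (axis i 1)) (at (x t)) x')
      = frechet_derivative (?F (w t)) (at (x t)) x'"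
  proof -
    have "((\<lambda>z. \<Sum>i\<in>UNIV. w t $ i *\<^sub>R ?F (axis i 1) z) has_derivative
        (\<lambda>h. \<Sum>i\<in>UNIV. w t $ i *\<^sub>R frechet_derivative (?F (axis i 1)) (at (x t)) h)) (at (x t))"
      by (intro has_derivative_sum has_derivative_scaleR_right dF x t)
    then have "(?F (w t) has_derivative
        (\<lambda>h. \<Sum>i\<in>UNIV. w t $ i *\<^sub>R frechet_derivative (?F (axis i 1)) (at (x t)) h)) (at (x t))"
      by (rule has_derivative_transform_within_open[OF _ f(2) x[OF t]])
         (rule linear_eq_sum_axis[OF lin, symmetric])
    from fun_cong[OF has_derivative_unique[OF this dF[OF x[OF t]]], of x'] show ?thesis .
  qed
  moreover have "(\<Sum>i\<in>UNIV. w' $ i *\<^sub>R ?F (axis i 1) (x t)) = ?F w' (x t)"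
    by (rule linear_eq_sum_axis[OF lin[OF x[OF t]], symmetric])
  ultimately have "((\<lambda>\<tau>. \<Sum>i\<in>UNIV. w \<tau> $ i *\<^sub>R ?F (axis i 1) (x \<tau>)) has_vector_derivative
      ?F w' (x t) + frechet_derivative (?F (w t)) (at (x t)) x') (at t within S)"
    by (simp add: sum.distrib add.commute)
  then show ?thesis
    by (rule has_vector_derivative_transform[OF t, rotated]) (rule linear_eq_sum_axis[OF lin[OF x]])
qed

section \<open>Curves and the equation of parallel transport\<close>

locale curve = connection M A D
  for M :: "('a::{t2_space, second_countable_topology}, 'n::finite) chart set" and A D +
  fixes a b :: real and \<gamma> :: "real \<Rightarrow> 'a"
  assumes ab: "a < b" and curve: "smooth_curve M a b \<gamma>"
begin

definition chart_times :: "('a, 'n) chart \<Rightarrow> real set" where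
  "chart_times c = {t \<in> {a..b}. \<gamma> t \<in> fst c}"

definition vel :: "('a, 'n) chart \<Rightarrow> real \<Rightarrow> real^'n" where
  "vel c t = vector_derivative (snd c \<circ> \<gamma>) (at t within {a..b})"

text \<open>The equation is imposed in all charts on an arbitrary subinterval and without
  smoothness: subintervals can be concatenated, and smoothness follows from the equation afterwards.
  The velocity is always that of the whole curve.\<close>

definition parallel :: "(real \<Rightarrow> ('a, 'n) tvec) \<Rightarrow> real \<Rightarrow> real \<Rightarrow> (real \<Rightarrow> ('a, 'n) tvec) \<Rightarrow> bool" where
  "parallel V s u W \<longleftrightarrow> (\<forall>t\<in>{s..u}. W t \<in> tangent_space M (\<gamma> t) \<and>
     (\<forall>c\<in>M. \<gamma> t \<in> fst c \<longrightarrow> ((\<lambda>\<tau>. W \<tau> c) has_vector_derivative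
        - conn_form M D c (\<gamma> t, V t) (vel c t) (W t c)) (at t within {s..u})))"

lemma chart_times_open:
  assumes "c \<in> M" obtains T where "open T" "chart_times c = {a..b} \<inter> T"
proof -
  have "continuous_on {a..b} \<gamma>" using curve by (simp add: smooth_curve_def)
  then obtain T where T: "open T" "T \<inter> {a..b} = \<gamma> -` fst c \<inter> {a..b}"
    using open_chart_domain[OF assms] unfolding continuous_on_open_invariant by blast
  have "chart_times c = \<gamma> -` fst c \<inter> {a..b}" unfolding chart_times_def by blast
  then have "chart_times c = {a..b} \<inter> T" unfolding T(2)[symmetric] by (simp only: Int_commute)
  then show ?thesis by (rule that[OF T(1)])
qed

lemma thick_chart_times: "c \<in> M \<Longrightarrow> thick (chart_times c)"
  by (erule chart_times_open) (simp add: thick_Int_open thick_interval ab)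

text \<open>\<open>chart_times c\<close> is relatively open in \<open>{a..b}\<close>, so restricting
  to it has no effect on limits at its points. This mediates between smoothness, which is stated on
  \<open>chart_times c\<close>, and derivatives, which are taken within intervals.\<close>

lemma at_within_chart_times:
  assumes c: "c \<in> M" and t: "t \<in> chart_times c" and S: "S \<subseteq> {a..b}"
  shows "at t within S \<inter> chart_times c = at t within S"
proof -
  obtain T where T: "open T" "chart_times c = {a..b} \<inter> T" by (rule chart_times_open[OF c])
  show ?thesis by (rule at_within_nhd[of t T]) (use T t S in auto)
qed

lemma at_within_chart_times': "c \<in> M \<Longrightarrow> t \<in> chart_times c \<Longrightarrow> at t within chart_times c = at t within {a..b}"
proof -
  assume *: "c \<in> M" "t \<in> chart_times c"
  have "{a..b} \<inter> chart_times c = chart_times c" by (auto simp: chart_times_def)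
  with at_within_chart_times[OF *, of "{a..b}"] show ?thesis by simp
qed

lemma eventually_in_chart_times:
  assumes c: "c \<in> M" and t: "t \<in> chart_times c" and S: "S \<subseteq> {a..b}"
  shows "\<forall>\<^sub>F \<tau> in at t within S. \<tau> \<in> S \<inter> chart_times c"
  unfolding at_within_chart_times[OF assms, symmetric] by (simp add: eventually_at_filter)

lemma has_vector_derivative_smooth_on_chart_times:
  assumes c: "c \<in> M" and t: "t \<in> chart_times c" and f: "smooth_on (chart_times c) f"
  shows "(f has_vector_derivative vector_derivative f (at t within {a..b})) (at t within {a..b})"
    "vector_derivative f (at t within {a..b}) = frechet_derivative f (at t within chart_times c) 1"
proof -
  have der: "(f has_derivative frechet_derivative f (at t within chart_times c)) (at t within chart_times c)"
    by (rule smooth_on_has_derivative[OF f t])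
  then have "(f has_derivative (\<lambda>h. h *\<^sub>R frechet_derivative f (at t within chart_times c) 1)) (at t within chart_times c)"
    by (rule has_derivative_eq_rhs)
       (simp add: fun_eq_iff linear_cmul[OF has_derivative_linear[OF der], symmetric])
  then have *: "(f has_vector_derivative frechet_derivative f (at t within chart_times c) 1) (at t within {a..b})"
    unfolding has_vector_derivative_def at_within_chart_times'[OF c t] .
  then show eq: "vector_derivative f (at t within {a..b}) = frechet_derivative f (at t within chart_times c) 1"
    using vector_derivative_within_cbox[of a b t f] ab t by (simp add: chart_times_def)
  show "(f has_vector_derivative vector_derivative f (at t within {a..b})) (at t within {a..b})"
    unfolding eq by (rule *)
qed

lemma smooth_on_curve: "c \<in> M \<Longrightarrow> smooth_on (chart_times c) (\<lambda>t. snd c (\<gamma> t))"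
  using curve unfolding smooth_curve_def chart_times_def o_def by blast

lemma curve_has_vector_derivative:
  assumes "c \<in> M" "t \<in> chart_times c"
  shows "((\<lambda>t. snd c (\<gamma> t)) has_vector_derivative vel c t) (at t within {a..b})"
  unfolding vel_def o_def by (rule has_vector_derivative_smooth_on_chart_times(1)[OF assms smooth_on_curve[OF assms(1)]])

lemma smooth_on_vel:
  assumes c: "c \<in> M" shows "smooth_on (chart_times c) (vel c)"
proof -
  have "smooth_on (chart_times c) (\<lambda>t. frechet_derivative (\<lambda>t. snd c (\<gamma> t)) (at t within chart_times c) 1)"
    by (rule smooth_on_frechet_derivative[OF smooth_on_curve[OF c]])
  then show ?thesis
    by (rule smooth_on_cong[THEN iffD1, rotated])
       (simp add: vel_def o_def has_vector_derivative_smooth_on_chart_times(2)[OF c _ smooth_on_curve[OF c]])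
qed

lemma vel_change:
  assumes c: "c \<in> M" "c' \<in> M" and t: "t \<in> chart_times c" "t \<in> chart_times c'"
  shows "vel c' t = dtrans c c' (snd c (\<gamma> t)) (vel c t)"
proof -
  have tI: "t \<in> {a..b}" and p: "\<gamma> t \<in> fst c" "\<gamma> t \<in> fst c'" using t by (auto simp: chart_times_def)
  have "((\<lambda>\<tau>. transition c c' (snd c (\<gamma> \<tau>))) has_vector_derivative dtrans c c' (snd c (\<gamma> t)) (vel c t)) (at t within chart_times c)"
    by (rule vector_derivative_diff_chain_within[unfolded o_def])
       (use curve_has_vector_derivative[OF c(1) t(1)] transition_has_derivative[OF c p] at_within_chart_times'[OF c(1) t(1)]
        in \<open>auto intro: has_derivative_at_withinI\<close>)
  then have "((\<lambda>\<tau>. snd c' (\<gamma> \<tau>)) has_vector_derivative dtrans c c' (snd c (\<gamma> t)) (vel c t)) (at t within chart_times c)"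
    by (rule has_vector_derivative_transform[OF t(1), rotated])
       (simp add: transition_apply chart_times_def chart_inv_chart[OF c(1)])
  then have "((\<lambda>\<tau>. snd c' (\<gamma> \<tau>)) has_vector_derivative dtrans c c' (snd c (\<gamma> t)) (vel c t)) (at t within cbox a b)"
    using at_within_chart_times'[OF c(1) t(1)] by simp
  from vector_derivative_within_cbox[OF ab _ this] show ?thesis using tI by (simp add: vel_def o_def)
qed

text \<open>The equation of parallel transport in one chart implies it in every other chart: the second
  derivatives of the transition map cancel.\<close>

lemma parallel_change_chart:
  assumes su: "{s..u} \<subseteq> {a..b}" and W: "\<And>\<tau>. \<tau> \<in> {s..u} \<Longrightarrow> W \<tau> \<in> tangent_space M (\<gamma> \<tau>)"
    and t: "t \<in> {s..u}" and c: "c \<in> M" "c' \<in> M" "\<gamma> t \<in> fst c" "\<gamma> t \<in> fst c'" and V: "(\<gamma> t, V t) \<in> A"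
    and der: "((\<lambda>\<tau>. W \<tau> c) has_vector_derivative - conn_form M D c (\<gamma> t, V t) (vel c t) (W t c)) (at t within {s..u})"
  shows "((\<lambda>\<tau>. W \<tau> c') has_vector_derivative - conn_form M D c' (\<gamma> t, V t) (vel c' t) (W t c')) (at t within {s..u})"
proof -
  let ?x = "snd c (\<gamma> t)"
  define S where "S = ({s..u} \<inter> chart_times c) \<inter> chart_times c'"
  have td: "t \<in> chart_times c" "t \<in> chart_times c'" using t c su by (auto simp: chart_times_def)
  have S: "at t within S = at t within {s..u}"
  proof -
    have "{s..u} \<inter> chart_times c \<subseteq> {a..b}" using su by blast
    from at_within_chart_times[OF c(2) td(2) this] at_within_chart_times[OF c(1) td(1) su]
    show ?thesis unfolding S_def by (rule trans)
  qed
  have tS: "t \<in> S" using t td by (simp add: S_def)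
  have lin: "linear (dtrans c c' ?x)" by (rule linear_dtrans[OF c])
  have "((\<lambda>\<tau>. dtrans c c' (snd c (\<gamma> \<tau>)) (W \<tau> c)) has_vector_derivative
      dtrans c c' ?x (- conn_form M D c (\<gamma> t, V t) (vel c t) (W t c))
      + frechet_derivative (\<lambda>z. dtrans c c' z (W t c)) (at ?x) (vel c t)) (at t within S)"
  proof (rule has_vector_derivative_frechet_apply[OF smooth_on_transition[OF c(1,2)] open_overlap[OF c(1,2)] _ tS])
    show "snd c (\<gamma> \<tau>) \<in> snd c ` (fst c \<inter> fst c')" if "\<tau> \<in> S" for \<tau>
      using that by (auto simp: S_def chart_times_def)
    have "S \<subseteq> {a..b}" using su by (auto simp: S_def)
    then show "((\<lambda>\<tau>. snd c (\<gamma> \<tau>)) has_vector_derivative vel c t) (at t within S)"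
      by (rule has_vector_derivative_within_subset[OF curve_has_vector_derivative[OF c(1) td(1)]])
    show "((\<lambda>\<tau>. W \<tau> c) has_vector_derivative - conn_form M D c (\<gamma> t, V t) (vel c t) (W t c)) (at t within S)"
      unfolding S by (rule der)
  qed
  also have "dtrans c c' ?x (- conn_form M D c (\<gamma> t, V t) (vel c t) (W t c))
      + frechet_derivative (\<lambda>z. dtrans c c' z (W t c)) (at ?x) (vel c t)
      = - conn_form M D c' (\<gamma> t, V t) (dtrans c c' ?x (vel c t)) (dtrans c c' ?x (W t c))"
    using conn_form_change[OF V c(1,2), of "vel c t" "W t c"] c by (simp add: linear_neg[OF lin])
  also have "\<dots> = - conn_form M D c' (\<gamma> t, V t) (vel c' t) (W t c')"
    using vel_change[OF c(1,2) td] tangent_change[OF W[OF t] c] by simp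
  finally have "((\<lambda>\<tau>. W \<tau> c') has_vector_derivative - conn_form M D c' (\<gamma> t, V t) (vel c' t) (W t c')) (at t within S)"
    by (rule has_vector_derivative_transform[OF tS, rotated])
       (use W in \<open>auto simp: S_def chart_times_def intro!: tangent_change[OF _ c(1,2)]\<close>)
  then show ?thesis unfolding S .
qed

lemma parallel_from_chart:
  assumes su: "{s..u} \<subseteq> {a..b}" and c: "c \<in> M" "\<And>t. t \<in> {s..u} \<Longrightarrow> \<gamma> t \<in> fst c"
    and V: "\<And>t. t \<in> {s..u} \<Longrightarrow> (\<gamma> t, V t) \<in> A"
    and W: "\<And>t. t \<in> {s..u} \<Longrightarrow> W t \<in> tangent_space M (\<gamma> t)"
    and der: "\<And>t. t \<in> {s..u} \<Longrightarrow>
      ((\<lambda>\<tau>. W \<tau> c) has_vector_derivative - conn_form M D c (\<gamma> t, V t) (vel c t) (W t c)) (at t within {s..u})"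
  shows "parallel V s u W"
  unfolding parallel_def
proof (intro ballI conjI impI)
  fix t assume t: "t \<in> {s..u}"
  show "W t \<in> tangent_space M (\<gamma> t)" by (rule W[OF t])
  fix c' assume c': "c' \<in> M" "\<gamma> t \<in> fst c'"
  show "((\<lambda>\<tau>. W \<tau> c') has_vector_derivative - conn_form M D c' (\<gamma> t, V t) (vel c' t) (W t c')) (at t within {s..u})"
    by (rule parallel_change_chart[where c = c]) (use su W t c c' V der in auto)
qed

lemma parallel_tangent: "parallel V s u W \<Longrightarrow> t \<in> {s..u} \<Longrightarrow> W t \<in> tangent_space M (\<gamma> t)"
  unfolding parallel_def by blast

lemma parallel_has_vector_derivative:
  "parallel V s u W \<Longrightarrow> t \<in> {s..u} \<Longrightarrow> c \<in> M \<Longrightarrow> \<gamma> t \<in> fst c \<Longrightarrow>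
    ((\<lambda>\<tau>. W \<tau> c) has_vector_derivative - conn_form M D c (\<gamma> t, V t) (vel c t) (W t c)) (at t within {s..u})"
  unfolding parallel_def by blast

text \<open>At the junction the one-sided derivatives agree because both are the right-hand side of
  the same equation at the same value.\<close>

lemma parallel_glue:
  assumes 1: "parallel V s m W1" and 2: "parallel V m u W2" and m: "s \<le> m" "m \<le> u" and eq: "W1 m = W2 m"
  shows "parallel V s u (\<lambda>t. if t \<in> {s..m} then W1 t else W2 t)"
  unfolding parallel_def
proof (intro ballI conjI impI)
  fix t assume t: "t \<in> {s..u}"
  let ?W = "\<lambda>t. if t \<in> {s..m} then W1 t else W2 t"
  show "?W t \<in> tangent_space M (\<gamma> t)"
    using parallel_tangent[OF 1, of t] parallel_tangent[OF 2, of t] t by auto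
  fix c assume c: "c \<in> M" "\<gamma> t \<in> fst c"
  have un: "{s..u} = {s..m} \<union> {m..u}" using m by auto
  have int: "closure {s..m} \<inter> closure {m..u} = {m}" using m by auto
  have "((\<lambda>t. if t \<in> {s..m} then W1 t c else W2 t c) has_vector_derivative
      (if t \<in> {s..m} then - conn_form M D c (\<gamma> t, V t) (vel c t) (W1 t c)
       else - conn_form M D c (\<gamma> t, V t) (vel c t) (W2 t c))) (at t within {s..u})"
  proof (rule has_vector_derivative_If_within_closures[OF _ un])
    show "t \<in> {s..m} \<union> {m..u}" using t un by simp
    have i1: "{s..m} \<union> {m} = {s..m}" and i2: "{m..u} \<union> {m} = {m..u}" using m by auto
    show "((\<lambda>t. W1 t c) has_vector_derivative - conn_form M D c (\<gamma> t, V t) (vel c t) (W1 t c))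
        (at t within {s..m} \<union> closure {s..m} \<inter> closure {m..u})"
      if "t \<in> {s..m} \<union> closure {s..m} \<inter> closure {m..u}"
      using that unfolding int i1 by (intro parallel_has_vector_derivative[OF 1 _ c])
    show "((\<lambda>t. W2 t c) has_vector_derivative - conn_form M D c (\<gamma> t, V t) (vel c t) (W2 t c))
        (at t within {m..u} \<union> closure {s..m} \<inter> closure {m..u})"
      if "t \<in> {m..u} \<union> closure {s..m} \<inter> closure {m..u}"
      using that unfolding int i2 by (intro parallel_has_vector_derivative[OF 2 _ c])
    assume "t \<in> closure {s..m}" "t \<in> closure {m..u}"
    then have "t = m" by auto
    then show "W1 t c = W2 t c" "- conn_form M D c (\<gamma> t, V t) (vel c t) (W1 t c)
        = - conn_form M D c (\<gamma> t, V t) (vel c t) (W2 t c)" using eq by auto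
  qed
  moreover have W_eq: "?W \<tau> c = (if \<tau> \<in> {s..m} then W1 \<tau> c else W2 \<tau> c)" for \<tau> by simp
  ultimately show "((\<lambda>\<tau>. ?W \<tau> c) has_vector_derivative - conn_form M D c (\<gamma> t, V t) (vel c t) (?W t c)) (at t within {s..u})"
    by (simp only: W_eq if_distrib[of "\<lambda>y. - conn_form M D c (\<gamma> t, V t) (vel c t) y"])
qed

text \<open>
  Near a point where \<open>Y\<close> and \<open>Y'\<close> agree, Gronwall's estimate in a chart applies; near a point where they
  differ there is nothing to show. Bolzano's principle combines the two cases.
\<close>

lemma fields_unique:
  fixes G :: "('a, 'n) chart \<Rightarrow> 'q::euclidean_space \<times> (real^'n) \<Rightarrow> real^'n"
  assumes su: "{s..u} \<subseteq> {a..b}" "s \<le> u"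
    and Z: "\<And>c. c \<in> M \<Longrightarrow> open (Z c)" "\<And>c. c \<in> M \<Longrightarrow> smooth_on (Z c) (G c)"
    and q: "\<And>c. c \<in> M \<Longrightarrow> continuous_on (chart_times c) (q c)"
    and Y: "\<And>t. t \<in> {s..u} \<Longrightarrow> Y t \<in> tangent_space M (\<gamma> t)"
      "\<And>t c. t \<in> {s..u} \<Longrightarrow> c \<in> M \<Longrightarrow> \<gamma> t \<in> fst c \<Longrightarrow> (q c t, Y t c) \<in> Z c"
      "\<And>t c. t \<in> {s..u} \<Longrightarrow> c \<in> M \<Longrightarrow> \<gamma> t \<in> fst c \<Longrightarrow>
        ((\<lambda>\<tau>. Y \<tau> c) has_vector_derivative G c (q c t, Y t c)) (at t within {s..u})"
    and Y': "\<And>t. t \<in> {s..u} \<Longrightarrow> Y' t \<in> tangent_space M (\<gamma> t)"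
      "\<And>t c. t \<in> {s..u} \<Longrightarrow> c \<in> M \<Longrightarrow> \<gamma> t \<in> fst c \<Longrightarrow> (q c t, Y' t c) \<in> Z c"
      "\<And>t c. t \<in> {s..u} \<Longrightarrow> c \<in> M \<Longrightarrow> \<gamma> t \<in> fst c \<Longrightarrow>
        ((\<lambda>\<tau>. Y' \<tau> c) has_vector_derivative G c (q c t, Y' t c)) (at t within {s..u})"
    and init: "Y s = Y' s"
  shows "Y u = Y' u"
proof -
  \<comment> \<open>Bolzano's principle needs a property of intervals that survives concatenation:
    equality at the left end implies equality at the right end.\<close>
  define P where "P l h \<longleftrightarrow> (s \<le> l \<and> l \<le> h \<and> h \<le> u \<longrightarrow> Y l = Y' l \<longrightarrow> Y h = Y' h)" for l h
  have "P s u"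
    using su(2)
  proof (induction rule: Bolzano)
    case (trans l m h)
    then show ?case unfolding P_def by auto
  next
    case (local x)
    then have x: "x \<in> {s..u}" by auto
    obtain c where c: "c \<in> M" "\<gamma> x \<in> fst c" by (rule chart_exists)
    have xd: "x \<in> chart_times c" using x su c by (auto simp: chart_times_def)
    have Yc: "((\<lambda>\<tau>. Y \<tau> c) \<longlongrightarrow> Y x c) (at x within {s..u})"
      "((\<lambda>\<tau>. Y' \<tau> c) \<longlongrightarrow> Y' x c) (at x within {s..u})"
      using has_vector_derivative_continuous[OF Y(3)[OF x c]] has_vector_derivative_continuous[OF Y'(3)[OF x c]]
      by (auto simp: continuous_within)
    have "(q c \<longlongrightarrow> q c x) (at x within chart_times c)"
      using q[OF c(1)] xd by (auto simp: continuous_on_def)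
    then have qc: "(q c \<longlongrightarrow> q c x) (at x within {s..u})"
      unfolding at_within_chart_times'[OF c(1) xd] by (rule tendsto_within_subset) (rule su(1))
    note evd = eventually_in_chart_times[OF c(1) xd su(1)]
    show ?case
    proof (cases "Y x = Y' x")
      case False
      then have "Y x c \<noteq> Y' x c"
        using tangent_eqI[OF Y(1)[OF x] Y'(1)[OF x] c] by blast
      then have ne: "Y x c - Y' x c \<noteq> 0" by simp
      have "\<forall>\<^sub>F \<tau> in at x within {s..u}. Y \<tau> c - Y' \<tau> c \<noteq> 0"
        by (rule tendsto_imp_eventually_ne[OF tendsto_diff[OF Yc] ne])
      then obtain d where d: "d > 0" "\<And>\<tau>. \<tau> \<in> {s..u} \<Longrightarrow> \<tau> \<noteq> x \<Longrightarrow> dist \<tau> x < d \<Longrightarrow> Y \<tau> c - Y' \<tau> c \<noteq> 0"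
        unfolding eventually_at by blast
      have "P l h" if "l \<le> x \<and> x \<le> h \<and> h - l < d" for l h
        unfolding P_def
      proof (intro impI)
        assume "s \<le> l \<and> l \<le> h \<and> h \<le> u" and eq: "Y l = Y' l"
        then have "l \<in> {s..u}" "dist l x < d" using that by (auto simp: dist_real_def)
        with d(2)[of l] ne have "Y l c - Y' l c \<noteq> 0" by (cases "l = x") auto
        with eq show "Y h = Y' h" by simp
      qed
      with d(1) show ?thesis by blast
    next
      case True
      obtain r K where r: "r > 0" and lip: "\<And>z z'. z \<in> cball (q c x, Y x c) r \<Longrightarrow> z' \<in> cball (q c x, Y x c) r \<Longrightarrow>
          norm (G c z - G c z') \<le> K * norm (z - z')"
        using smooth_on_locally_lipschitz[OF Z(2)[OF c(1)] Z(1)[OF c(1)] Y(2)[OF x c]] by metis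
      have "\<forall>\<^sub>F \<tau> in at x within {s..u}. dist (q c \<tau>, Y \<tau> c) (q c x, Y x c) < r"
        "\<forall>\<^sub>F \<tau> in at x within {s..u}. dist (q c \<tau>, Y' \<tau> c) (q c x, Y' x c) < r"
        using tendstoD[OF tendsto_Pair[OF qc Yc(1)] r] tendstoD[OF tendsto_Pair[OF qc Yc(2)] r] by auto
      then have "\<forall>\<^sub>F \<tau> in at x within {s..u}. \<tau> \<in> chart_times c \<and> dist (q c \<tau>, Y \<tau> c) (q c x, Y x c) < r
          \<and> dist (q c \<tau>, Y' \<tau> c) (q c x, Y' x c) < r"
        using evd by eventually_elim auto
      then obtain d where d: "d > 0" "\<And>\<tau>. \<tau> \<in> {s..u} \<Longrightarrow> \<tau> \<noteq> x \<Longrightarrow> dist \<tau> x < d \<Longrightarrow> \<tau> \<in> chart_times c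
          \<and> dist (q c \<tau>, Y \<tau> c) (q c x, Y x c) < r \<and> dist (q c \<tau>, Y' \<tau> c) (q c x, Y' x c) < r"
        unfolding eventually_at by blast
      have near: "\<tau> \<in> chart_times c" "(q c \<tau>, Y \<tau> c) \<in> cball (q c x, Y x c) r" "(q c \<tau>, Y' \<tau> c) \<in> cball (q c x, Y x c) r"
        if "\<tau> \<in> {s..u}" "dist \<tau> x < d" for \<tau>
        using d(2)[OF that(1) _ that(2)] r xd True by (cases "\<tau> = x"; auto simp: dist_commute less_imp_le)+
      have "P l h" if lh: "l \<le> x \<and> x \<le> h \<and> h - l < d" for l h
        unfolding P_def
      proof (intro impI)
        assume sl: "s \<le> l \<and> l \<le> h \<and> h \<le> u" and eq: "Y l = Y' l"
        have sub: "{l..h} \<subseteq> {s..u}" using sl by auto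
        have in_near: "\<tau> \<in> {s..u}" "dist \<tau> x < d" if "\<tau> \<in> {l..h}" for \<tau>
          using that sl lh by (auto simp: dist_real_def)
        have \<gamma>: "\<gamma> \<tau> \<in> fst c" if "\<tau> \<in> {l..h}" for \<tau>
          using near(1)[OF in_near[OF that]] by (simp add: chart_times_def)
        have "Y h c = Y' h c"
        proof (rule ode_unique[where a = l and b = h])
          fix \<tau> assume \<tau>: "\<tau> \<in> {l..h}"
          show "((\<lambda>\<tau>. Y \<tau> c) has_vector_derivative G c (q c \<tau>, Y \<tau> c)) (at \<tau> within {l..h})"
            by (rule has_vector_derivative_within_subset[OF Y(3)[OF in_near(1)[OF \<tau>] c(1) \<gamma>[OF \<tau>]] sub])
          show "((\<lambda>\<tau>. Y' \<tau> c) has_vector_derivative G c (q c \<tau>, Y' \<tau> c)) (at \<tau> within {l..h})"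
            by (rule has_vector_derivative_within_subset[OF Y'(3)[OF in_near(1)[OF \<tau>] c(1) \<gamma>[OF \<tau>]] sub])
          have "norm (G c (q c \<tau>, Y \<tau> c) - G c (q c \<tau>, Y' \<tau> c)) \<le> K * norm ((q c \<tau>, Y \<tau> c) - (q c \<tau>, Y' \<tau> c))"
            by (intro lip near in_near \<tau>)
          then show "norm (G c (q c \<tau>, Y \<tau> c) - G c (q c \<tau>, Y' \<tau> c)) \<le> K * norm (Y \<tau> c - Y' \<tau> c)"
            by (simp add: norm_Pair)
        qed (use eq sl in auto)
        moreover have h: "h \<in> {l..h}" using sl by simp
        ultimately show "Y h = Y' h"
          by (intro tangent_eqI[OF Y(1)[OF in_near(1)[OF h]] Y'(1)[OF in_near(1)[OF h]] c(1) \<gamma>[OF h]])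
      qed
      with d(1) show ?thesis by blast
    qed
  qed
  then show ?thesis using su(2) init by (simp add: P_def)
qed

text \<open>
  Transport of \<open>y\<close> along a field with components \<open>\<eta>\<close>, as an autonomous right-hand side: the argument of
  \<open>rhs\<close> is \<open>((x, x', \<eta>), y)\<close>. In \<open>self_rhs\<close>, with argument \<open>((x, x'), y)\<close>, the field is \<open>y\<close> itself.
\<close>

definition rhs :: "('a, 'n) chart \<Rightarrow> ((real^'n) \<times> (real^'n) \<times> (real^'n)) \<times> (real^'n) \<Rightarrow> real^'n" where
  "rhs c z = - conn_form M D c (from_coords M c (fst (fst z), snd (snd (fst z)))) (fst (snd (fst z))) (snd z)"

definition rhs_dom :: "('a, 'n) chart \<Rightarrow> (((real^'n) \<times> (real^'n) \<times> (real^'n)) \<times> (real^'n)) set" where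
  "rhs_dom c = (\<lambda>z. (fst (fst z), snd (snd (fst z)))) -` coord_dom c A"

definition self_rhs :: "('a, 'n) chart \<Rightarrow> ((real^'n) \<times> (real^'n)) \<times> (real^'n) \<Rightarrow> real^'n" where
  "self_rhs c z = - conn_form M D c (from_coords M c (fst (fst z), snd z)) (snd (fst z)) (snd z)"

definition self_rhs_dom :: "('a, 'n) chart \<Rightarrow> (((real^'n) \<times> (real^'n)) \<times> (real^'n)) set" where
  "self_rhs_dom c = (\<lambda>z. (fst (fst z), snd z)) -` coord_dom c A"

lemma open_rhs_dom: "c \<in> M \<Longrightarrow> open (rhs_dom c)"
  unfolding rhs_dom_def by (intro open_vimage open_coord_dom continuous_intros)

lemma open_self_rhs_dom: "c \<in> M \<Longrightarrow> open (self_rhs_dom c)"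
  unfolding self_rhs_dom_def by (intro open_vimage open_coord_dom continuous_intros)

lemma smooth_on_rhs: "c \<in> M \<Longrightarrow> smooth_on (rhs_dom c) (rhs c)"
  unfolding rhs_def[abs_def]
  by (intro smooth_on_uminus smooth_on_conn_form smooth_on_Pair smooth_on_fst smooth_on_snd smooth_on_ident
      thick_open open_rhs_dom) (auto simp: rhs_dom_def)

lemma smooth_on_self_rhs: "c \<in> M \<Longrightarrow> smooth_on (self_rhs_dom c) (self_rhs c)"
  unfolding self_rhs_def[abs_def]
  by (intro smooth_on_uminus smooth_on_conn_form smooth_on_Pair smooth_on_fst smooth_on_snd smooth_on_ident
      thick_open open_self_rhs_dom) (auto simp: self_rhs_dom_def)

lemma coords_eq:
  assumes "(\<gamma> t, V t) \<in> A" "c \<in> M" "\<gamma> t \<in> fst c"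
  shows "(snd c (\<gamma> t), V t c) \<in> coord_dom c A" "from_coords M c (snd c (\<gamma> t), V t c) = (\<gamma> t, V t)"
  using to_coords_in_coord_dom[OF assms(1)] from_to_coords[OF assms(1,2)] assms(3) by (auto simp: to_coords_def)

end

section \<open>Uniqueness, smoothness and existence of parallel fields\<close>

context curve begin

lemma rhs_eq:
  assumes "(\<gamma> t, V t) \<in> A" "c \<in> M" "\<gamma> t \<in> fst c"
  shows "rhs c ((snd c (\<gamma> t), vel c t, V t c), y) = - conn_form M D c (\<gamma> t, V t) (vel c t) y"
    "((snd c (\<gamma> t), vel c t, V t c), y) \<in> rhs_dom c"
  using coords_eq[where V = V, OF assms] by (simp_all add: rhs_def rhs_dom_def)

lemma self_rhs_eq:
  assumes "(\<gamma> t, V t) \<in> A" "c \<in> M" "\<gamma> t \<in> fst c"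
  shows "self_rhs c ((snd c (\<gamma> t), vel c t), V t c) = - conn_form M D c (\<gamma> t, V t) (vel c t) (V t c)"
    "((snd c (\<gamma> t), vel c t), V t c) \<in> self_rhs_dom c"
  using coords_eq[where V = V, OF assms] by (simp_all add: self_rhs_def self_rhs_dom_def)

lemma parallel_subset:
  "parallel V s u W \<Longrightarrow> {s'..u'} \<subseteq> {s..u} \<Longrightarrow> parallel V s' u' W"
  unfolding parallel_def by (meson has_vector_derivative_within_subset subsetD)

lemma parallel_cong:
  "parallel V s u W \<Longrightarrow> (\<And>t. t \<in> {s..u} \<Longrightarrow> V t = V' t) \<Longrightarrow> parallel V' s u W"
  unfolding parallel_def by metis

text \<open>\<open>fields_unique\<close> compares right ends only, so it is applied on
  \<open>{a..t}\<close> to reach an intermediate point.\<close>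

lemma self_parallel_unique:
  assumes V: "\<And>t. t \<in> {a..b} \<Longrightarrow> (\<gamma> t, V t) \<in> A" "parallel V a b V"
    and V': "\<And>t. t \<in> {a..b} \<Longrightarrow> (\<gamma> t, V' t) \<in> A" "parallel V' a b V'"
    and init: "V a = V' a" and t: "t \<in> {a..b}"
  shows "V t = V' t"
proof (rule fields_unique[where s = a and Z = self_rhs_dom and G = self_rhs and q = "\<lambda>c t. (snd c (\<gamma> t), vel c t)"])
  have sub: "{a..t} \<subseteq> {a..b}" using t by auto
  then show "{a..t} \<subseteq> {a..b}" .
  note p = parallel_subset[OF V(2) sub] and p' = parallel_subset[OF V'(2) sub]
  show "continuous_on (chart_times c) (\<lambda>t. (snd c (\<gamma> t), vel c t))" if "c \<in> M" for c
    by (intro continuous_on_Pair smooth_on_continuous smooth_on_curve smooth_on_vel that)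
  fix s assume s: "s \<in> {a..t}"
  then have s': "s \<in> {a..b}" using sub by blast
  show "V s \<in> tangent_space M (\<gamma> s)" by (rule parallel_tangent[OF p s])
  show "V' s \<in> tangent_space M (\<gamma> s)" by (rule parallel_tangent[OF p' s])
  fix c assume c: "c \<in> M" "\<gamma> s \<in> fst c"
  show "((snd c (\<gamma> s), vel c s), V s c) \<in> self_rhs_dom c" by (rule self_rhs_eq(2)[where V = V, OF V(1)[OF s'] c])
  show "((snd c (\<gamma> s), vel c s), V' s c) \<in> self_rhs_dom c" by (rule self_rhs_eq(2)[where V = V', OF V'(1)[OF s'] c])
  show "((\<lambda>\<tau>. V \<tau> c) has_vector_derivative self_rhs c ((snd c (\<gamma> s), vel c s), V s c)) (at s within {a..t})"
    unfolding self_rhs_eq(1)[where V = V, OF V(1)[OF s'] c] by (rule parallel_has_vector_derivative[OF p s c])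
  show "((\<lambda>\<tau>. V' \<tau> c) has_vector_derivative self_rhs c ((snd c (\<gamma> s), vel c s), V' s c)) (at s within {a..t})"
    unfolding self_rhs_eq(1)[where V = V', OF V'(1)[OF s'] c] by (rule parallel_has_vector_derivative[OF p' s c])
qed (use t init open_self_rhs_dom smooth_on_self_rhs in auto)

lemma fields_along_smooth: "V \<in> fields_along M a b \<gamma> \<Longrightarrow> c \<in> M \<Longrightarrow> smooth_on (chart_times c) (\<lambda>t. V t c)"
  unfolding fields_along_def chart_times_def by blast

lemma parallel_unique:
  assumes V: "V \<in> fields_along M a b \<gamma>" "\<And>t. t \<in> {a..b} \<Longrightarrow> (\<gamma> t, V t) \<in> A"
    and p: "parallel V a b W" "parallel V a b W'" and init: "W a = W' a"
  shows "W b = W' b"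
proof (rule fields_unique[where s = a and Z = rhs_dom and G = rhs and q = "\<lambda>c t. (snd c (\<gamma> t), vel c t, V t c)"])
  show "continuous_on (chart_times c) (\<lambda>t. (snd c (\<gamma> t), vel c t, V t c))" if "c \<in> M" for c
    by (intro continuous_on_Pair smooth_on_continuous smooth_on_curve smooth_on_vel fields_along_smooth[OF V(1)] that)
  fix s assume s: "s \<in> {a..b}"
  show "W s \<in> tangent_space M (\<gamma> s)" by (rule parallel_tangent[OF p(1) s])
  show "W' s \<in> tangent_space M (\<gamma> s)" by (rule parallel_tangent[OF p(2) s])
  fix c assume c: "c \<in> M" "\<gamma> s \<in> fst c"
  show "((snd c (\<gamma> s), vel c s, V s c), W s c) \<in> rhs_dom c" "((snd c (\<gamma> s), vel c s, V s c), W' s c) \<in> rhs_dom c"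
    by (rule rhs_eq(2)[where V = V, OF V(2)[OF s] c])+
  show "((\<lambda>\<tau>. W \<tau> c) has_vector_derivative rhs c ((snd c (\<gamma> s), vel c s, V s c), W s c)) (at s within {a..b})"
    unfolding rhs_eq(1)[where V = V, OF V(2)[OF s] c] by (rule parallel_has_vector_derivative[OF p(1) s c])
  show "((\<lambda>\<tau>. W' \<tau> c) has_vector_derivative rhs c ((snd c (\<gamma> s), vel c s, V s c), W' s c)) (at s within {a..b})"
    unfolding rhs_eq(1)[where V = V, OF V(2)[OF s] c] by (rule parallel_has_vector_derivative[OF p(2) s c])
qed (use ab init open_rhs_dom smooth_on_rhs in auto)

text \<open>Differentiability and the equation suffice: the right-hand side is a smooth function of
  position, velocity and the field itself, and the solution inherits smoothness from it.\<close>

lemma self_parallel_smooth: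
  assumes V: "\<And>t. t \<in> {a..b} \<Longrightarrow> (\<gamma> t, V t) \<in> A" and p: "parallel V a b V"
  shows "V \<in> fields_along M a b \<gamma>"
  unfolding fields_along_def mem_Collect_eq chart_times_def[symmetric]
proof (intro conjI ballI)
  show "V t \<in> tangent_space M (\<gamma> t)" if "t \<in> {a..b}" for t by (rule parallel_tangent[OF p that])
  fix c assume c: "c \<in> M"
  show "smooth_on (chart_times c) (\<lambda>t. V t c)"
  proof (rule ode_solution_smooth[OF thick_chart_times[OF c] smooth_on_self_rhs[OF c],
        where u = "\<lambda>t. (snd c (\<gamma> t), vel c t)"])
    show "smooth_on (chart_times c) (\<lambda>t. (snd c (\<gamma> t), vel c t))"
      by (intro smooth_on_Pair thick_chart_times smooth_on_curve smooth_on_vel c)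
    fix t assume t: "t \<in> chart_times c"
    then have t': "t \<in> {a..b}" "\<gamma> t \<in> fst c" by (auto simp: chart_times_def)
    show "((snd c (\<gamma> t), vel c t), V t c) \<in> self_rhs_dom c" by (rule self_rhs_eq(2)[where V = V, OF V[OF t'(1)] c t'(2)])
    show "((\<lambda>\<tau>. V \<tau> c) has_vector_derivative self_rhs c ((snd c (\<gamma> t), vel c t), V t c)) (at t within chart_times c)"
      unfolding self_rhs_eq(1)[where V = V, OF V[OF t'(1)] c t'(2)] at_within_chart_times'[OF c t]
      by (rule parallel_has_vector_derivative[OF p t'(1) c t'(2)])
  qed
qed

lemma parallel_smooth:
  assumes V: "V \<in> fields_along M a b \<gamma>" "\<And>t. t \<in> {a..b} \<Longrightarrow> (\<gamma> t, V t) \<in> A" and p: "parallel V a b W"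
  shows "W \<in> fields_along M a b \<gamma>"
  unfolding fields_along_def mem_Collect_eq chart_times_def[symmetric]
proof (intro conjI ballI)
  show "W t \<in> tangent_space M (\<gamma> t)" if "t \<in> {a..b}" for t by (rule parallel_tangent[OF p that])
  fix c assume c: "c \<in> M"
  show "smooth_on (chart_times c) (\<lambda>t. W t c)"
  proof (rule ode_solution_smooth[OF thick_chart_times[OF c] smooth_on_rhs[OF c],
        where u = "\<lambda>t. (snd c (\<gamma> t), vel c t, V t c)"])
    show "smooth_on (chart_times c) (\<lambda>t. (snd c (\<gamma> t), vel c t, V t c))"
      by (intro smooth_on_Pair thick_chart_times smooth_on_curve smooth_on_vel fields_along_smooth[OF V(1)] c)
    fix t assume t: "t \<in> chart_times c"
    then have t': "t \<in> {a..b}" "\<gamma> t \<in> fst c" by (auto simp: chart_times_def)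
    show "((snd c (\<gamma> t), vel c t, V t c), W t c) \<in> rhs_dom c" by (rule rhs_eq(2)[where V = V, OF V(2)[OF t'(1)] c t'(2)])
    show "((\<lambda>\<tau>. W \<tau> c) has_vector_derivative rhs c ((snd c (\<gamma> t), vel c t, V t c), W t c)) (at t within chart_times c)"
      unfolding rhs_eq(1)[where V = V, OF V(2)[OF t'(1)] c t'(2)] at_within_chart_times'[OF c t]
      by (rule parallel_has_vector_derivative[OF p t'(1) c t'(2)])
  qed
qed

lemma cov_deriv_along_chart:
  assumes "c \<in> M" "\<gamma> t \<in> fst c"
  shows "cov_deriv_along M D a b \<gamma> V W t c = vector_derivative (\<lambda>s. W s c) (at t within {a..b})
      + conn_form M D c (\<gamma> t, V t) (vel c t) (W t c)"
  using assms by (simp add: cov_deriv_along_def conn_form_def vel_def vec_eq_iff)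

text \<open>\<open>vector_derivative\<close> is a total function, so an equation for
  \<open>cov_deriv_along\<close> becomes a statement about actual derivatives through the smoothness
  of \<open>W\<close>.\<close>

lemma parallel_iff_cov_deriv:
  assumes W: "W \<in> fields_along M a b \<gamma>"
  shows "(\<forall>t\<in>{a..b}. cov_deriv_along M D a b \<gamma> V W t = tzero) \<longleftrightarrow> parallel V a b W"
proof
  assume 0: "\<forall>t\<in>{a..b}. cov_deriv_along M D a b \<gamma> V W t = tzero"
  show "parallel V a b W"
    unfolding parallel_def
  proof (intro ballI conjI impI)
    fix t assume t: "t \<in> {a..b}"
    show "W t \<in> tangent_space M (\<gamma> t)" using W t unfolding fields_along_def by blast
    fix c assume c: "c \<in> M" "\<gamma> t \<in> fst c"
    have td: "t \<in> chart_times c" using t c by (simp add: chart_times_def)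
    have "cov_deriv_along M D a b \<gamma> V W t c = 0" using 0 t by simp
    then have "vector_derivative (\<lambda>s. W s c) (at t within {a..b}) = - conn_form M D c (\<gamma> t, V t) (vel c t) (W t c)"
      unfolding cov_deriv_along_chart[OF c] by (simp add: eq_neg_iff_add_eq_0)
    then show "((\<lambda>\<tau>. W \<tau> c) has_vector_derivative - conn_form M D c (\<gamma> t, V t) (vel c t) (W t c)) (at t within {a..b})"
      using has_vector_derivative_smooth_on_chart_times(1)[OF c(1) td fields_along_smooth[OF W c(1)]] by simp
  qed
next
  assume p: "parallel V a b W"
  show "\<forall>t\<in>{a..b}. cov_deriv_along M D a b \<gamma> V W t = tzero"
  proof (intro ballI ext)
    fix t c assume t: "t \<in> {a..b}"
    show "cov_deriv_along M D a b \<gamma> V W t c = tzero c"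
    proof (cases "c \<in> M \<and> \<gamma> t \<in> fst c")
      case True
      then have c: "c \<in> M" "\<gamma> t \<in> fst c" by auto
      have "vector_derivative (\<lambda>s. W s c) (at t within {a..b}) = - conn_form M D c (\<gamma> t, V t) (vel c t) (W t c)"
        using vector_derivative_within_cbox[of a b t "\<lambda>s. W s c"] ab t parallel_has_vector_derivative[OF p t c] by simp
      then show ?thesis unfolding cov_deriv_along_chart[OF c] by simp
    qed (auto simp: cov_deriv_along_def)
  qed
qed

text \<open>The smoothness demanded by \<open>is_transport\<close> is a consequence of the equation,
  by \<open>self_parallel_smooth\<close>.\<close>

lemma is_transport_iff:
  "is_transport M A D a b \<gamma> \<xi> V \<longleftrightarrow> (\<forall>t\<in>{a..b}. (\<gamma> t, V t) \<in> A) \<and> V a = \<xi> \<and> parallel V a b V"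
  unfolding is_transport_def using parallel_iff_cov_deriv[of V V] self_parallel_smooth[of V] by blast

lemma is_transport_fields_along: "is_transport M A D a b \<gamma> \<xi> V \<Longrightarrow> V \<in> fields_along M a b \<gamma>"
  unfolding is_transport_def by blast

lemma is_transport_unique:
  assumes "is_transport M A D a b \<gamma> \<xi> V" "is_transport M A D a b \<gamma> \<xi> V'" "t \<in> {a..b}"
  shows "V t = V' t"
  by (rule self_parallel_unique[OF _ _ _ _ _ assms(3)]) (use assms(1,2) in \<open>simp_all add: is_transport_iff\<close>)

lemma transport_eq:
  assumes V: "is_transport M A D a b \<gamma> \<xi> V"
  shows "transport M A D a b \<gamma> \<xi> = V b"
  unfolding transport_def
proof (rule the_equality)
  show "\<exists>V'. is_transport M A D a b \<gamma> \<xi> V' \<and> V' b = V b" using V by blast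
  show "\<eta> = V b" if "\<exists>V'. is_transport M A D a b \<gamma> \<xi> V' \<and> V' b = \<eta>" for \<eta>
    using that is_transport_unique[OF _ V, of _ b] ab by auto
qed

text \<open>The description also quantifies over the reference field. Any other one equals
  \<open>V\<close> on \<open>{a..b}\<close> by uniqueness, so a competing \<open>W'\<close> is
  parallel along \<open>V\<close> too.\<close>

lemma transport_along_eq:
  assumes V: "is_transport M A D a b \<gamma> \<xi> V" and W: "parallel V a b W" "W a = w"
  shows "transport_along M A D a b \<gamma> \<xi> w = W b"
  unfolding transport_along_def
proof (rule the_equality)
  have Vf: "V \<in> fields_along M a b \<gamma>" by (rule is_transport_fields_along[OF V])
  have VA: "(\<gamma> t, V t) \<in> A" if "t \<in> {a..b}" for t using V that by (simp add: is_transport_iff)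
  have "W \<in> fields_along M a b \<gamma>" by (rule parallel_smooth[OF Vf VA W(1)])
  with V W show "\<exists>V' W'. is_transport M A D a b \<gamma> \<xi> V' \<and> W' \<in> fields_along M a b \<gamma> \<and> W' a = w \<and>
      (\<forall>t\<in>{a..b}. cov_deriv_along M D a b \<gamma> V' W' t = tzero) \<and> W' b = W b"
    using parallel_iff_cov_deriv by blast
  fix \<eta> assume "\<exists>V' W'. is_transport M A D a b \<gamma> \<xi> V' \<and> W' \<in> fields_along M a b \<gamma> \<and> W' a = w \<and>
      (\<forall>t\<in>{a..b}. cov_deriv_along M D a b \<gamma> V' W' t = tzero) \<and> W' b = \<eta>"
  then obtain V' W' where V': "is_transport M A D a b \<gamma> \<xi> V'" and W': "W' \<in> fields_along M a b \<gamma>" "W' a = w"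
    "\<forall>t\<in>{a..b}. cov_deriv_along M D a b \<gamma> V' W' t = tzero" "W' b = \<eta>" by blast
  have "parallel V' a b W'" using W'(3) parallel_iff_cov_deriv[OF W'(1)] by blast
  then have "parallel V a b W'" by (rule parallel_cong) (rule is_transport_unique[OF V' V])
  then have "W' b = W b" using parallel_unique[OF Vf VA _ W(1)] W(2) W'(2) by simp
  with W'(4) show "\<eta> = W b" by simp
qed

text \<open>The equation is linear, so the Lipschitz constant, and with it the admissible length
  \<open>d\<close>, depends neither on the initial value nor on the position of the interval around
  \<open>x\<close>. Bolzano's principle requires exactly this uniformity.\<close>

lemma parallel_exists_locally:
  assumes V: "V \<in> fields_along M a b \<gamma>" "\<And>t. t \<in> {a..b} \<Longrightarrow> (\<gamma> t, V t) \<in> A" and x: "x \<in> {a..b}"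
  obtains d where "d > 0" "\<And>l h w. l \<le> x \<Longrightarrow> x \<le> h \<Longrightarrow> h - l < d \<Longrightarrow> {l..h} \<subseteq> {a..b} \<Longrightarrow> w \<in> tangent_space M (\<gamma> l) \<Longrightarrow>
    \<exists>W. parallel V l h W \<and> W l = w"
proof -
  obtain c where c: "c \<in> M" "\<gamma> x \<in> fst c" by (rule chart_exists)
  have xd: "x \<in> chart_times c" using x c by (simp add: chart_times_def)
  obtain T where T: "open T" "chart_times c = {a..b} \<inter> T" by (rule chart_times_open[OF c(1)])
  obtain e where e: "e > 0" "cball x e \<subseteq> T" using T xd open_contains_cball by blast
  define I where "I = {a..b} \<inter> cball x e"
  have I: "I \<subseteq> chart_times c" "compact I" using e T by (auto simp: I_def intro!: compact_Int)
  define F where "F t y = - conn_form M D c (\<gamma> t, V t) (vel c t) y" for t y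
  have linF: "linear (F t)" for t
    unfolding F_def by (intro linear_compose_neg bounded_linear.linear[OF bounded_linear_conn_form_right])
  have F_sum: "F t y = (\<Sum>i\<in>UNIV. y $ i *\<^sub>R F t (axis i 1))" for t y by (rule linear_eq_sum_axis[OF linF])
  have contF: "continuous_on I (\<lambda>t. F t y)" for y
  proof -
    have "smooth_on (chart_times c) (\<lambda>t. (snd c (\<gamma> t), vel c t, V t c))"
      by (intro smooth_on_Pair thick_chart_times smooth_on_curve smooth_on_vel fields_along_smooth[OF V(1)] c)
    then have "smooth_on (chart_times c) (\<lambda>t. ((snd c (\<gamma> t), vel c t, V t c), y))"
      by (rule smooth_on_Pair[OF thick_chart_times[OF c(1)] _ smooth_on_const[OF thick_chart_times[OF c(1)]]])
    then have "smooth_on (chart_times c) (\<lambda>t. rhs c ((snd c (\<gamma> t), vel c t, V t c), y))"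
      by (rule smooth_on_compose[OF smooth_on_rhs[OF c(1)] _ thick_chart_times[OF c(1)]])
         (use rhs_eq(2)[where V = V, OF V(2) c(1)] in \<open>auto simp: chart_times_def\<close>)
    then have "smooth_on (chart_times c) (\<lambda>t. F t y)"
      by (rule smooth_on_cong[THEN iffD1, rotated])
         (use rhs_eq(1)[where V = V, OF V(2) c(1)] in \<open>auto simp: chart_times_def F_def\<close>)
    then show ?thesis by (rule continuous_on_subset[OF smooth_on_continuous I(1)])
  qed
  have "\<exists>B. \<forall>t\<in>I. norm (F t y) \<le> B" for y
    using compact_imp_bounded[OF compact_continuous_image[OF contF[of y] I(2)]] unfolding bounded_iff by blast
  then obtain B where B: "\<And>y t. t \<in> I \<Longrightarrow> norm (F t y) \<le> B y" by metis
  have xI: "x \<in> I" using x e by (simp add: I_def)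
  define K where "K = (\<Sum>i\<in>UNIV. B (axis i 1))"
  have K: "K \<ge> 0" unfolding K_def by (intro sum_nonneg order_trans[OF norm_ge_zero B[OF xI]])
  have lip: "norm (F t y - F t z) \<le> K * norm (y - z)" if "t \<in> I" for t y z
  proof -
    have "norm (F t y - F t z) = norm (F t (y - z))" by (simp add: linear_diff[OF linF])
    also have "\<dots> \<le> (\<Sum>i\<in>UNIV. norm ((y - z) $ i *\<^sub>R F t (axis i 1)))"
      by (subst F_sum) (rule norm_sum)
    also have "\<dots> \<le> (\<Sum>i\<in>UNIV. norm (y - z) * B (axis i 1))"
      unfolding norm_scaleR by (intro sum_mono mult_mono B that component_le_norm_cart norm_ge_zero)
    finally show ?thesis by (simp add: K_def sum_distrib_left mult.commute)
  qed
  \<comment> \<open>\<open>e\<close> keeps the interval inside the compact set \<open>I\<close>; the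
    other bound makes the contraction factor less than 1.\<close>
  define d where "d = min e (1 / (K + 1))"
  have d: "d > 0" using e K by (simp add: d_def)
  show ?thesis
  proof (rule that[OF d])
    fix l h w assume lh: "l \<le> x" "x \<le> h" "h - l < d" "{l..h} \<subseteq> {a..b}" and w: "w \<in> tangent_space M (\<gamma> l)"
    have sub: "{l..h} \<subseteq> I" using lh by (auto simp: I_def d_def dist_real_def)
    have \<gamma>: "\<gamma> t \<in> fst c" if "t \<in> {l..h}" for t using that sub I(1) by (auto simp: chart_times_def)
    have "(h - l) * K \<le> (1 / (K + 1)) * K" using lh K by (intro mult_right_mono) (auto simp: d_def)
    also have "\<dots> < 1" using K by (simp add: field_simps)
    finally have K1: "(h - l) * K < 1" .
    obtain y where y: "y l = w c" "\<And>t. t \<in> {l..h} \<Longrightarrow> (y has_vector_derivative F t (y t)) (at t within {l..h})"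
    proof (rule ode_exists_lipschitz[where F = F and a = l and b = h and K = K and ?y0.0 = "w c"])
      have "continuous_on ({l..h} \<times> UNIV) (\<lambda>z. \<Sum>i\<in>UNIV. snd z $ i *\<^sub>R F (fst z) (axis i 1))"
        by (intro continuous_on_sum continuous_on_scaleR continuous_on_compose2[OF contF continuous_on_fst[OF continuous_on_id]]
            bounded_linear.continuous_on[OF bounded_linear_vec_nth] continuous_on_snd[OF continuous_on_id])
           (use sub in auto)
      then show "continuous_on ({l..h} \<times> UNIV) (\<lambda>(t, y). F t y)"
        by (simp add: case_prod_beta F_sum[symmetric])
    qed (use lh K K1 sub in \<open>auto intro!: lip\<close>)
    define W where "W t = coord_vec M c (\<gamma> t) (y t)" for t
    have Wc: "W t c = y t" if "t \<in> {l..h}" for t using \<gamma>[OF that] c by (simp add: W_def)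
    have "parallel V l h W"
    proof (rule parallel_from_chart[OF lh(4) c(1) \<gamma>])
      fix t assume t: "t \<in> {l..h}"
      show "(\<gamma> t, V t) \<in> A" using V(2) lh(4) t by blast
      show "W t \<in> tangent_space M (\<gamma> t)" unfolding W_def by (rule coord_vec_tangent[OF c(1) \<gamma>[OF t]])
      have "(y has_vector_derivative - conn_form M D c (\<gamma> t, V t) (vel c t) (W t c)) (at t within {l..h})"
        using y(2)[OF t] by (simp add: F_def Wc[OF t])
      then show "((\<lambda>\<tau>. W \<tau> c) has_vector_derivative - conn_form M D c (\<gamma> t, V t) (vel c t) (W t c)) (at t within {l..h})"
        by (rule has_vector_derivative_transform[OF t, rotated]) (rule Wc)
    qed
    moreover have "W l = w"
      unfolding W_def y(1) by (rule coord_vec_tangent_component[OF w c(1) \<gamma>]) (use lh in auto)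
    ultimately show "\<exists>W. parallel V l h W \<and> W l = w" by blast
  qed
qed

text \<open>Intervals on which every initial vector can be transported may be concatenated, and
  short ones around each point have this property, so Bolzano's principle yields the whole
  curve.\<close>

lemma parallel_exists:
  assumes V: "V \<in> fields_along M a b \<gamma>" "\<And>t. t \<in> {a..b} \<Longrightarrow> (\<gamma> t, V t) \<in> A" and w: "w \<in> tangent_space M (\<gamma> a)"
  obtains W where "parallel V a b W" "W a = w"
proof -
  define P where "P l h \<longleftrightarrow> (a \<le> l \<and> l \<le> h \<and> h \<le> b \<longrightarrow>
    (\<forall>w\<in>tangent_space M (\<gamma> l). \<exists>W. parallel V l h W \<and> W l = w))" for l h
  have "P a b"
    using less_imp_le[OF ab]
  proof (induction rule: Bolzano)
    case (trans l m h)
    show ?case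
      unfolding P_def
    proof (intro impI ballI)
      fix w assume h: "a \<le> l \<and> l \<le> h \<and> h \<le> b" and w: "w \<in> tangent_space M (\<gamma> l)"
      obtain W1 where W1: "parallel V l m W1" "W1 l = w"
        using trans(1,3,4) h w unfolding P_def by force
      have "W1 m \<in> tangent_space M (\<gamma> m)" using parallel_tangent[OF W1(1), of m] trans by simp
      then obtain W2 where W2: "parallel V m h W2" "W2 m = W1 m"
        using trans(2,3,4) h unfolding P_def by force
      show "\<exists>W. parallel V l h W \<and> W l = w"
        using parallel_glue[OF W1(1) W2(1) trans(3,4) W2(2)[symmetric]] W1(2) trans(3)
        by (intro exI[of _ "\<lambda>t. if t \<in> {l..m} then W1 t else W2 t"]) auto
    qed
  next
    case (local x)
    then have "x \<in> {a..b}" by simp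
    from parallel_exists_locally[OF V this] obtain d where d: "d > 0"
      "\<And>l h w. l \<le> x \<Longrightarrow> x \<le> h \<Longrightarrow> h - l < d \<Longrightarrow> {l..h} \<subseteq> {a..b} \<Longrightarrow> w \<in> tangent_space M (\<gamma> l) \<Longrightarrow>
        \<exists>W. parallel V l h W \<and> W l = w" by metis
    show ?case
      by (rule exI[of _ d]) (use d in \<open>auto simp: P_def\<close>)
  qed
  then show ?thesis using ab w that unfolding P_def by auto
qed

end

section \<open>The metric along parallel fields\<close>

locale metric_curve = metric_connection M A L D + curve M A D a b \<gamma>
  for M :: "('a::{t2_space, second_countable_topology}, 'n::finite) chart set" and A L D a b \<gamma>
begin

lemma has_vector_derivative_metric_along:
  assumes V: "\<And>t. t \<in> {a..b} \<Longrightarrow> (\<gamma> t, V t) \<in> A" "parallel V a b V"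
    and W: "parallel V a b W1" "parallel V a b W2"
    and t: "t \<in> {a..b}" and c: "c \<in> M" "\<gamma> t \<in> fst c"
  shows "((\<lambda>s. fundamental_tensor L (\<gamma> s, V s) (W1 s) (W2 s)) has_vector_derivative
    cov_form M L D c (\<gamma> t, V t) (vel c t) (W1 t c) (W2 t c)) (at t within {a..b})"
proof -
  have td: "t \<in> chart_times c" using t c by (simp add: chart_times_def)
  let ?z = "\<lambda>s. (snd c (\<gamma> s), V s c)" and ?\<Gamma> = "conn_form M D c (\<gamma> t, V t) (vel c t)"
  have z: "?z s \<in> coord_dom c A" if "s \<in> chart_times c" for s
    using that coords_eq(1)[where V = V, OF V(1) c(1)] by (simp add: chart_times_def)
  \<comment> \<open>Since \<open>V\<close> is parallel along itself, the pair of base point and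
    \<open>V\<close> moves along the horizontal lift of the velocity, which is the direction of the
    derivative in \<open>cov_form\<close>.\<close>
  have dz: "(?z has_vector_derivative (vel c t, - ?\<Gamma> (V t c))) (at t within {a..b})"
    by (intro has_vector_derivative_Pair curve_has_vector_derivative c td parallel_has_vector_derivative V t)
  have d: "((\<lambda>s. metric_form M L c (?z s) (W1 s c) (W2 s c)) has_vector_derivative
      frechet_derivative (\<lambda>z. metric_form M L c z (W1 t c) (W2 t c)) (at (?z t)) (vel c t, - ?\<Gamma> (V t c))
      + metric_form M L c (?z t) (- ?\<Gamma> (W1 t c)) (W2 t c) + metric_form M L c (?z t) (W1 t c) (- ?\<Gamma> (W2 t c)))
      (at t within chart_times c)"
    by (rule has_vector_derivative_metric_form[OF c(1) z td])
       (use dz parallel_has_vector_derivative[OF W(1) t c] parallel_has_vector_derivative[OF W(2) t c]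
        in \<open>simp_all add: at_within_chart_times'[OF c(1) td]\<close>)
  have "frechet_derivative (\<lambda>z. metric_form M L c z (W1 t c) (W2 t c)) (at (?z t)) (vel c t, - ?\<Gamma> (V t c))
      + metric_form M L c (?z t) (- ?\<Gamma> (W1 t c)) (W2 t c) + metric_form M L c (?z t) (W1 t c) (- ?\<Gamma> (W2 t c))
      = cov_form M L D c (\<gamma> t, V t) (vel c t) (W1 t c) (W2 t c)"
    using linear_neg[OF linear_metric_form_left[OF c(1) z[OF td]], of "?\<Gamma> (W1 t c)" "W2 t c"]
      linear_neg[OF linear_metric_form_right[OF c(1) z[OF td]], of "W1 t c" "?\<Gamma> (W2 t c)"]
    by (simp add: cov_form_def to_coords_def)
  with d have "((\<lambda>s. metric_form M L c (?z s) (W1 s c) (W2 s c)) has_vector_derivative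
      cov_form M L D c (\<gamma> t, V t) (vel c t) (W1 t c) (W2 t c)) (at t within chart_times c)" by simp
  then have "((\<lambda>s. fundamental_tensor L (\<gamma> s, V s) (W1 s) (W2 s)) has_vector_derivative
      cov_form M L D c (\<gamma> t, V t) (vel c t) (W1 t c) (W2 t c)) (at t within chart_times c)"
  proof (rule has_vector_derivative_transform[OF td, rotated])
    fix s assume "s \<in> chart_times c"
    then have s: "s \<in> {a..b}" "\<gamma> s \<in> fst c" by (auto simp: chart_times_def)
    show "fundamental_tensor L (\<gamma> s, V s) (W1 s) (W2 s) = metric_form M L c (?z s) (W1 s c) (W2 s c)"
      using fundamental_tensor_chart[OF V(1)[OF s(1)] c(1)] s(2) parallel_tangent[OF W(1) s(1)] parallel_tangent[OF W(2) s(1)]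
      by (simp add: to_coords_def)
  qed
  then show ?thesis unfolding at_within_chart_times'[OF c(1) td] .
qed

end

section \<open>Preservation of the metric and vanishing of its covariant derivative\<close>

context metric_connection begin

lemma transport_preserves_metric_if:
  assumes cov: "\<And>c v x y z. c \<in> M \<Longrightarrow> v \<in> A \<Longrightarrow> fst v \<in> fst c \<Longrightarrow> cov_form M L D c v x y z = 0"
  shows "transport_preserves_metric M A L D"
  unfolding transport_preserves_metric_def
proof (intro allI impI ballI)
  fix a b \<gamma> \<xi> u w
  assume *: "a < b \<and> smooth_curve M a b \<gamma> \<and> (\<gamma> a, \<xi>) \<in> A \<and> transport_defined M A D a b \<gamma> \<xi>"
    and u: "u \<in> tangent_space M (\<gamma> a)" and w: "w \<in> tangent_space M (\<gamma> a)"
  interpret metric_curve M A L D a b \<gamma>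
    using * by unfold_locales auto
  obtain V where V: "is_transport M A D a b \<gamma> \<xi> V" using * unfolding transport_defined_def by blast
  have Vf: "V \<in> fields_along M a b \<gamma>" by (rule is_transport_fields_along[OF V])
  have VA: "\<And>t. t \<in> {a..b} \<Longrightarrow> (\<gamma> t, V t) \<in> A" and Va: "V a = \<xi>" and Vp: "parallel V a b V"
    using V by (auto simp: is_transport_iff)
  obtain U where U: "parallel V a b U" "U a = u" by (rule parallel_exists[OF Vf VA u])
  obtain W where W: "parallel V a b W" "W a = w" by (rule parallel_exists[OF Vf VA w])
  let ?\<phi> = "\<lambda>s. fundamental_tensor L (\<gamma> s, V s) (U s) (W s)"
  have "(?\<phi> has_vector_derivative 0) (at t within {a..b})" if t: "t \<in> {a..b}" for t
  proof -
    obtain c where c: "c \<in> M" "\<gamma> t \<in> fst c" by (rule chart_exists)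
    show ?thesis using has_vector_derivative_metric_along[OF VA Vp U(1) W(1) t c] cov[OF c(1) VA[OF t]] c(2) by simp
  qed
  then obtain k where k: "\<And>t. t \<in> {a..b} \<Longrightarrow> ?\<phi> t = k"
    using has_vector_derivative_zero_constant[of "{a..b}" ?\<phi>] by auto
  have "?\<phi> b = ?\<phi> a" using k[of a] k[of b] ab by simp
  then show "fundamental_tensor L (\<gamma> b, transport M A D a b \<gamma> \<xi>) (transport_along M A D a b \<gamma> \<xi> u)
      (transport_along M A D a b \<gamma> \<xi> w) = fundamental_tensor L (\<gamma> a, \<xi>) u w"
    by (simp add: transport_eq[OF V] transport_along_eq[OF V U] transport_along_eq[OF V W] U(2) W(2) Va)
qed

lemma smooth_curve_line:
  assumes c: "c \<in> M" and e: "e > 0" and dom: "\<And>t. t \<in> {0..e} \<Longrightarrow> x + t *\<^sub>R a \<in> snd c ` fst c"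
  shows "smooth_curve M 0 e (\<lambda>t. chart_inv c (x + t *\<^sub>R a))"
  unfolding smooth_curve_def
proof (intro conjI ballI)
  have line: "continuous_on S (\<lambda>t. x + t *\<^sub>R a)" for S by (intro continuous_intros)
  show cont: "continuous_on {0..e} (\<lambda>t. chart_inv c (x + t *\<^sub>R a))"
    by (rule continuous_on_compose2[OF continuous_on_chart_inv[OF c] line]) (use dom in auto)
  fix c' assume c': "c' \<in> M"
  let ?S = "{t \<in> {0..e}. chart_inv c (x + t *\<^sub>R a) \<in> fst c'}"
  obtain T where T: "open T" "T \<inter> {0..e} = (\<lambda>t. chart_inv c (x + t *\<^sub>R a)) -` fst c' \<inter> {0..e}"
    using open_chart_domain[OF c'] cont unfolding continuous_on_open_invariant by blast
  have "?S = (\<lambda>t. chart_inv c (x + t *\<^sub>R a)) -` fst c' \<inter> {0..e}" by blast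
  then have S: "?S = {0..e} \<inter> T" unfolding T(2)[symmetric] by (simp only: Int_commute)
  have thick: "thick ?S" unfolding S by (intro thick_Int_open thick_interval T e)
  have "smooth_on ?S (\<lambda>t. x + t *\<^sub>R a)"
    by (intro smooth_on_add smooth_on_scaleR smooth_on_const smooth_on_ident thick)
  then have "smooth_on ?S (\<lambda>t. transition c c' (x + t *\<^sub>R a))"
  proof (rule smooth_on_compose[OF smooth_on_transition[OF c c'] _ thick])
    show "(\<lambda>t. x + t *\<^sub>R a) ` ?S \<subseteq> snd c ` (fst c \<inter> fst c')"
    proof safe
      fix t assume t: "t \<in> {0..e}" "chart_inv c (x + t *\<^sub>R a) \<in> fst c'"
      then show "x + t *\<^sub>R a \<in> snd c ` (fst c \<inter> fst c')"
        using chart_chart_inv[OF c dom[OF t(1)]] chart_inv_in[OF c dom[OF t(1)]] by (intro image_eqI[of _ _ "chart_inv c (x + t *\<^sub>R a)"]) auto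
    qed
  qed
  then show "smooth_on ?S (snd c' \<circ> (\<lambda>t. chart_inv c (x + t *\<^sub>R a)))"
    by (simp add: transition_apply o_def)
qed

lemma cov_form_zero_if_preserves:
  assumes pres: "transport_preserves_metric M A L D" and v: "v \<in> A" and c: "c \<in> M" "fst v \<in> fst c"
  shows "cov_form M L D c v a0 u w = 0"
proof -
  obtain x0 y0 where xy: "to_coords c v = (x0, y0)" by fastforce
  have z0: "(x0, y0) \<in> coord_dom c A" using to_coords_in_coord_dom[OF v c(2)] xy by simp
  define S where "S = (\<lambda>z. (x0 + fst z *\<^sub>R a0, snd z)) -` coord_dom c A"
  have S: "open S" unfolding S_def by (intro open_vimage open_coord_dom c continuous_intros)
  \<comment> \<open>On the line through \<open>x0\<close> with velocity \<open>a0\<close> this is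
    the equation of a self-parallel field in the chart; time enters through the base point
    only.\<close>
  define F where "F z = - conn_form M D c (from_coords M c (x0 + fst z *\<^sub>R a0, snd z)) a0 (snd z)" for z
  have F: "smooth_on S F"
    unfolding F_def[abs_def]
    by (intro smooth_on_uminus smooth_on_conn_form smooth_on_Pair smooth_on_add smooth_on_scaleR smooth_on_fst smooth_on_snd
        smooth_on_ident smooth_on_const thick_open S c) (auto simp: S_def)
  have "(0, y0) \<in> S" using z0 by (simp add: S_def)
  from ode_exists_locally[OF F S this] obtain e y where e: "e > 0" "y 0 = y0" "\<And>t. t \<in> {0..e} \<Longrightarrow> (t, y t) \<in> S"
    and dy': "\<And>t. t \<in> {0..e} \<Longrightarrow> (y has_vector_derivative F (t, y t)) (at t within {0..e})"
    by blast
  have dy: "(y has_vector_derivative - conn_form M D c (from_coords M c (x0 + t *\<^sub>R a0, y t)) a0 (y t)) (at t within {0..e})"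
    if "t \<in> {0..e}" for t
    using dy'[OF that] by (simp add: F_def)
  define \<gamma> where "\<gamma> t = chart_inv c (x0 + t *\<^sub>R a0)" for t
  define V where "V t = coord_vec M c (\<gamma> t) (y t)" for t
  have VA: "(\<gamma> t, V t) \<in> A" "\<gamma> t \<in> fst c" "snd c (\<gamma> t) = x0 + t *\<^sub>R a0" if t: "t \<in> {0..e}" for t
  proof -
    have "(x0 + t *\<^sub>R a0, y t) \<in> coord_dom c A" using e(3)[OF t] by (simp add: S_def)
    then obtain v' where v': "v' \<in> A" "fst v' \<in> fst c" "(x0 + t *\<^sub>R a0, y t) = to_coords c v'"
      "from_coords M c (x0 + t *\<^sub>R a0, y t) = v'" by (rule coord_domE[OF _ c(1)])
    have eq: "(\<gamma> t, V t) = v'" using v'(4) by (simp add: from_coords_def V_def \<gamma>_def)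
    then show "(\<gamma> t, V t) \<in> A" "\<gamma> t \<in> fst c" "snd c (\<gamma> t) = x0 + t *\<^sub>R a0"
      using v'(1,2,3) by (auto simp: to_coords_def)
  qed
  have from_eq: "from_coords M c (x0 + t *\<^sub>R a0, y t) = (\<gamma> t, V t)" for t
    by (simp add: from_coords_def V_def \<gamma>_def)
  have Vc: "V t c = y t" if "t \<in> {0..e}" for t using VA(2)[OF that] c by (simp add: V_def)
  have p: "\<gamma> 0 = fst v" "V 0 = snd v"
  proof -
    show "\<gamma> 0 = fst v" using xy chart_inv_chart[OF c] by (auto simp: \<gamma>_def to_coords_def)
    then show "V 0 = snd v"
      using xy coord_vec_tangent_component[OF A_tangent[OF v] c] by (auto simp: V_def e(2) to_coords_def)
  qed
  \<comment> \<open>All initial pieces of the curve are needed because preservation of the metric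
    speaks of end points only. Velocity and parallelism refer to derivatives within a piece, so they
    are established for every \<open>e'\<close>.\<close>
  have curve: "metric_curve M A L D 0 e' \<gamma>" if "0 < e'" "e' \<le> e" for e'
  proof unfold_locales
    show "smooth_curve M 0 e' \<gamma>"
      unfolding \<gamma>_def[abs_def]
    proof (rule smooth_curve_line[OF c(1) that(1)])
      fix t assume "t \<in> {0..e'}"
      then have "t \<in> {0..e}" using that by auto
      from VA(2,3)[OF this] show "x0 + t *\<^sub>R a0 \<in> snd c ` fst c" by (metis image_eqI)
    qed
  qed (rule that(1))
  have vel: "curve.vel 0 e' \<gamma> c t = a0" if e': "0 < e'" "e' \<le> e" and t: "t \<in> {0..e'}" for e' t
  proof -
    interpret C: metric_curve M A L D 0 e' \<gamma> by (rule curve[OF e'])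
    have "((\<lambda>t. x0 + t *\<^sub>R a0) has_vector_derivative a0) (at t within {0..e'})"
      by (auto intro!: derivative_eq_intros)
    then have "((\<lambda>t. snd c (\<gamma> t)) has_vector_derivative a0) (at t within {0..e'})"
      by (rule has_vector_derivative_transform[OF t, rotated]) (use VA(3) e' in auto)
    then show ?thesis
      unfolding C.vel_def o_def using vector_derivative_within_cbox[of 0 e' t "\<lambda>t. snd c (\<gamma> t)" a0] e' t by simp
  qed
  have parallel: "curve.parallel M D 0 e' \<gamma> V 0 e' W"
    if e': "0 < e'" "e' \<le> e" and W: "\<And>t. t \<in> {0..e} \<Longrightarrow> W t \<in> tangent_space M (\<gamma> t)"
      "\<And>t. t \<in> {0..e} \<Longrightarrow> ((\<lambda>\<tau>. W \<tau> c) has_vector_derivative - conn_form M D c (\<gamma> t, V t) a0 (W t c)) (at t within {0..e})"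
    for e' W
  proof -
    interpret C: metric_curve M A L D 0 e' \<gamma> by (rule curve[OF e'])
    have sub: "{0..e'} \<subseteq> {0..e}" using e' by auto
    show ?thesis
    proof (rule C.parallel_from_chart[OF order_refl c(1)])
      fix t assume t: "t \<in> {0..e'}"
      then have te: "t \<in> {0..e}" using sub by blast
      show "\<gamma> t \<in> fst c" "(\<gamma> t, V t) \<in> A" "W t \<in> tangent_space M (\<gamma> t)" using VA[OF te] W(1)[OF te] by auto
      show "((\<lambda>\<tau>. W \<tau> c) has_vector_derivative - conn_form M D c (\<gamma> t, V t) (curve.vel 0 e' \<gamma> c t) (W t c)) (at t within {0..e'})"
        unfolding vel[OF e' t] by (rule has_vector_derivative_within_subset[OF W(2)[OF te] sub])
    qed
  qed
  have Vtan: "V t \<in> tangent_space M (\<gamma> t)" if "t \<in> {0..e}" for t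
    using A_tangent[OF VA(1)[OF that]] by simp
  have dV: "((\<lambda>\<tau>. V \<tau> c) has_vector_derivative - conn_form M D c (\<gamma> t, V t) a0 (V t c)) (at t within {0..e})"
    if t: "t \<in> {0..e}" for t
  proof -
    have "(y has_vector_derivative - conn_form M D c (\<gamma> t, V t) a0 (V t c)) (at t within {0..e})"
      using dy[OF t] by (simp add: from_eq Vc[OF t])
    then show ?thesis by (rule has_vector_derivative_transform[OF t, rotated]) (rule Vc)
  qed
  note Vpar = parallel[OF _ _ Vtan dV]
  interpret E: metric_curve M A L D 0 e \<gamma> by (rule curve) (use e in auto)
  have Vtr: "is_transport M A D 0 e' \<gamma> (snd v) V" if e': "0 < e'" "e' \<le> e" for e'
  proof -
    interpret C: metric_curve M A L D 0 e' \<gamma> by (rule curve[OF e'])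
    show ?thesis unfolding C.is_transport_iff using VA(1) p Vpar[OF e'] e' by auto
  qed
  have VtrE: "is_transport M A D 0 e \<gamma> (snd v) V" using Vtr[of e] e by simp
  have Vf: "V \<in> fields_along M 0 e \<gamma>" by (rule E.is_transport_fields_along[OF VtrE])
  let ?u = "coord_vec M c (fst v) u" and ?w = "coord_vec M c (fst v) w"
  have tan: "?u \<in> tangent_space M (\<gamma> 0)" "?w \<in> tangent_space M (\<gamma> 0)"
    unfolding p by (rule coord_vec_tangent[OF c])+
  obtain U where U: "E.parallel V 0 e U" "U 0 = ?u" by (rule E.parallel_exists[OF Vf VA(1) tan(1)])
  obtain W where W: "E.parallel V 0 e W" "W 0 = ?w" by (rule E.parallel_exists[OF Vf VA(1) tan(2)])
  have dX: "((\<lambda>\<tau>. X \<tau> c) has_vector_derivative - conn_form M D c (\<gamma> t, V t) a0 (X t c)) (at t within {0..e})"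
    if X: "E.parallel V 0 e X" and t: "t \<in> {0..e}" for X t
    using E.parallel_has_vector_derivative[OF X t c(1) VA(2)[OF t]] vel[of e t] e(1) t by simp
  let ?\<phi> = "\<lambda>s. fundamental_tensor L (\<gamma> s, V s) (U s) (W s)"
  \<comment> \<open>For positive \<open>t\<close> the hypothesis is used on \<open>{0..t}\<close>,
    where the transports are the restrictions of \<open>V\<close>, \<open>U\<close> and
    \<open>W\<close>.\<close>
  have const: "?\<phi> t = ?\<phi> 0" if t: "t \<in> {0..e}" for t
  proof (cases "t = 0")
    case False
    then have t': "0 < t" "t \<le> e" using t by auto
    interpret C: metric_curve M A L D 0 t \<gamma> by (rule curve[OF t'])
    have U': "C.parallel V 0 t U" by (rule parallel[OF t' E.parallel_tangent[OF U(1)] dX[OF U(1)]])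
    have W': "C.parallel V 0 t W" by (rule parallel[OF t' E.parallel_tangent[OF W(1)] dX[OF W(1)]])
    have "(\<gamma> 0, snd v) \<in> A" using v p by simp
    then have "fundamental_tensor L (\<gamma> t, transport M A D 0 t \<gamma> (snd v))
        (transport_along M A D 0 t \<gamma> (snd v) ?u) (transport_along M A D 0 t \<gamma> (snd v) ?w)
        = fundamental_tensor L (\<gamma> 0, snd v) ?u ?w"
      using pres C.curve C.ab Vtr[OF t'] tan unfolding transport_preserves_metric_def transport_defined_def by blast
    then show ?thesis
      by (simp add: C.transport_eq[OF Vtr[OF t']] C.transport_along_eq[OF Vtr[OF t'] U' U(2)]
          C.transport_along_eq[OF Vtr[OF t'] W' W(2)] U(2) W(2) p)
  qed simp
  have 0: "0 \<in> {0..e}" using e by simp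
  \<comment> \<open>The one-sided derivative at 0 is computed twice, by the general formula and as
    that of a constant function; it is unique because \<open>{0..e}\<close> is
    nondegenerate.\<close>
  have d1: "(?\<phi> has_vector_derivative cov_form M L D c (\<gamma> 0, V 0) a0 (U 0 c) (W 0 c)) (at 0 within {0..e})"
    using E.has_vector_derivative_metric_along[OF VA(1) _ U(1) W(1) 0 c(1) VA(2)[OF 0]] Vpar[of e] vel[of e 0] e(1) by simp
  have "((\<lambda>s. ?\<phi> 0) has_vector_derivative 0) (at 0 within {0..e})" by (rule has_vector_derivative_const)
  then have d2: "(?\<phi> has_vector_derivative 0) (at 0 within {0..e})"
    by (rule has_vector_derivative_transform[OF 0, rotated]) (rule const)
  have "cov_form M L D c (\<gamma> 0, V 0) a0 (U 0 c) (W 0 c) = 0"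
    using vector_derivative_within_cbox[of 0 e 0 ?\<phi>, OF e(1) _ d1[folded box_real(2)]]
      vector_derivative_within_cbox[of 0 e 0 ?\<phi>, OF e(1) _ d2[folded box_real(2)]] e(1) by simp
  then show ?thesis by (simp add: p U(2) W(2) c)
qed

end

theorem proposition6:
  fixes M :: "('a::{t2_space, second_countable_topology}, 'n::finite) chart set"
    and A :: "('a, 'n) tbundle set"
    and L :: "('a, 'n) tbundle \<Rightarrow> real"
    and D :: "('a, 'n) operator"
  assumes "smooth_manifold M"
    and "open_in_bundle M A" and "fibrewise_conic A"
    and "\<forall>v\<in>A. snd v \<noteq> tzero" and "fst ` A = UNIV"
    and "pseudo_finsler M A L"
    and "levi_civita_chern M A L D"
  shows "anisotropic_connection M A D \<and> torsion_free M A D \<and> transport_preserves_metric M A L D \<and>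
    (\<forall>D'. anisotropic_connection M A D' \<and> torsion_free M A D' \<and> transport_preserves_metric M A L D'
       \<longrightarrow> connection_eq M A D' D)"
proof (intro conjI allI impI)
  show D: "anisotropic_connection M A D" "torsion_free M A D"
    using assms(7) unfolding levi_civita_chern_def by auto
  interpret metric_connection M A L D
    using assms D by unfold_locales
  have cov: "cov_form M L D c v x y z = 0" if "c \<in> M" "v \<in> A" "fst v \<in> fst c" for c v x y z
    using metric_parallel_cov_form[OF _ that(2,1,3)] assms(7) unfolding levi_civita_chern_def by blast
  show "transport_preserves_metric M A L D" by (rule transport_preserves_metric_if[OF cov])
  fix D' assume D': "anisotropic_connection M A D' \<and> torsion_free M A D' \<and> transport_preserves_metric M A L D'"
  interpret D': metric_connection M A L D'
    using D' by unfold_locales blast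
  show "connection_eq M A D' D"
    unfolding connection_eq_def
  proof (intro ballI)
    fix X Y v assume X: "X \<in> vector_fields M" and Y: "Y \<in> vector_fields M" and v: "v \<in> A"
    obtain c where c: "c \<in> M" "fst v \<in> fst c" by (rule chart_exists)
    \<comment> \<open>By \<open>D_chart\<close> two connections can differ in a chart only through
      their forms, and one chart around the base point decides equality of the values.\<close>
    have "conn_form M D' c v = conn_form M D c v"
    proof (rule conn_form_unique[OF _ D(2) _ _ _ _ v c])
      show "metric_connection M A L D" "metric_connection M A L D'" by unfold_locales
      show "torsion_free M A D'" using D' by blast
      show "cov_form M L D c v a b d = 0" for a b d by (rule cov[OF c(1) v c(2)])
      show "cov_form M L D' c v a b d = 0" for a b d
        by (rule D'.cov_form_zero_if_preserves[OF _ v c]) (use D' in blast)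
    qed
    then have "D' X Y v c = D X Y v c"
      unfolding D'.D_chart[OF X Y v c] D_chart[OF X Y v c] by simp
    then show "D' X Y v = D X Y v"
      by (rule tangent_eqI[OF D'.D_tangent[OF X Y v] D_tangent[OF X Y v] c])
  qed
qed

end
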